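(* Let $2 \ge r > 1$ and $s \ge s(r) = \frac{1}{2} - \frac{1}{2r}$. Then for all $b' < 0$ and $b > \frac{1}{r}$ there is a constant $c$ such that \[ \Big\| \partial_x \Big( \prod_{i=1}^3 u_i \Big) \Big\|_{X^r_{s,b'}} \le c \prod_{i=1}^3 \|u_i\|_{X^r_{s,b}} \] for all $u_1,u_2,u_3 \in X^r_{s,b}$.
   Context: For $1 \le r \le \infty$ let $r'$ be the conjugate exponent, $\frac{1}{r}+\frac{1}{r'}=1$, and $\langle \xi \rangle = (1+\xi^2)^{1/2}$. For space-time functions $f(x,t)$ with space-time Fourier transform $\widehat{f}(\xi,\tau)$, the space $X^r_{s,b}$ is defined by the norm \[ \|f\|_{X^r_{s,b}} := \Big( \int d\xi\, d\tau\, \langle \xi \rangle^{s r'} \langle \tau - \xi^3 \rangle^{b r'} |\widehat{f}(\xi,\tau)|^{r'} \Big)^{1/r'}. \] *)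

theory Defs
  imports "HOL-Analysis.Analysis"
begin

text \<open>Elements of X^r_{s,b} are represented by their space-time Fourier transforms
  F :: real * real => complex, F(xi,tau) = hat f(xi,tau).\<close>

definition japan :: "real \<Rightarrow> real" where
  "japan \<xi> = sqrt (1 + \<xi>\<^sup>2)"

definition conj_exp :: "real \<Rightarrow> real" where
  "conj_exp r = r / (r - 1)"

definition Xweight :: "real \<Rightarrow> real \<Rightarrow> real \<Rightarrow> real \<times> real \<Rightarrow> real" where
  "Xweight r s b z = japan (fst z) powr (s * conj_exp r)
                     * japan (snd z - (fst z)^3) powr (b * conj_exp r)"

definition Xpow :: "real \<Rightarrow> real \<Rightarrow> real \<Rightarrow> (real \<times> real \<Rightarrow> complex) \<Rightarrow> ennreal" where
  "Xpow r s b F = (\<integral>\<^sup>+ z. ennreal (Xweight r s b z * cmod (F z) powr conj_exp r) \<partial>lborel)"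

definition Xspace :: "real \<Rightarrow> real \<Rightarrow> real \<Rightarrow> (real \<times> real \<Rightarrow> complex) set" where
  "Xspace r s b = {F. F \<in> borel_measurable lborel \<and> Xpow r s b F < \<infinity>}"

definition Xnorm :: "real \<Rightarrow> real \<Rightarrow> real \<Rightarrow> (real \<times> real \<Rightarrow> complex) \<Rightarrow> real" where
  "Xnorm r s b F = enn2real (Xpow r s b F) powr (1 / conj_exp r)"

text \<open>Fourier transform of  d/dx (u1 u2 u3)  in terms of the Fourier transforms
  F_i of u_i, with the convention hat f(xi,tau) = int e^{-i(x xi + t tau)} f(x,t) dx dt:
  i xi (2 pi)^{-4} (F1 * F2 * F3)(xi,tau).\<close>
definition dx_triple ::
  "(real \<times> real \<Rightarrow> complex) \<Rightarrow> (real \<times> real \<Rightarrow> complex) \<Rightarrow> (real \<times> real \<Rightarrow> complex)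
     \<Rightarrow> real \<times> real \<Rightarrow> complex" where
  "dx_triple F1 F2 F3 z =
     \<i> * complex_of_real (fst z) * complex_of_real (1 / (2 * pi) ^ 4) *
     (LINT w :: (real \<times> real) \<times> (real \<times> real) | lborel.
        F1 (fst w) * F2 (snd w) *
        F3 (fst z - fst (fst w) - fst (snd w), snd z - snd (fst w) - snd (snd w)))"

end

(*
Put p = r' >= 2 and xi = x + y + w. Since b > 1/r, Hoelder's inequality in the modulations reduces the
estimate to bounds in the frequencies x, y, w alone, and only the case s = 1/(2p) matters, as
<xi> <= 4 <x><y><w>. One function, say that of w, is isolated: the integrand is split by Hoelder
with exponents p, p, p/(p-2) into a factor carrying the other two functions, a factor carrying the
isolated one and a factor without functions. The second factor is harmless because, for fixed xi and w,
the resonance function xi^3 - x^3 - y^3 - w^3 = 3 (x+y)(y+w)(w+x) is quadratic in x with derivative of size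
3 |x^2 - y^2|. The same substitution reduces the third factor to a one-dimensional integral, and the
first factor to an integral in w only. The frequency space is cut into regions in each of which a
suitable function can be isolated; b' < 0 enters only through <tau - xi^3>^b' <= 1.
*)
theory Submission
  imports Defs
begin

section \<open>Iterated integrals over frequency triples\<close>

text \<open>Writing \<open>U\<close> for the weight times the p-th power of |F| turns the hypotheses
  into bounds on masses and leaves two conditions on frequencies, \<open>H1\<close> and
  \<open>H3\<close> in \<open>controlled_Schur\<close>. With \<open>V\<close> = |\<xi>| and |.| in
  place of the brackets, both are scale invariant: the multiplier has degree -1, so
  \<open>H1\<close> has degree 2 - 1 - 2 + 1 = 0, and in \<open>H3\<close> the degree 1 + 2 matches
  the cubic resonance function. So nothing may be wasted, not even a logarithm. The obstacle is the
  zero set of the Jacobian, which is gained in one factor and has to be divided out elsewhere.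
  Isolating the smallest frequency works unless the Jacobian of the two largest is too small; then
  another function is isolated. Two configurations resist this, since there the Jacobians of all
  three pairs vanish: frequencies near \<xi>/3, \<xi>/3, \<xi>/3 and frequencies near \<xi>, \<xi>,
  -\<xi>. Near the first, the distance to it can be read off from the value of the resonance
  function. Near the second, two factors of the resonance function are small, and a power of their
  ratio is traded between \<open>H1\<close> and \<open>H3\<close>.\<close>

lemma nn_integral_lborel_pair:
  fixes f :: "'a::euclidean_space \<times> 'b::euclidean_space \<Rightarrow> ennreal"
  assumes "f \<in> borel_measurable (borel \<Otimes>\<^sub>M borel)"
  shows "(\<integral>\<^sup>+z. f z \<partial>lborel) = (\<integral>\<^sup>+x. \<integral>\<^sup>+y. f (x, y) \<partial>lborel \<partial>lborel)"
proof -
  have "(\<integral>\<^sup>+x. \<integral>\<^sup>+y. f (x, y) \<partial>lborel \<partial>lborel) = integral\<^sup>N (lborel \<Otimes>\<^sub>M lborel) f"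
    by (rule lborel.nn_integral_fst) (use assms in \<open>simp add: lborel_prod borel_prod\<close>)
  then show ?thesis by (simp add: lborel_prod)
qed

lemma nn_integral_lborel_swap:
  fixes f :: "'a::euclidean_space \<Rightarrow> 'b::euclidean_space \<Rightarrow> ennreal"
  assumes "(\<lambda>(x, y). f x y) \<in> borel_measurable (borel \<Otimes>\<^sub>M borel)"
  shows "(\<integral>\<^sup>+x. \<integral>\<^sup>+y. f x y \<partial>lborel \<partial>lborel) = (\<integral>\<^sup>+y. \<integral>\<^sup>+x. f x y \<partial>lborel \<partial>lborel)"
proof -
  have "(\<lambda>(x, y). f x y) \<in> borel_measurable (lborel \<Otimes>\<^sub>M lborel)"
    using assms by (simp add: lborel_prod borel_prod)
  from lborel_pair.Fubini'[OF this] show ?thesis by simp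
qed

lemma nn_integral_lborel_translate:
  fixes f :: "'a::euclidean_space \<Rightarrow> ennreal"
  assumes [measurable]: "f \<in> borel_measurable borel"
  shows "(\<integral>\<^sup>+x. f (x - a) \<partial>lborel) = (\<integral>\<^sup>+x. f x \<partial>lborel)"
proof -
  have "(\<integral>\<^sup>+x. f x \<partial>lborel) = (\<integral>\<^sup>+x. f x \<partial>distr lborel borel ((+) (- a)))"
    by (simp add: lborel_distr_plus)
  also have "\<dots> = (\<integral>\<^sup>+x. f (x - a) \<partial>lborel)"
    by (subst nn_integral_distr) auto
  finally show ?thesis by simp
qed

lemma nn_integral_lborel_reflect:
  fixes f :: "'a::euclidean_space \<Rightarrow> ennreal"
  assumes [measurable]: "f \<in> borel_measurable borel"
  shows "(\<integral>\<^sup>+x. f (a - x) \<partial>lborel) = (\<integral>\<^sup>+x. f x \<partial>lborel)"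
proof -
  have "(\<integral>\<^sup>+x. f x \<partial>lborel) = (\<integral>\<^sup>+x. f x \<partial>density (distr lborel borel (\<lambda>x. a + (-1) *\<^sub>R x)) (\<lambda>_. ennreal (\<bar>-1\<bar>^DIM('a))))"
    by (subst lborel_affine[of "-1" a, symmetric]) auto
  also have "\<dots> = (\<integral>\<^sup>+x. f (a - x) \<partial>lborel)"
    by (subst nn_integral_density, simp, simp, subst nn_integral_distr) auto
  finally show ?thesis by simp
qed

section \<open>Quadratic substitutions on the line\<close>

text \<open>The substitution \<open>u = x\<^sup>2\<close> is made on the compact intervals
  \<open>{0..real n}\<close>; monotone convergence in \<open>n\<close> then gives the half
  line.\<close>

lemma nn_integral_quadratic_half:
  fixes g :: "real \<Rightarrow> ennreal"
  assumes [measurable]: "g \<in> borel_measurable borel"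
  shows "(\<integral>\<^sup>+x. ennreal (2 * x) * g (x\<^sup>2) * indicator {0..} x \<partial>lborel) \<le> (\<integral>\<^sup>+u. g u * indicator {0..} u \<partial>lborel)"
proof -
  have bd: "(\<integral>\<^sup>+x. ennreal (2 * x) * g (x\<^sup>2) * indicator {0..real n} x \<partial>lborel)
        \<le> (\<integral>\<^sup>+u. g u * indicator {0..} u \<partial>lborel)" for n
  proof -
    have "(\<integral>\<^sup>+x. g x * indicator {0\<^sup>2..(real n)\<^sup>2} x \<partial>lborel)
         = (\<integral>\<^sup>+x. g (x\<^sup>2) * ennreal (2 * x) * indicator {0..real n} x \<partial>lborel)"
    proof (cases "n = 0")
      case True
      have "AE x::real in lborel. x \<noteq> 0" by (rule AE_lborel_singleton)
      then have "AE x in lborel. g x * indicator {0..0} x = 0"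
         "AE x in lborel. g (x\<^sup>2) * ennreal (2 * x) * indicator {0..0} x = 0"
        by (auto elim!: eventually_mono)
      with True show ?thesis by (simp add: nn_integral_0_iff_AE)
    next
      case False
      then show ?thesis
        by (intro nn_integral_substitution_aux[where g = "\<lambda>x. x\<^sup>2"])
           (auto intro!: derivative_eq_intros continuous_intros)
    qed
    then have "(\<integral>\<^sup>+x. ennreal (2 * x) * g (x\<^sup>2) * indicator {0..real n} x \<partial>lborel)
         = (\<integral>\<^sup>+x. g x * indicator {0\<^sup>2..(real n)\<^sup>2} x \<partial>lborel)"
      by (simp add: mult.commute)
    also have "\<dots> \<le> (\<integral>\<^sup>+u. g u * indicator {0..} u \<partial>lborel)"
      by (rule nn_integral_mono) (auto split: split_indicator)
    finally show ?thesis .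
  qed
  have "(\<integral>\<^sup>+x. ennreal (2 * x) * g (x\<^sup>2) * indicator {0..} x \<partial>lborel)
      = (\<integral>\<^sup>+x. (SUP n. ennreal (2 * x) * g (x\<^sup>2) * indicator {0..real n} x) \<partial>lborel)"
  proof (rule nn_integral_cong)
    fix x :: real
    have "(SUP n. indicator {0..real n} x) = (indicator {0..} x :: ennreal)"
    proof (cases "x \<ge> 0")
      case True
      obtain n where "x \<le> real n" using real_arch_simple by blast
      with True have "indicator {0..real n} x = (1::ennreal)" by simp
      then have "(1::ennreal) \<le> (SUP n. indicator {0..real n} x)" by (metis SUP_upper UNIV_I)
      moreover have "(SUP n. indicator {0..real n} x) \<le> (1::ennreal)"
        by (rule SUP_least) (auto split: split_indicator)
      ultimately show ?thesis using True by simp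
    qed auto
    then show "ennreal (2 * x) * g (x\<^sup>2) * indicator {0..} x = (SUP n. ennreal (2 * x) * g (x\<^sup>2) * indicator {0..real n} x)"
      by (simp add: SUP_mult_left_ennreal[symmetric])
  qed
  also have "\<dots> = (SUP n. \<integral>\<^sup>+x. ennreal (2 * x) * g (x\<^sup>2) * indicator {0..real n} x \<partial>lborel)"
    by (rule nn_integral_monotone_convergence_SUP)
       (auto simp: incseq_def le_fun_def split: split_indicator)
  also have "\<dots> \<le> (\<integral>\<^sup>+u. g u * indicator {0..} u \<partial>lborel)"
    by (rule SUP_least) (rule bd)
  finally show ?thesis .
qed

text \<open>The parabola c + k (x - m)^2 takes each value at most twice, and its derivative has
  modulus 2 |k (x - m)|. The weight is half of this, which pays for the two branches, so the
  constant is 1 whatever \<open>k\<close>, \<open>m\<close> and \<open>c\<close> are.\<close>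

lemma nn_integral_quadratic:
  fixes g :: "real \<Rightarrow> ennreal"
  assumes [measurable]: "g \<in> borel_measurable borel"
  shows "(\<integral>\<^sup>+x. ennreal \<bar>k * (x - m)\<bar> * g (c + k * (x - m)\<^sup>2) \<partial>lborel) \<le> (\<integral>\<^sup>+u. g u \<partial>lborel)"
proof (cases "k = 0")
  case False
  \<comment> \<open>The factor |k| / 2 makes the integral of \<open>F\<close> half of that of
    \<open>g\<close>: each of the two half lines contributes at most this much.\<close>
  define F where "F x = ennreal (\<bar>k\<bar> / 2) * g (c + k * x)" for x
  have [measurable]: "F \<in> borel_measurable borel" unfolding F_def by measurable
  let ?H = "\<integral>\<^sup>+x. ennreal (2 * x) * F (x\<^sup>2) * indicator {0..} x \<partial>lborel"
  have IF: "2 * (\<integral>\<^sup>+x. F x \<partial>lborel) = (\<integral>\<^sup>+u. g u \<partial>lborel)"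
  proof -
    have "(\<integral>\<^sup>+u. g u \<partial>lborel) = ennreal \<bar>k\<bar> * (\<integral>\<^sup>+x. g (c + k * x) \<partial>lborel)"
      using False by (intro nn_integral_real_affine) auto
    also have "\<dots> = 2 * (ennreal (\<bar>k\<bar> / 2) * (\<integral>\<^sup>+x. g (c + k * x) \<partial>lborel))"
    proof -
      have "ennreal \<bar>k\<bar> = 2 * ennreal (\<bar>k\<bar> / 2)"
        by (subst ennreal_numeral[symmetric], subst ennreal_mult[symmetric]) auto
      then show ?thesis by (simp add: mult.assoc)
    qed
    also have "\<dots> = 2 * (\<integral>\<^sup>+x. F x \<partial>lborel)"
      unfolding F_def by (subst nn_integral_cmult) auto
    finally show ?thesis by simp
  qed
  have half: "?H \<le> (\<integral>\<^sup>+x. F x \<partial>lborel)"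
    by (rule order_trans[OF nn_integral_quadratic_half], simp)
       (auto intro!: nn_integral_mono split: split_indicator)
  have refl: "(\<integral>\<^sup>+x. ennreal (2 * (0 - x)) * F ((0 - x)\<^sup>2) * indicator {0..} (0 - x) \<partial>lborel) = ?H"
    by (rule nn_integral_lborel_reflect) measurable
  have "(\<integral>\<^sup>+x. ennreal \<bar>k * (x - m)\<bar> * g (c + k * (x - m)\<^sup>2) \<partial>lborel)
      = (\<integral>\<^sup>+x. ennreal \<bar>k * x\<bar> * g (c + k * x\<^sup>2) \<partial>lborel)"
    by (rule nn_integral_lborel_translate[where f = "\<lambda>x. ennreal \<bar>k * x\<bar> * g (c + k * x\<^sup>2)"]) measurable
  also have "\<dots> \<le> (\<integral>\<^sup>+x. (ennreal (2 * x) * F (x\<^sup>2) * indicator {0..} x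
                + ennreal (2 * (0 - x)) * F ((0 - x)\<^sup>2) * indicator {0..} (0 - x)) \<partial>lborel)"
  proof (rule nn_integral_mono)
    fix x :: real
    have E: "ennreal (2 * y) * F (x\<^sup>2) = ennreal \<bar>k * y\<bar> * g (c + k * x\<^sup>2)" if "y \<ge> 0" for y
    proof -
      have "ennreal (2 * y) * ennreal (\<bar>k\<bar> / 2) = ennreal \<bar>k * y\<bar>"
        using that by (subst ennreal_mult[symmetric]) (auto simp: abs_mult)
      then show ?thesis by (simp add: F_def mult.assoc[symmetric])
    qed
    show "ennreal \<bar>k * x\<bar> * g (c + k * x\<^sup>2) \<le> ennreal (2 * x) * F (x\<^sup>2) * indicator {0..} x
                + ennreal (2 * (0 - x)) * F ((0 - x)\<^sup>2) * indicator {0..} (0 - x)"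
    proof (cases "x \<ge> 0")
      case True
      then have "ennreal \<bar>k * x\<bar> * g (c + k * x\<^sup>2) = ennreal (2 * x) * F (x\<^sup>2) * indicator {0..} x"
        by (subst E[OF True, symmetric]) simp
      then show ?thesis by (metis add_increasing2 order_refl zero_le)
    next
      case False
      then show ?thesis using E[of "- x"] by simp
    qed
  qed
  also have "\<dots> = ?H + ?H"
    by (subst nn_integral_add) (simp_all add: refl[simplified])
  also have "\<dots> \<le> 2 * (\<integral>\<^sup>+x. F x \<partial>lborel)"
    using add_mono[OF half half] by (simp only: mult_2[of "integral\<^sup>N lborel F"])
  finally show ?thesis unfolding IF .
qed simp

section \<open>Threefold convolution integrals\<close>

text \<open>The integral of \<open>K\<close> over the plane u + v + w = z. It is used for points of
  the Fourier plane, for frequencies alone and for time frequencies alone, hence the general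
  type.\<close>

definition tri :: "('a::euclidean_space \<Rightarrow> 'a \<Rightarrow> 'a \<Rightarrow> ennreal) \<Rightarrow> 'a \<Rightarrow> ennreal" where
  "tri K z = (\<integral>\<^sup>+u. \<integral>\<^sup>+v. K u v (z - u - v) \<partial>lborel \<partial>lborel)"

definition measurable3 :: "('a::euclidean_space \<Rightarrow> 'a \<Rightarrow> 'a \<Rightarrow> 'b::topological_space) \<Rightarrow> bool" where
  "measurable3 K \<longleftrightarrow> (\<lambda>(u, v, w). K u v w) \<in> borel_measurable (borel \<Otimes>\<^sub>M borel \<Otimes>\<^sub>M borel)"

text \<open>Serves as a local measurability rule, through which \<open>measurable\<close> can handle
  an abstract kernel applied to three arguments.\<close>

lemma measurable3_compose:
  assumes "measurable3 K" and f: "f \<in> borel_measurable M" "g \<in> borel_measurable M" "h \<in> borel_measurable M"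
  shows "(\<lambda>x. K (f x) (g x) (h x)) \<in> borel_measurable M"
proof -
  have "(\<lambda>x. (f x, g x, h x)) \<in> measurable M (borel \<Otimes>\<^sub>M borel \<Otimes>\<^sub>M borel)"
    using f by measurable
  from measurable_compose[OF this assms(1)[unfolded measurable3_def]] show ?thesis by simp
qed

lemma measurable3_permute:
  assumes "measurable3 K"
  shows "measurable3 (\<lambda>u v w. K v u w)" "measurable3 (\<lambda>u v w. K u w v)"
proof -
  note measurable3_compose[OF assms, measurable (raw)]
  show "measurable3 (\<lambda>u v w. K v u w)" "measurable3 (\<lambda>u v w. K u w v)"
    unfolding measurable3_def by measurable
qed

lemma tri_cong: "(\<And>u v w. u + v + w = z \<Longrightarrow> K u v w = K' u v w) \<Longrightarrow> tri K z = tri K' z"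
  unfolding tri_def by (intro nn_integral_cong) simp

lemma tri_mono: "(\<And>u v w. u + v + w = z \<Longrightarrow> K u v w \<le> K' u v w) \<Longrightarrow> tri K z \<le> tri K' z"
  unfolding tri_def by (intro nn_integral_mono) simp

lemma tri_swap12:
  assumes "measurable3 K"
  shows "tri (\<lambda>u v w. K v u w) z = tri K z"
proof -
  note measurable3_compose[OF assms, measurable (raw)]
  have "tri (\<lambda>u v w. K v u w) z = (\<integral>\<^sup>+v. \<integral>\<^sup>+u. K v u (z - u - v) \<partial>lborel \<partial>lborel)"
    unfolding tri_def by (rule nn_integral_lborel_swap) measurable
  also have "\<dots> = tri K z"
    unfolding tri_def by (rule nn_integral_cong, rule nn_integral_cong) (simp add: algebra_simps)
  finally show ?thesis .
qed

lemma tri_swap23: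
  assumes "measurable3 K"
  shows "tri (\<lambda>u v w. K u w v) z = tri K z"
  unfolding tri_def
proof (rule nn_integral_cong)
  fix u :: 'a
  note measurable3_compose[OF assms, measurable (raw)]
  have "(\<integral>\<^sup>+v. K u (z - u - v) (z - u - (z - u - v)) \<partial>lborel) = (\<integral>\<^sup>+v. K u v (z - u - v) \<partial>lborel)"
    by (rule nn_integral_lborel_reflect[where f = "\<lambda>v. K u v (z - u - v)"]) measurable
  then show "(\<integral>\<^sup>+v. K u (z - u - v) v \<partial>lborel) = (\<integral>\<^sup>+v. K u v (z - u - v) \<partial>lborel)"
    by simp
qed

lemma tri_add:
  assumes "measurable3 K" "measurable3 L"
  shows "tri (\<lambda>u v w. K u v w + L u v w) z = tri K z + tri L z"
proof -
  note measurable3_compose[OF assms(1), measurable (raw)] measurable3_compose[OF assms(2), measurable (raw)]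
  have "tri (\<lambda>u v w. K u v w + L u v w) z
      = (\<integral>\<^sup>+u. (\<integral>\<^sup>+v. K u v (z - u - v) \<partial>lborel) + (\<integral>\<^sup>+v. L u v (z - u - v) \<partial>lborel) \<partial>lborel)"
    unfolding tri_def by (intro nn_integral_cong nn_integral_add) measurable
  also have "\<dots> = tri K z + tri L z"
    unfolding tri_def by (rule nn_integral_add) measurable
  finally show ?thesis .
qed

lemma tri_measurable:
  assumes "measurable3 K"
  shows "tri K \<in> borel_measurable borel"
proof -
  note measurable3_compose[OF assms, measurable (raw)]
  show ?thesis unfolding tri_def[abs_def] by measurable
qed

lemma nn_integral_tri:
  assumes "measurable3 K"
  shows "(\<integral>\<^sup>+z. tri K z \<partial>lborel) = (\<integral>\<^sup>+u. \<integral>\<^sup>+v. \<integral>\<^sup>+w. K u v w \<partial>lborel \<partial>lborel \<partial>lborel)"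
proof -
  note measurable3_compose[OF assms, measurable (raw)]
  have "(\<integral>\<^sup>+z. tri K z \<partial>lborel) = (\<integral>\<^sup>+u. \<integral>\<^sup>+z. \<integral>\<^sup>+v. K u v (z - u - v) \<partial>lborel \<partial>lborel \<partial>lborel)"
    unfolding tri_def by (rule nn_integral_lborel_swap) measurable
  also have "\<dots> = (\<integral>\<^sup>+u. \<integral>\<^sup>+v. \<integral>\<^sup>+z. K u v (z - u - v) \<partial>lborel \<partial>lborel \<partial>lborel)"
    by (intro nn_integral_cong nn_integral_lborel_swap) measurable
  also have "\<dots> = (\<integral>\<^sup>+u. \<integral>\<^sup>+v. \<integral>\<^sup>+w. K u v w \<partial>lborel \<partial>lborel \<partial>lborel)"
  proof (rule nn_integral_cong, rule nn_integral_cong)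
    fix u v :: 'a
    have "(\<integral>\<^sup>+z. K u v (z - (u + v)) \<partial>lborel) = (\<integral>\<^sup>+w. K u v w \<partial>lborel)"
      by (rule nn_integral_lborel_translate) measurable
    then show "(\<integral>\<^sup>+z. K u v (z - u - v) \<partial>lborel) = (\<integral>\<^sup>+w. K u v w \<partial>lborel)"
      by (simp add: diff_diff_add)
  qed
  finally show ?thesis .
qed

text \<open>Fubini in the form needed to integrate out the modulations while the frequencies are
  fixed: only the variables \<open>s\<close> and \<open>y\<close> have to change places.\<close>

lemma tri_iterated:
  fixes K :: "real \<times> real \<Rightarrow> real \<times> real \<Rightarrow> real \<times> real \<Rightarrow> ennreal"
  assumes "measurable3 K"
  shows "tri K z = tri (\<lambda>x y w. tri (\<lambda>s t q. K (x, s) (y, t) (w, q)) (snd z)) (fst z)"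
proof -
  note measurable3_compose[OF assms, measurable (raw)]
  have 1: "tri K z = (\<integral>\<^sup>+x. \<integral>\<^sup>+s. \<integral>\<^sup>+v. K (x, s) v (z - (x, s) - v) \<partial>lborel \<partial>lborel \<partial>lborel)"
    unfolding tri_def
    by (rule nn_integral_lborel_pair) (unfold borel_prod, measurable)
  have 2: "(\<integral>\<^sup>+v. K (x, s) v (z - (x, s) - v) \<partial>lborel) =
       (\<integral>\<^sup>+y. \<integral>\<^sup>+t. K (x, s) (y, t) (z - (x, s) - (y, t)) \<partial>lborel \<partial>lborel)" for x s
    by (rule nn_integral_lborel_pair) (unfold borel_prod, measurable)
  have 3: "(\<integral>\<^sup>+s. \<integral>\<^sup>+y. \<integral>\<^sup>+t. K (x, s) (y, t) (z - (x, s) - (y, t)) \<partial>lborel \<partial>lborel \<partial>lborel)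
     = (\<integral>\<^sup>+y. \<integral>\<^sup>+s. \<integral>\<^sup>+t. K (x, s) (y, t) (z - (x, s) - (y, t)) \<partial>lborel \<partial>lborel \<partial>lborel)" for x
    by (rule nn_integral_lborel_swap) measurable
  show ?thesis unfolding 1 2 3 by (cases z) (simp add: tri_def)
qed

section \<open>Japanese brackets and elementary one-dimensional integrals\<close>

lemma japan_ge_1: "1 \<le> japan x"
  and japan_pos [simp]: "0 < japan x"
  and abs_le_japan: "\<bar>x\<bar> \<le> japan x"
  and japan_le: "japan x \<le> 1 + \<bar>x\<bar>"
proof -
  show 1: "1 \<le> japan x" by (simp add: japan_def)
  then show "0 < japan x" by linarith
  show "\<bar>x\<bar> \<le> japan x" unfolding japan_def by (rule real_le_rsqrt) simp
  show "japan x \<le> 1 + \<bar>x\<bar>"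
    unfolding japan_def by (rule real_le_lsqrt) (auto simp: power2_eq_square algebra_simps)
qed

lemma japan_nonneg [simp]: "0 \<le> japan x" and japan_neq_0 [simp]: "japan x \<noteq> 0"
  using japan_pos[of x] by linarith+

lemma japan_measurable [measurable]: "japan \<in> borel_measurable borel"
  unfolding japan_def[abs_def] by measurable

lemma japan_scale: "1 \<le> k \<Longrightarrow> \<bar>x\<bar> \<le> k * \<bar>y\<bar> \<Longrightarrow> japan x \<le> k * japan y"
proof -
  assume k: "1 \<le> k" "\<bar>x\<bar> \<le> k * \<bar>y\<bar>"
  have "x\<^sup>2 \<le> (k * \<bar>y\<bar>)\<^sup>2" using k by (metis abs_ge_zero power2_abs power_mono)
  moreover have "1 \<le> k\<^sup>2" using k by simp
  ultimately have "1 + x\<^sup>2 \<le> k\<^sup>2 * (1 + y\<^sup>2)" by (simp add: power_mult_distrib algebra_simps)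
  then have "sqrt (1 + x\<^sup>2) \<le> sqrt (k\<^sup>2 * (1 + y\<^sup>2))" by (rule real_sqrt_le_mono)
  then show ?thesis using k by (simp add: japan_def real_sqrt_mult)
qed

lemma nn_integral_powr_tail:
  fixes a q :: real
  assumes "a > 0" "q > 1"
  shows "(\<integral>\<^sup>+x. ennreal (x powr - q) * indicator {a..} x \<partial>lborel) = ennreal (a powr (1 - q) / (q - 1))"
proof -
  have d: "\<And>x. a \<le> x \<Longrightarrow> DERIV (\<lambda>x. x powr (1 - q) / (1 - q)) x :> x powr - q"
  proof -
    fix x assume "a \<le> x"
    then have "DERIV (\<lambda>x. x powr (1 - q) / (1 - q)) x :> (1 - q) * x powr (1 - q - 1) / (1 - q)"
      using assms by (intro DERIV_cdivide has_real_derivative_powr) auto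
    then show "DERIV (\<lambda>x. x powr (1 - q) / (1 - q)) x :> x powr - q"
      using assms by simp
  qed
  have "((\<lambda>x. x powr (1 - q)) \<longlongrightarrow> 0) at_top"
    using assms by (intro tendsto_neg_powr filterlim_ident) auto
  then have l: "((\<lambda>x. x powr (1 - q) / (1 - q)) \<longlongrightarrow> 0) at_top"
    by (rule tendsto_divide_zero)
  have "(\<integral>\<^sup>+x. ennreal (x powr - q) * indicator {a..} x \<partial>lborel) = ennreal (0 - a powr (1 - q) / (1 - q))"
    by (rule nn_integral_FTC_atLeast[OF _ d _ l]) auto
  also have "0 - a powr (1 - q) / (1 - q) = a powr (1 - q) / (q - 1)"
    using assms by (simp add: field_simps)
  finally show ?thesis .
qed

lemma nn_integral_even_le:
  fixes f :: "real \<Rightarrow> ennreal"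
  assumes [measurable]: "f \<in> borel_measurable borel"
  shows "(\<integral>\<^sup>+x. f \<bar>x\<bar> \<partial>lborel) \<le> 2 * (\<integral>\<^sup>+x. f x * indicator {0..} x \<partial>lborel)"
proof -
  have "(\<integral>\<^sup>+x. f \<bar>x\<bar> \<partial>lborel) \<le> (\<integral>\<^sup>+x. f x * indicator {0..} x + f (0 - x) * indicator {0..} (0 - x) \<partial>lborel)"
    by (rule nn_integral_mono) (auto split: split_indicator)
  also have "\<dots> = (\<integral>\<^sup>+x. f x * indicator {0..} x \<partial>lborel) + (\<integral>\<^sup>+x. f (0 - x) * indicator {0..} (0 - x) \<partial>lborel)"
    by (rule nn_integral_add) measurable
  also have "(\<integral>\<^sup>+x. f (0 - x) * indicator {0..} (0 - x) \<partial>lborel) = (\<integral>\<^sup>+x. f x * indicator {0..} x \<partial>lborel)"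
    by (rule nn_integral_lborel_reflect) measurable
  finally show ?thesis by (simp only: mult_2)
qed

lemma nn_integral_powr_tail_even:
  fixes a q :: real
  assumes "a > 0" "q > 1"
  shows "(\<integral>\<^sup>+x. ennreal (if a \<le> \<bar>x\<bar> then \<bar>x\<bar> powr - q else 0) \<partial>lborel) \<le> ennreal (2 * a powr (1 - q) / (q - 1))"
proof -
  have "(\<integral>\<^sup>+x. ennreal (if a \<le> \<bar>x\<bar> then \<bar>x\<bar> powr - q else 0) \<partial>lborel)
      \<le> 2 * (\<integral>\<^sup>+x. ennreal (if a \<le> x then x powr - q else 0) * indicator {0..} x \<partial>lborel)"
    by (rule nn_integral_even_le[where f = "\<lambda>x. ennreal (if a \<le> x then x powr - q else 0)"]) measurable
  also have "(\<integral>\<^sup>+x. ennreal (if a \<le> x then x powr - q else 0) * indicator {0..} x \<partial>lborel)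
     = (\<integral>\<^sup>+x. ennreal (x powr - q) * indicator {a..} x \<partial>lborel)"
    using assms by (intro nn_integral_cong) (auto split: split_indicator)
  also have "\<dots> = ennreal (a powr (1 - q) / (q - 1))"
    by (rule nn_integral_powr_tail[OF assms])
  also have "2 * \<dots> = ennreal (2 * a powr (1 - q) / (q - 1))"
    using assms by (subst ennreal_numeral[symmetric], subst ennreal_mult[symmetric]) auto
  finally show ?thesis .
qed

lemma nn_integral_japan_powr:
  assumes "q > 1"
  obtains B where "B > 0" "(\<integral>\<^sup>+x. ennreal (japan x powr - q) \<partial>lborel) \<le> ennreal B"
proof
  show "(2 + 2 / (q - 1)) > 0" using assms by (simp add: add_pos_pos)
  have "(\<integral>\<^sup>+x. ennreal (japan x powr - q) \<partial>lborel)
     \<le> (\<integral>\<^sup>+x. indicator {-1..1} x + ennreal (if 1 \<le> \<bar>x\<bar> then \<bar>x\<bar> powr - q else 0) \<partial>lborel)"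
  proof (rule nn_integral_mono)
    fix x :: real
    show "ennreal (japan x powr - q) \<le> indicator {-1..1} x + ennreal (if 1 \<le> \<bar>x\<bar> then \<bar>x\<bar> powr - q else 0)"
    proof (cases "1 \<le> \<bar>x\<bar>")
      case True
      then have "japan x powr - q \<le> \<bar>x\<bar> powr - q"
        using assms abs_le_japan by (intro powr_mono2') auto
      then show ?thesis using True by (auto intro!: add_increasing ennreal_leI)
    next
      case False
      have "japan x powr - q \<le> 1"
        using assms japan_ge_1[of x] powr_mono2'[of "-q" 1 "japan x"] by simp
      then show ?thesis using False by (auto simp: ennreal_le_1 abs_le_iff split: split_indicator)
    qed
  qed
  also have "\<dots> = (\<integral>\<^sup>+x. indicator {-1..1::real} x \<partial>lborel) + (\<integral>\<^sup>+x. ennreal (if 1 \<le> \<bar>x\<bar> then \<bar>x\<bar> powr - q else 0) \<partial>lborel)"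
    by (rule nn_integral_add) measurable
  also have "\<dots> \<le> ennreal 2 + ennreal (2 * 1 powr (1 - q) / (q - 1))"
    using nn_integral_powr_tail_even[of 1 q] assms by (intro add_mono) auto
  also have "\<dots> = ennreal (2 + 2 / (q - 1))"
    using assms by (subst ennreal_plus[symmetric]) auto
  finally show "(\<integral>\<^sup>+x. ennreal (japan x powr - q) \<partial>lborel) \<le> ennreal (2 + 2 / (q - 1))" .
qed

lemma nn_integral_inverse_sqrt:
  fixes L :: real
  assumes "L \<ge> 0"
  shows "(\<integral>\<^sup>+x. ennreal (if \<bar>x\<bar> \<le> L then \<bar>x\<bar> powr - (1/2) else 0) \<partial>lborel) \<le> ennreal (4 * sqrt L)"
proof -
  have "(\<integral>\<^sup>+x. ennreal (if \<bar>x\<bar> \<le> L then \<bar>x\<bar> powr - (1/2) else 0) \<partial>lborel)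
      \<le> 2 * (\<integral>\<^sup>+x. ennreal (if x \<le> L then x powr - (1/2) else 0) * indicator {0..} x \<partial>lborel)"
    by (rule nn_integral_even_le[where f = "\<lambda>x. ennreal (if x \<le> L then x powr - (1/2) else 0)"]) measurable
  also have "(\<integral>\<^sup>+x. ennreal (if x \<le> L then x powr - (1/2) else 0) * indicator {0..} x \<partial>lborel)
     = (\<integral>\<^sup>+x. ennreal (x powr - (1/2)) * indicator {0..L} x \<partial>lborel)"
    by (intro nn_integral_cong) (auto split: split_indicator)
  also have "\<dots> = ennreal (L powr (- (1/2) + 1) / (- (1/2) + 1))"
    by (rule nn_integral_has_integral_lebesgue'[OF _ has_integral_powr_from_0]) (use assms in auto)
  also have "2 * \<dots> = ennreal (4 * sqrt L)"
    using assms by (subst ennreal_numeral[symmetric], subst ennreal_mult[symmetric]) (auto simp: powr_half_sqrt)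
  finally show ?thesis .
qed

section \<open>Hoelder's inequality for threefold convolutions\<close>

lemma tri_cmult:
  assumes "measurable3 K"
  shows "tri (\<lambda>u v w. c * K u v w) z = c * tri K z"
proof -
  note measurable3_compose[OF assms, measurable (raw)]
  have "tri (\<lambda>u v w. c * K u v w) z = (\<integral>\<^sup>+u. c * (\<integral>\<^sup>+v. K u v (z - u - v) \<partial>lborel) \<partial>lborel)"
    unfolding tri_def by (intro nn_integral_cong nn_integral_cmult) measurable
  also have "\<dots> = c * tri K z"
    unfolding tri_def by (rule nn_integral_cmult) measurable
  finally show ?thesis .
qed

lemma tri_translate:
  assumes "measurable3 K"
  shows "tri (\<lambda>u v w. K (u - a) (v - b) (w - c)) z = tri K (z - a - b - c)"
proof -
  note measurable3_compose[OF assms, measurable (raw)]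
  have "tri (\<lambda>u v w. K (u - a) (v - b) (w - c)) z
     = (\<integral>\<^sup>+u. \<integral>\<^sup>+v. K (u - a) v ((z - a - b - c) - (u - a) - v) \<partial>lborel \<partial>lborel)"
    unfolding tri_def
  proof (rule nn_integral_cong)
    fix u
    have "(\<integral>\<^sup>+v. K (u - a) (v - b) ((z - a - b - c) - (u - a) - (v - b)) \<partial>lborel)
        = (\<integral>\<^sup>+v. K (u - a) v ((z - a - b - c) - (u - a) - v) \<partial>lborel)"
      by (rule nn_integral_lborel_translate) measurable
    then show "(\<integral>\<^sup>+v. K (u - a) (v - b) (z - u - v - c) \<partial>lborel)
        = (\<integral>\<^sup>+v. K (u - a) v ((z - a - b - c) - (u - a) - v) \<partial>lborel)"
      by (simp add: algebra_simps)
  qed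
  also have "\<dots> = tri K (z - a - b - c)"
    unfolding tri_def by (rule nn_integral_lborel_translate) measurable
  finally show ?thesis .
qed

text \<open>Young's inequality with weights 2/p and 1 - 2/p for sqrt(A B) and C, followed by the
  arithmetic-geometric mean of A and B. The zero cases are separate; there \<open>powr\<close> gives
  0 on the left for every exponent, also at p = 2, where the last exponent is 0.\<close>

lemma weighted_am_gm3:
  fixes A B C p :: real
  assumes "p \<ge> 2" "A \<ge> 0" "B \<ge> 0" "C \<ge> 0"
  shows "(A * B) powr (1/p) * C powr (1 - 2/p) \<le> (A + B) / p + (1 - 2/p) * C"
proof (cases "A * B = 0 \<or> C = 0")
  case True
  then show ?thesis using assms by auto
next
  case False
  then have pos: "A > 0" "B > 0" "C > 0" using assms by auto
  have "(A * B) powr (1/p) = sqrt (A * B) powr (2/p)"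
    using pos by (simp add: powr_half_sqrt[symmetric] powr_powr)
  then have "(A * B) powr (1/p) * C powr (1 - 2/p) \<le> 2/p * sqrt (A * B) + (1 - 2/p) * C"
    using Youngs_inequality_0[of "2/p" "1 - 2/p" "sqrt (A * B)" C] pos assms by simp
  also have "\<dots> \<le> 2/p * ((A + B) / 2) + (1 - 2/p) * C"
    using assms arith_geo_mean_sqrt[of A B] by (intro add_mono mult_left_mono) auto
  also have "\<dots> = (A + B) / p + (1 - 2/p) * C"
    using assms by (simp add: field_simps)
  finally show ?thesis .
qed

text \<open>The weighted mean inequality is applied to f/a, g/b, h/c and integrated. Stating the
  hypotheses as real bounds \<open>a\<close>, \<open>b\<close>, \<open>c\<close> instead of with the
  integrals themselves keeps powers away from extended reals.\<close>

lemma tri_Holder: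
  fixes f g h k :: "'a::euclidean_space \<Rightarrow> 'a \<Rightarrow> 'a \<Rightarrow> real"
  assumes m: "measurable3 f" "measurable3 g" "measurable3 h"
    and nn: "\<And>u v w. 0 \<le> f u v w" "\<And>u v w. 0 \<le> g u v w" "\<And>u v w. 0 \<le> h u v w"
    and p: "p \<ge> 2" and pos: "a > 0" "b > 0" "c > 0"
    and f: "tri (\<lambda>u v w. ennreal (f u v w)) z \<le> ennreal a"
    and g: "tri (\<lambda>u v w. ennreal (g u v w)) z \<le> ennreal b"
    and h: "tri (\<lambda>u v w. ennreal (h u v w)) z \<le> ennreal c"
  shows "tri (\<lambda>u v w. ennreal ((f u v w * g u v w) powr (1/p) * h u v w powr (1 - 2/p))) z
        \<le> ennreal ((a * b) powr (1/p) * c powr (1 - 2/p))"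
proof -
  define D where "D = (a * b) powr (1/p) * c powr (1 - 2/p)"
  have D: "D > 0" unfolding D_def using pos by simp
  note measurable3_compose[OF m(1), measurable (raw)] measurable3_compose[OF m(2), measurable (raw)]
    measurable3_compose[OF m(3), measurable (raw)]
  have q: "0 \<le> 1 - 2/p" using p by simp
  have "(f u v w * g u v w) powr (1/p) * h u v w powr (1 - 2/p)
      \<le> D / (p * a) * f u v w + (D / (p * b) * g u v w + D * (1 - 2/p) / c * h u v w)" for u v w
  proof -
    have "((f u v w / a) * (g u v w / b)) powr (1/p) * (h u v w / c) powr (1 - 2/p)
       \<le> (f u v w / a + g u v w / b) / p + (1 - 2/p) * (h u v w / c)"
      using nn pos p by (intro weighted_am_gm3) auto
    moreover have "((f u v w / a) * (g u v w / b)) powr (1/p) * (h u v w / c) powr (1 - 2/p)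
        = ((f u v w * g u v w) powr (1/p) * h u v w powr (1 - 2/p)) / D"
      unfolding D_def using nn pos by (simp add: powr_divide powr_mult)
    ultimately have "(f u v w * g u v w) powr (1/p) * h u v w powr (1 - 2/p)
        \<le> ((f u v w / a + g u v w / b) / p + (1 - 2/p) * (h u v w / c)) * D"
      using D by (simp add: pos_divide_le_eq)
    also have "\<dots> = D / (p * a) * f u v w + (D / (p * b) * g u v w + D * (1 - 2/p) / c * h u v w)"
      using pos p by (simp add: field_simps)
    finally show ?thesis .
  qed
  then have "ennreal ((f u v w * g u v w) powr (1/p) * h u v w powr (1 - 2/p))
      \<le> ennreal (D / (p * a)) * ennreal (f u v w) + (ennreal (D / (p * b)) * ennreal (g u v w)
         + ennreal (D * (1 - 2/p) / c) * ennreal (h u v w))" for u v w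
    using nn[of u v w] D pos p q
    by (simp add: ennreal_mult[symmetric] ennreal_plus[symmetric] del: ennreal_plus)
  then have "tri (\<lambda>u v w. ennreal ((f u v w * g u v w) powr (1/p) * h u v w powr (1 - 2/p))) z
      \<le> tri (\<lambda>u v w. ennreal (D / (p * a)) * ennreal (f u v w) + (ennreal (D / (p * b)) * ennreal (g u v w)
         + ennreal (D * (1 - 2/p) / c) * ennreal (h u v w))) z"
    by (intro tri_mono)
  also have "\<dots> = ennreal (D / (p * a)) * tri (\<lambda>u v w. ennreal (f u v w)) z
      + (ennreal (D / (p * b)) * tri (\<lambda>u v w. ennreal (g u v w)) z
       + ennreal (D * (1 - 2/p) / c) * tri (\<lambda>u v w. ennreal (h u v w)) z)"
  proof -
    have mm: "measurable3 (\<lambda>u v w. ennreal (f u v w))" "measurable3 (\<lambda>u v w. ennreal (g u v w))" "measurable3 (\<lambda>u v w. ennreal (h u v w))"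
      "measurable3 (\<lambda>u v w. ennreal (D / (p * a)) * ennreal (f u v w))"
      "measurable3 (\<lambda>u v w. ennreal (D / (p * b)) * ennreal (g u v w))"
      "measurable3 (\<lambda>u v w. ennreal (D * (1 - 2/p) / c) * ennreal (h u v w))"
      "measurable3 (\<lambda>u v w. ennreal (D / (p * b)) * ennreal (g u v w) + ennreal (D * (1 - 2/p) / c) * ennreal (h u v w))"
      unfolding measurable3_def by measurable
    show ?thesis
      by (simp only: tri_add[OF mm(4) mm(7)] tri_add[OF mm(5) mm(6)] tri_cmult[OF mm(1)] tri_cmult[OF mm(2)] tri_cmult[OF mm(3)])
  qed
  also have "\<dots> \<le> ennreal (D / (p * a)) * ennreal a + (ennreal (D / (p * b)) * ennreal b
       + ennreal (D * (1 - 2/p) / c) * ennreal c)"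
    using f g h by (intro add_mono mult_left_mono) auto
  also have "\<dots> = ennreal (D / (p * a) * a + (D / (p * b) * b + D * (1 - 2/p) / c * c))"
    using D pos p q by (simp add: ennreal_mult[symmetric] ennreal_plus[symmetric] del: ennreal_plus)
  also have "D / (p * a) * a + (D / (p * b) * b + D * (1 - 2/p) / c * c) = D"
    using pos p by (simp add: field_simps)
  finally show ?thesis by (simp add: D_def)
qed

section \<open>Jacobian, resonance function and frequency multiplier\<close>

definition jac :: "real \<Rightarrow> real \<Rightarrow> real" where
  "jac x y = \<bar>x\<^sup>2 - y\<^sup>2\<bar>"

definition resonance :: "real \<Rightarrow> real \<Rightarrow> real \<Rightarrow> real" where
  "resonance x y w = (x + y + w) ^ 3 - x ^ 3 - y ^ 3 - w ^ 3"

text \<open>The p-th power of the quotient of Sobolev weights at the critical exponent s = 1/(2p);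
  raising to the power p turns the exponent into 1/2, independent of p.\<close>

definition freq_mult :: "real \<Rightarrow> real \<Rightarrow> real \<Rightarrow> real" where
  "freq_mult x y w = sqrt (japan (x + y + w) / (japan x * japan y * japan w))"

definition modulation :: "real \<times> real \<Rightarrow> real" where
  "modulation u = japan (snd u - fst u ^ 3)"

lemma jac_nonneg [simp]: "0 \<le> jac x y" by (simp add: jac_def)

lemma freq_mult_nonneg [simp]: "0 \<le> freq_mult x y w" by (simp add: freq_mult_def)

lemma freq_mult_pos [simp]: "0 < freq_mult x y w" by (simp add: freq_mult_def)

lemma modulation_pos [simp]: "0 < modulation u" by (simp add: modulation_def)

lemma modulation_measurable [measurable]: "modulation \<in> borel_measurable borel"
  unfolding modulation_def[abs_def] borel_prod[symmetric] by measurable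

lemma jac_measurable [measurable (raw)]:
  assumes [measurable]: "f \<in> borel_measurable M" "g \<in> borel_measurable M"
  shows "(\<lambda>x. jac (f x) (g x)) \<in> borel_measurable M"
  unfolding jac_def by measurable

lemma freq_mult_measurable [measurable (raw)]:
  assumes [measurable]: "f \<in> borel_measurable M" "g \<in> borel_measurable M" "h \<in> borel_measurable M"
  shows "(\<lambda>x. freq_mult (f x) (g x) (h x)) \<in> borel_measurable M"
  unfolding freq_mult_def by measurable

lemma resonance_measurable [measurable (raw)]:
  assumes [measurable]: "f \<in> borel_measurable M" "g \<in> borel_measurable M" "h \<in> borel_measurable M"
  shows "(\<lambda>x. resonance (f x) (g x) (h x)) \<in> borel_measurable M"
  unfolding resonance_def by measurable

lemma cubes_quadratic: "(x::real) ^ 3 + (c - x) ^ 3 = c ^ 3 / 4 + 3 * c * (x - c / 2)\<^sup>2"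
  by (simp add: power3_eq_cube power2_eq_square field_simps)

lemma jac_quadratic: "\<bar>3 * c * (x - c / 2)\<bar> = 3 / 2 * jac x (c - x)"
proof -
  have "3 * c * (x - c / 2) = 3 / 2 * (x\<^sup>2 - (c - x)\<^sup>2)"
    by (simp add: power2_eq_square field_simps)
  then have "\<bar>3 * c * (x - c / 2)\<bar> = \<bar>3 / 2 * (x\<^sup>2 - (c - x)\<^sup>2)\<bar>" by (rule arg_cong)
  then show ?thesis unfolding jac_def by (simp only: abs_mult) 
qed

text \<open>Completing the square makes the sum of two cubes with x + y = c a parabola in x, to
  which \<open>nn_integral_quadratic\<close> applies. The weight there is 3/2 times
  \<open>jac\<close>; the factor 3/2 is dropped.\<close>

lemma nn_integral_jac:
  fixes g :: "real \<Rightarrow> ennreal"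
  assumes [measurable]: "g \<in> borel_measurable borel"
  shows "(\<integral>\<^sup>+x. ennreal (jac x (c - x)) * g (t + x ^ 3 + (c - x) ^ 3) \<partial>lborel) \<le> (\<integral>\<^sup>+u. g u \<partial>lborel)"
    and "(\<integral>\<^sup>+x. ennreal (jac x (c - x)) * g (t - x ^ 3 - (c - x) ^ 3) \<partial>lborel) \<le> (\<integral>\<^sup>+u. g u \<partial>lborel)"
proof -
  have j: "ennreal (jac x (c - x)) \<le> ennreal \<bar>3 * c * (x - c / 2)\<bar>" for x
    unfolding jac_quadratic by (rule ennreal_leI) simp
  have "(\<integral>\<^sup>+x. ennreal (jac x (c - x)) * g (t + x ^ 3 + (c - x) ^ 3) \<partial>lborel)
      \<le> (\<integral>\<^sup>+x. ennreal \<bar>3 * c * (x - c / 2)\<bar> * g ((t + c ^ 3 / 4) + (3 * c) * (x - c / 2)\<^sup>2) \<partial>lborel)"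
  proof (rule nn_integral_mono)
    fix x
    have "t + x ^ 3 + (c - x) ^ 3 = (t + c ^ 3 / 4) + (3 * c) * (x - c / 2)\<^sup>2"
      using cubes_quadratic[of x c] by simp
    then show "ennreal (jac x (c - x)) * g (t + x ^ 3 + (c - x) ^ 3)
       \<le> ennreal \<bar>3 * c * (x - c / 2)\<bar> * g ((t + c ^ 3 / 4) + (3 * c) * (x - c / 2)\<^sup>2)"
      using j by (simp only:) (rule mult_right_mono, auto)
  qed
  also have "\<dots> \<le> (\<integral>\<^sup>+u. g u \<partial>lborel)" by (rule nn_integral_quadratic) fact
  finally show "(\<integral>\<^sup>+x. ennreal (jac x (c - x)) * g (t + x ^ 3 + (c - x) ^ 3) \<partial>lborel) \<le> (\<integral>\<^sup>+u. g u \<partial>lborel)" .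
  have "(\<integral>\<^sup>+x. ennreal (jac x (c - x)) * g (t - x ^ 3 - (c - x) ^ 3) \<partial>lborel)
      \<le> (\<integral>\<^sup>+x. ennreal \<bar>(- 3 * c) * (x - c / 2)\<bar> * g ((t - c ^ 3 / 4) + (- 3 * c) * (x - c / 2)\<^sup>2) \<partial>lborel)"
  proof (rule nn_integral_mono)
    fix x
    have "t - x ^ 3 - (c - x) ^ 3 = (t - c ^ 3 / 4) + (- 3 * c) * (x - c / 2)\<^sup>2"
      using cubes_quadratic[of x c] by simp
    moreover have "\<bar>(- 3 * c) * (x - c / 2)\<bar> = \<bar>3 * c * (x - c / 2)\<bar>" by (simp add: abs_mult)
    ultimately show "ennreal (jac x (c - x)) * g (t - x ^ 3 - (c - x) ^ 3)
       \<le> ennreal \<bar>(- 3 * c) * (x - c / 2)\<bar> * g ((t - c ^ 3 / 4) + (- 3 * c) * (x - c / 2)\<^sup>2)"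
      using j by (simp only:) (rule mult_right_mono, auto)
  qed
  also have "\<dots> \<le> (\<integral>\<^sup>+u. g u \<partial>lborel)" by (rule nn_integral_quadratic) fact
  finally show "(\<integral>\<^sup>+x. ennreal (jac x (c - x)) * g (t - x ^ 3 - (c - x) ^ 3) \<partial>lborel) \<le> (\<integral>\<^sup>+u. g u \<partial>lborel)" .
qed

section \<open>A Schur test for the trilinear form\<close>

lemma nn_integral_convolution_const:
  fixes J H :: "real \<Rightarrow> ennreal"
  assumes [measurable]: "J \<in> borel_measurable borel" "H \<in> borel_measurable borel"
  shows "(\<integral>\<^sup>+y. \<integral>\<^sup>+s. J s * H (y - s) \<partial>lborel \<partial>lborel) = (\<integral>\<^sup>+s. J s \<partial>lborel) * (\<integral>\<^sup>+s. H s \<partial>lborel)"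
proof -
  have "(\<integral>\<^sup>+y. \<integral>\<^sup>+s. J s * H (y - s) \<partial>lborel \<partial>lborel) = (\<integral>\<^sup>+s. \<integral>\<^sup>+y. J s * H (y - s) \<partial>lborel \<partial>lborel)"
    by (rule nn_integral_lborel_swap) measurable
  also have "\<dots> = (\<integral>\<^sup>+s. J s * (\<integral>\<^sup>+y. H y \<partial>lborel) \<partial>lborel)"
    by (simp add: nn_integral_cmult nn_integral_lborel_translate)
  finally show ?thesis by (simp add: nn_integral_multc)
qed

text \<open>For fixed frequencies the time-frequency integral is the self-convolution
  \<open>G\<close> of \<open>J\<close> at a point that is quadratic in the frequency. The
  substitution with Jacobian \<open>jac\<close> leaves the total mass of \<open>G\<close>, which is
  the square of that of \<open>J\<close>. The point is uniformity in \<open>c\<close> and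
  \<open>t\<close>.\<close>

lemma nn_integral_two_waves:
  fixes J :: "real \<Rightarrow> ennreal"
  assumes [measurable]: "J \<in> borel_measurable borel"
  shows "(\<integral>\<^sup>+u. ennreal (jac (fst u) (c - fst u)) * (J (snd u - fst u ^ 3) * J (t - snd u - (c - fst u) ^ 3)) \<partial>lborel)
      \<le> (\<integral>\<^sup>+s. J s \<partial>lborel)\<^sup>2"
proof -
  define G where "G y = (\<integral>\<^sup>+s. J s * J (y - s) \<partial>lborel)" for y
  have [measurable]: "G \<in> borel_measurable borel" unfolding G_def[abs_def] by measurable
  have "(\<integral>\<^sup>+u. ennreal (jac (fst u) (c - fst u)) * (J (snd u - fst u ^ 3) * J (t - snd u - (c - fst u) ^ 3)) \<partial>lborel)
      = (\<integral>\<^sup>+x. \<integral>\<^sup>+s. ennreal (jac x (c - x)) * (J (s - x ^ 3) * J (t - s - (c - x) ^ 3)) \<partial>lborel \<partial>lborel)"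
    by (subst nn_integral_lborel_pair) simp_all
  also have "\<dots> = (\<integral>\<^sup>+x. ennreal (jac x (c - x)) * G (t - x ^ 3 - (c - x) ^ 3) \<partial>lborel)"
  proof (rule nn_integral_cong)
    fix x
    have "(\<integral>\<^sup>+s. J (s - x ^ 3) * J ((t - x ^ 3 - (c - x) ^ 3) - (s - x ^ 3)) \<partial>lborel) = G (t - x ^ 3 - (c - x) ^ 3)"
      unfolding G_def by (rule nn_integral_lborel_translate) measurable
    then show "(\<integral>\<^sup>+s. ennreal (jac x (c - x)) * (J (s - x ^ 3) * J (t - s - (c - x) ^ 3)) \<partial>lborel)
        = ennreal (jac x (c - x)) * G (t - x ^ 3 - (c - x) ^ 3)"
      by (subst nn_integral_cmult) (simp_all add: algebra_simps)
  qed
  also have "\<dots> \<le> (\<integral>\<^sup>+y. G y \<partial>lborel)" by (rule nn_integral_jac) measurable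
  also have "\<dots> = (\<integral>\<^sup>+s. J s \<partial>lborel)\<^sup>2"
    unfolding G_def by (simp add: nn_integral_convolution_const power2_eq_square)
  finally show ?thesis .
qed

section \<open>Boundedness of the trilinear form on a frequency region\<close>

definition pred3 :: "(real \<Rightarrow> real \<Rightarrow> real \<Rightarrow> bool) \<Rightarrow> bool" where
  "pred3 R \<longleftrightarrow> Measurable.pred (borel \<Otimes>\<^sub>M borel \<Otimes>\<^sub>M borel) (\<lambda>(x, y, w). R x y w)"

lemma pred3_compose:
  assumes "pred3 R" and f: "f \<in> borel_measurable M" "g \<in> borel_measurable M" "h \<in> borel_measurable M"
  shows "Measurable.pred M (\<lambda>x. R (f x) (g x) (h x))"
proof -
  have "(\<lambda>x. (f x, g x, h x)) \<in> measurable M (borel \<Otimes>\<^sub>M borel \<Otimes>\<^sub>M borel)"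
    using f by measurable
  from measurable_compose[OF this assms(1)[unfolded pred3_def]] show ?thesis by simp
qed

text \<open>\<open>U1\<close>, \<open>U2\<close>, \<open>U3\<close> stand for the integrands of
  \<open>Xpow\<close>, that is, for weighted p-th powers, so all data sit under one p-th root. In
  the application \<beta> = b r with 1 - 1/p = 1/r, hence the exponent of the modulations is
  -b.\<close>

definition trilinear_ker ::
  "real \<Rightarrow> real \<Rightarrow> (real \<Rightarrow> real \<Rightarrow> real \<Rightarrow> bool)
    \<Rightarrow> (real \<times> real \<Rightarrow> real) \<Rightarrow> (real \<times> real \<Rightarrow> real) \<Rightarrow> (real \<times> real \<Rightarrow> real)
    \<Rightarrow> real \<times> real \<Rightarrow> real \<times> real \<Rightarrow> real \<times> real \<Rightarrow> ennreal" where
  "trilinear_ker p \<beta> R U1 U2 U3 u v w =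
    (if R (fst u) (fst v) (fst w)
     then ennreal ((\<bar>fst u + fst v + fst w\<bar> powr p * freq_mult (fst u) (fst v) (fst w) * (U1 u * U2 v * U3 w)) powr (1/p)
                   * (modulation u * modulation v * modulation w) powr (- \<beta> * (1 - 1/p)))
     else 0)"

definition mass_le :: "(real \<times> real \<Rightarrow> real) \<Rightarrow> real \<Rightarrow> bool" where
  "mass_le U n \<longleftrightarrow> U \<in> borel_measurable borel \<and> (\<forall>u. 0 \<le> U u) \<and> 0 < n \<and> (\<integral>\<^sup>+u. ennreal (U u) \<partial>lborel) \<le> ennreal n"

text \<open>Says that the integral of \<open>T powr p\<close> is at most \<open>m\<close>; the majorant \<open>a\<close> of \<open>T powr p\<close>
  avoids powers of extended reals.\<close>

definition Lp_le :: "real \<Rightarrow> (real \<times> real \<Rightarrow> ennreal) \<Rightarrow> real \<Rightarrow> bool" where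
  "Lp_le p T m \<longleftrightarrow> (\<exists>a\<in>borel_measurable borel. (\<integral>\<^sup>+z. a z \<partial>lborel) \<le> ennreal m \<and>
     (\<forall>z t. 0 < t \<longrightarrow> a z \<le> ennreal t \<longrightarrow> T z \<le> ennreal (t powr (1/p))))"

text \<open>Boundedness of the form restricted to the region \<open>R\<close>, measured in p-th
  powers: the bound is therefore linear in each of the masses.\<close>

definition controlled :: "real \<Rightarrow> real \<Rightarrow> (real \<Rightarrow> real \<Rightarrow> real \<Rightarrow> bool) \<Rightarrow> bool" where
  "controlled p \<beta> R \<longleftrightarrow> (\<exists>C>0. \<forall>U1 U2 U3 n1 n2 n3. mass_le U1 n1 \<longrightarrow> mass_le U2 n2 \<longrightarrow> mass_le U3 n3 \<longrightarrow>
     Lp_le p (tri (trilinear_ker p \<beta> R U1 U2 U3)) (C * (n1 * n2 * n3)))"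

lemma Lp_le_mono: "Lp_le p T m \<Longrightarrow> (\<And>z. T' z \<le> T z) \<Longrightarrow> Lp_le p T' m"
  unfolding Lp_le_def by (meson order_trans)

text \<open>With K = 2 powr p, a bound t/K on each majorant bounds each summand by half of t powr
  (1/p).\<close>

lemma Lp_le_add:
  assumes p: "p > 0" and T: "Lp_le p T1 m1" "Lp_le p T2 m2" and m: "0 \<le> m1" "0 \<le> m2"
  shows "Lp_le p (\<lambda>z. T1 z + T2 z) (2 powr p * (m1 + m2))"
proof -
  from T obtain a1 a2 where [measurable]: "a1 \<in> borel_measurable borel" "a2 \<in> borel_measurable borel"
    and a: "(\<integral>\<^sup>+z. a1 z \<partial>lborel) \<le> ennreal m1" "(\<integral>\<^sup>+z. a2 z \<partial>lborel) \<le> ennreal m2"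
    and b: "\<And>z t. 0 < t \<Longrightarrow> a1 z \<le> ennreal t \<Longrightarrow> T1 z \<le> ennreal (t powr (1/p))"
      "\<And>z t. 0 < t \<Longrightarrow> a2 z \<le> ennreal t \<Longrightarrow> T2 z \<le> ennreal (t powr (1/p))"
    unfolding Lp_le_def by blast
  define K :: real where "K = 2 powr p"
  have K: "K > 0" by (simp add: K_def)
  show ?thesis
    unfolding Lp_le_def K_def[symmetric]
  proof (intro bexI[of _ "\<lambda>z. ennreal K * (a1 z + a2 z)"] conjI allI impI)
    have "(\<integral>\<^sup>+z. ennreal K * (a1 z + a2 z) \<partial>lborel) = ennreal K * ((\<integral>\<^sup>+z. a1 z \<partial>lborel) + (\<integral>\<^sup>+z. a2 z \<partial>lborel))"
      by (simp add: nn_integral_cmult nn_integral_add)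
    also have "\<dots> \<le> ennreal K * (ennreal m1 + ennreal m2)"
      using a by (intro mult_left_mono add_mono) auto
    also have "\<dots> = ennreal (K * (m1 + m2))"
      using K m by (simp add: ennreal_mult ennreal_plus)
    finally show "(\<integral>\<^sup>+z. ennreal K * (a1 z + a2 z) \<partial>lborel) \<le> ennreal (K * (m1 + m2))" .
  next
    fix z and t :: real
    assume t: "0 < t" and le: "ennreal K * (a1 z + a2 z) \<le> ennreal t"
    have split: "c \<le> ennreal (t / K)" if "ennreal K * c \<le> ennreal t" for c
    proof -
      have "ennreal (1/K) * (ennreal K * c) \<le> ennreal (1/K) * ennreal t"
        using that by (rule mult_left_mono) simp
      also have "ennreal (1/K) * (ennreal K * c) = c"
        using K by (simp add: mult.assoc[symmetric] ennreal_mult[symmetric])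
      also have "ennreal (1/K) * ennreal t = ennreal (t / K)"
        using K t by (simp add: ennreal_mult[symmetric])
      finally show ?thesis .
    qed
    have "a1 z \<le> ennreal (t / K)" "a2 z \<le> ennreal (t / K)"
      by (rule split, rule order_trans[OF _ le], intro mult_left_mono; simp)+
    then have "T1 z + T2 z \<le> ennreal ((t / K) powr (1/p)) + ennreal ((t / K) powr (1/p))"
      using b t K by (intro add_mono) auto
    also have "\<dots> = ennreal (2 * (t / K) powr (1/p))"
      by (subst ennreal_plus[symmetric]) auto
    also have "2 * (t / K) powr (1/p) = t powr (1/p)"
      using p t by (simp add: K_def powr_divide powr_powr)
    finally show "T1 z + T2 z \<le> ennreal (t powr (1/p))" .
  qed measurable
qed

lemma borel_measurable_fst_snd [measurable (raw)]:
  fixes f :: "'c \<Rightarrow> 'a::second_countable_topology \<times> 'b::second_countable_topology"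
  assumes "f \<in> borel_measurable M"
  shows "(\<lambda>x. fst (f x)) \<in> borel_measurable M" "(\<lambda>x. snd (f x)) \<in> borel_measurable M"
  by (rule measurable_compose[OF assms borel_measurable_continuous_onI], intro continuous_intros)+

lemma trilinear_ker_measurable3:
  assumes "pred3 R" "mass_le U1 n1" "mass_le U2 n2" "mass_le U3 n3"
  shows "measurable3 (trilinear_ker p \<beta> R U1 U2 U3)"
proof -
  note pred3_compose[OF assms(1), measurable (raw)]
  have [measurable]: "U1 \<in> borel_measurable borel" "U2 \<in> borel_measurable borel" "U3 \<in> borel_measurable borel"
    using assms by (auto simp: mass_le_def)
  show ?thesis
    unfolding measurable3_def trilinear_ker_def by measurable
qed

lemma controlled_mono:
  assumes "controlled p \<beta> R'" "\<And>x y w. R x y w \<Longrightarrow> R' x y w"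
  shows "controlled p \<beta> R"
proof -
  have "tri (trilinear_ker p \<beta> R U1 U2 U3) z \<le> tri (trilinear_ker p \<beta> R' U1 U2 U3) z" for U1 U2 U3 z
    by (rule tri_mono) (auto simp: trilinear_ker_def assms(2))
  then show ?thesis
    using assms(1) unfolding controlled_def by (meson Lp_le_mono)
qed

lemma controlled_disj:
  assumes "p > 0" "controlled p \<beta> R1" "controlled p \<beta> R2" "pred3 R1" "pred3 R2"
  shows "controlled p \<beta> (\<lambda>x y w. R1 x y w \<or> R2 x y w)"
proof -
  from assms obtain C1 C2 where C: "C1 > 0" "C2 > 0"
    and b: "\<And>U1 U2 U3 n1 n2 n3. mass_le U1 n1 \<Longrightarrow> mass_le U2 n2 \<Longrightarrow> mass_le U3 n3 \<Longrightarrow>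
     Lp_le p (tri (trilinear_ker p \<beta> R1 U1 U2 U3)) (C1 * (n1 * n2 * n3))"
     "\<And>U1 U2 U3 n1 n2 n3. mass_le U1 n1 \<Longrightarrow> mass_le U2 n2 \<Longrightarrow> mass_le U3 n3 \<Longrightarrow>
     Lp_le p (tri (trilinear_ker p \<beta> R2 U1 U2 U3)) (C2 * (n1 * n2 * n3))"
    unfolding controlled_def by blast
  show ?thesis
    unfolding controlled_def
  proof (intro exI[of _ "2 powr p * (C1 + C2)"] conjI allI impI)
    show "0 < 2 powr p * (C1 + C2)" using C by simp
    fix U1 U2 U3 n1 n2 n3
    assume m: "mass_le U1 n1" "mass_le U2 n2" "mass_le U3 n3"
    then have n: "0 < n1 * n2 * n3" by (simp add: mass_le_def)
    have "Lp_le p (\<lambda>z. tri (trilinear_ker p \<beta> R1 U1 U2 U3) z + tri (trilinear_ker p \<beta> R2 U1 U2 U3) z)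
        (2 powr p * (C1 * (n1 * n2 * n3) + C2 * (n1 * n2 * n3)))"
      using C n by (intro Lp_le_add b m assms) auto
    moreover have "tri (trilinear_ker p \<beta> (\<lambda>x y w. R1 x y w \<or> R2 x y w) U1 U2 U3) z
        \<le> tri (trilinear_ker p \<beta> R1 U1 U2 U3) z + tri (trilinear_ker p \<beta> R2 U1 U2 U3) z" for z
      unfolding tri_add[OF trilinear_ker_measurable3[OF assms(4) m] trilinear_ker_measurable3[OF assms(5) m], symmetric]
      by (rule tri_mono) (simp add: trilinear_ker_def)
    ultimately have "Lp_le p (tri (trilinear_ker p \<beta> (\<lambda>x y w. R1 x y w \<or> R2 x y w) U1 U2 U3))
        (2 powr p * (C1 * (n1 * n2 * n3) + C2 * (n1 * n2 * n3)))"
      by (rule Lp_le_mono)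
    then show "Lp_le p (tri (trilinear_ker p \<beta> (\<lambda>x y w. R1 x y w \<or> R2 x y w) U1 U2 U3))
        (2 powr p * (C1 + C2) * (n1 * n2 * n3))"
      by (simp only: distrib_right mult.assoc)
  qed
qed

text \<open>Only the product of the masses enters the bound, so permuting the three functions along
  with the frequencies changes nothing.\<close>

lemma controlled_permute:
  assumes "controlled p \<beta> R"
    and "\<And>U1 U2 U3 n1 n2 n3. mass_le U1 n1 \<Longrightarrow> mass_le U2 n2 \<Longrightarrow> mass_le U3 n3 \<Longrightarrow>
      \<exists>V1 V2 V3 m1 m2 m3. mass_le V1 m1 \<and> mass_le V2 m2 \<and> mass_le V3 m3 \<and> m1 * m2 * m3 = n1 * n2 * n3
        \<and> tri (trilinear_ker p \<beta> R' U1 U2 U3) = tri (trilinear_ker p \<beta> R V1 V2 V3)"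
  shows "controlled p \<beta> R'"
proof -
  obtain C where C: "C > 0" "\<And>U1 U2 U3 n1 n2 n3. mass_le U1 n1 \<Longrightarrow> mass_le U2 n2 \<Longrightarrow> mass_le U3 n3 \<Longrightarrow>
     Lp_le p (tri (trilinear_ker p \<beta> R U1 U2 U3)) (C * (n1 * n2 * n3))"
    using assms(1) unfolding controlled_def by blast
  have "Lp_le p (tri (trilinear_ker p \<beta> R' U1 U2 U3)) (C * (n1 * n2 * n3))"
    if m: "mass_le U1 n1" "mass_le U2 n2" "mass_le U3 n3" for U1 U2 U3 n1 n2 n3
  proof -
    obtain V1 V2 V3 m1 m2 m3 where "mass_le V1 m1" "mass_le V2 m2" "mass_le V3 m3"
      and eq: "m1 * m2 * m3 = n1 * n2 * n3" "tri (trilinear_ker p \<beta> R' U1 U2 U3) = tri (trilinear_ker p \<beta> R V1 V2 V3)"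
      using assms(2)[OF m] by blast
    then have "Lp_le p (tri (trilinear_ker p \<beta> R V1 V2 V3)) (C * (m1 * m2 * m3))" by (intro C)
    then show ?thesis unfolding eq .
  qed
  with C(1) show ?thesis unfolding controlled_def by blast
qed

lemma controlled_swap12:
  assumes "controlled p \<beta> R" "pred3 R"
  shows "controlled p \<beta> (\<lambda>x y w. R y x w)"
proof (rule controlled_permute[OF assms(1)])
  fix U1 U2 U3 n1 n2 n3
  assume m: "mass_le U1 n1" "mass_le U2 n2" "mass_le U3 n3"
  have e: "trilinear_ker p \<beta> (\<lambda>x y w. R y x w) U1 U2 U3 = (\<lambda>u v w. trilinear_ker p \<beta> R U2 U1 U3 v u w)"
    by (intro ext) (simp add: trilinear_ker_def freq_mult_def ac_simps)
  have "tri (trilinear_ker p \<beta> (\<lambda>x y w. R y x w) U1 U2 U3) = tri (trilinear_ker p \<beta> R U2 U1 U3)"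
    unfolding e by (rule ext) (rule tri_swap12[OF trilinear_ker_measurable3[OF assms(2) m(2,1,3)]])
  moreover have "n2 * n1 * n3 = n1 * n2 * n3" by simp
  ultimately show "\<exists>V1 V2 V3 m1 m2 m3. mass_le V1 m1 \<and> mass_le V2 m2 \<and> mass_le V3 m3 \<and> m1 * m2 * m3 = n1 * n2 * n3
        \<and> tri (trilinear_ker p \<beta> (\<lambda>x y w. R y x w) U1 U2 U3) = tri (trilinear_ker p \<beta> R V1 V2 V3)"
    using m by blast
qed

lemma controlled_swap23:
  assumes "controlled p \<beta> R" "pred3 R"
  shows "controlled p \<beta> (\<lambda>x y w. R x w y)"
proof (rule controlled_permute[OF assms(1)])
  fix U1 U2 U3 n1 n2 n3
  assume m: "mass_le U1 n1" "mass_le U2 n2" "mass_le U3 n3"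
  have e: "trilinear_ker p \<beta> (\<lambda>x y w. R x w y) U1 U2 U3 = (\<lambda>u v w. trilinear_ker p \<beta> R U1 U3 U2 u w v)"
    by (intro ext) (simp add: trilinear_ker_def freq_mult_def ac_simps)
  have "tri (trilinear_ker p \<beta> (\<lambda>x y w. R x w y) U1 U2 U3) = tri (trilinear_ker p \<beta> R U1 U3 U2)"
    unfolding e by (rule ext) (rule tri_swap23[OF trilinear_ker_measurable3[OF assms(2) m(1,3,2)]])
  moreover have "n1 * n3 * n2 = n1 * n2 * n3" by simp
  ultimately show "\<exists>V1 V2 V3 m1 m2 m3. mass_le V1 m1 \<and> mass_le V2 m2 \<and> mass_le V3 m3 \<and> m1 * m2 * m3 = n1 * n2 * n3
        \<and> tri (trilinear_ker p \<beta> (\<lambda>x y w. R x w y) U1 U2 U3) = tri (trilinear_ker p \<beta> R V1 V2 V3)"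
    using m by blast
qed

text \<open>The kernel carries a power of |\<xi>| and vanishes for \<xi> = 0; for any other \<xi>
  the region meets the line y -> (x, y, \<xi> - x - y) in a null set.\<close>

lemma controlled_negligible:
  assumes R: "pred3 R" and "\<And>x z. AE y in lborel. R x y (z - x - y) \<longrightarrow> z = 0"
  shows "controlled p \<beta> R"
  unfolding controlled_def
proof (intro exI[of _ 1] conjI allI impI)
  fix U1 U2 U3 n1 n2 n3
  assume m: "mass_le U1 n1" "mass_le U2 n2" "mass_le U3 n3"
  then have n: "0 < n1 * n2 * n3" by (simp add: mass_le_def)
  have "tri (trilinear_ker p \<beta> R U1 U2 U3) z = 0" for z
  proof -
    have "(\<integral>\<^sup>+y. tri (\<lambda>s t q. trilinear_ker p \<beta> R U1 U2 U3 (x, s) (y, t) (fst z - x - y, q)) (snd z) \<partial>lborel) = 0" for x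
    proof -
      have "AE y in lborel. tri (\<lambda>s t q. trilinear_ker p \<beta> R U1 U2 U3 (x, s) (y, t) (fst z - x - y, q)) (snd z) = 0"
        using assms(2)[of x "fst z"]
      proof eventually_elim
        case (elim y)
        then have "trilinear_ker p \<beta> R U1 U2 U3 (x, s) (y, t) (fst z - x - y, q) = 0" for s t q
          by (cases "R x y (fst z - x - y)") (simp_all add: trilinear_ker_def)
        then show ?case by (simp add: tri_def)
      qed
      then show ?thesis by (subst nn_integral_cong_AE) auto
    qed
    then show ?thesis
      unfolding tri_iterated[OF trilinear_ker_measurable3[OF R m]]
      by (simp add: tri_def[of "\<lambda>x y w. tri (\<lambda>s t q. trilinear_ker p \<beta> R U1 U2 U3 (x, s) (y, t) (w, q)) (snd z)"])
  qed
  then show "Lp_le p (tri (trilinear_ker p \<beta> R U1 U2 U3)) (1 * (n1 * n2 * n3))"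
    unfolding Lp_le_def using n by (intro bexI[of _ "\<lambda>_. 0"]) auto
qed simp

text \<open>The powers of \<open>V\<close> cancel, since (2 - p)/p + (1 - 2/p) = 0, and the
  exponents of the modulations add up as 1/p + (1 - 2/p) = 1 - 1/p. It serves both to factor the
  kernel and, with \<open>m = 1\<close>, to balance the constants.\<close>

lemma Hoelder_exponents:
  fixes p \<beta> P V m :: real
  assumes p: "p \<ge> 2" and P: "P \<ge> 0" and V: "V > 0" and m: "m > 0"
  shows "(P / V powr (p - 2) * m powr - \<beta>) powr (1/p) * (V * m powr - \<beta>) powr (1 - 2/p)
     = P powr (1/p) * m powr (- \<beta> * (1 - 1/p))"
proof -
  have 1: "(P / V powr (p - 2) * m powr - \<beta>) powr (1/p) = P powr (1/p) * V powr ((2 - p) / p) * m powr (- (\<beta> / p))"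
  proof -
    have "P / V powr (p - 2) * m powr - \<beta> = P * V powr - (p - 2) * m powr - \<beta>"
      using V by (simp only: powr_minus divide_inverse)
    also have "\<dots> powr (1/p) = P powr (1/p) * V powr (- (p - 2) * (1/p)) * m powr (- \<beta> * (1/p))"
      using assms by (simp only: powr_mult powr_powr powr_ge_zero mult_nonneg_nonneg)
    finally show ?thesis by simp
  qed
  have 2: "(V * m powr - \<beta>) powr (1 - 2/p) = V powr (1 - 2/p) * m powr (- \<beta> * (1 - 2/p))"
    using assms by (simp add: powr_mult powr_powr)
  have "(2 - p) / p + (1 - 2/p) = 0" using p by (simp add: field_simps)
  then have 3: "V powr ((2 - p) / p) * V powr (1 - 2/p) = 1"
    using V by (simp add: powr_add[symmetric])
  have 4: "m powr (- (\<beta> / p)) * m powr (- \<beta> * (1 - 2/p)) = m powr (- \<beta> * (1 - 1/p))"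
    unfolding powr_add[symmetric] using p by (intro arg_cong2[of _ _ _ _ "(powr)"]) (auto simp: field_simps)
  have "(a * b * c) * (d * e) = a * (b * d) * (c * e)" for a b c d e :: real by simp
  then show ?thesis unfolding 1 2 by (simp only: 3 4 mult_1_right)
qed

text \<open>\<open>H1\<close> bounds the Hoelder factor carrying \<open>U1\<close> and \<open>U2\<close>, \<open>H3\<close> the one without functions;
  the factor carrying \<open>U3\<close> is controlled by the Jacobian alone.\<close>

lemma controlled_Schur:
  assumes p: "p \<ge> 2" and \<beta>: "\<beta> > 1" and R: "pred3 R" and V: "measurable3 V"
    and pos: "\<And>x y w. R x y w \<Longrightarrow> 0 < V x y w \<and> 0 < jac x y"
    and C: "C1 > 0" "C3 > 0"
    and H1: "\<And>x y. (\<integral>\<^sup>+w. (if R x y w then ennreal (\<bar>x + y + w\<bar> powr p * freq_mult x y w / (V x y w powr (p - 2) * jac x y)) else 0) \<partial>lborel)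
        \<le> ennreal C1"
    and H3: "\<And>\<xi> g. g \<in> borel_measurable borel \<Longrightarrow>
        tri (\<lambda>x y w. if R x y w then ennreal (V x y w) * g (resonance x y w) else 0) \<xi> \<le> ennreal C3 * (\<integral>\<^sup>+u. g u \<partial>lborel)"
  shows "controlled p \<beta> R"
proof -
  obtain B where B: "B > 0" "(\<integral>\<^sup>+x. ennreal (japan x powr - \<beta>) \<partial>lborel) \<le> ennreal B"
    using nn_integral_japan_powr[OF \<beta>] .
  define J where "J x = ennreal (japan x powr - \<beta>)" for x
  have [measurable]: "J \<in> borel_measurable borel" unfolding J_def[abs_def] by measurable
  have JB: "(\<integral>\<^sup>+x. J x \<partial>lborel) \<le> ennreal B" using B(2) unfolding J_def .
  note pred3_compose[OF R, measurable (raw)] measurable3_compose[OF V, measurable (raw)]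
  define c where "c = C3 * B ^ 3"
  have c: "c > 0" using C B by (simp add: c_def)

  \<comment> \<open>\<open>V\<close> sees frequencies only, so the three modulation weights can be
    integrated first. They give \<open>G\<close> at \<tau> - \<xi>^3 plus the resonance function,
    and \<open>H3\<close> applies to a translate of \<open>G\<close>.\<close>
  have third: "tri (\<lambda>u v w. if R (fst u) (fst v) (fst w) then ennreal (V (fst u) (fst v) (fst w)) * (J (snd u - fst u ^ 3) * J (snd v - fst v ^ 3) * J (snd w - fst w ^ 3)) else 0) z
      \<le> ennreal c" (is "tri ?K z \<le> _") for z
  proof -
    define G where "G = tri (\<lambda>s t q. J s * J t * J q)"
    have mJ: "measurable3 (\<lambda>s t q. J s * J t * J q)" unfolding measurable3_def by measurable
    have [measurable]: "G \<in> borel_measurable borel" unfolding G_def by (rule tri_measurable[OF mJ])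
    have IG: "(\<integral>\<^sup>+y. G y \<partial>lborel) \<le> ennreal (B ^ 3)"
    proof -
      have "(\<integral>\<^sup>+y. G y \<partial>lborel) = (\<integral>\<^sup>+s. J s \<partial>lborel) * (\<integral>\<^sup>+s. J s \<partial>lborel) * (\<integral>\<^sup>+s. J s \<partial>lborel)"
        unfolding G_def nn_integral_tri[OF mJ] by (simp add: nn_integral_cmult nn_integral_multc)
      also have "\<dots> \<le> ennreal B * ennreal B * ennreal B"
        by (intro mult_mono JB) auto
      also have "\<dots> = ennreal (B ^ 3)"
        using B by (simp add: power3_eq_cube ennreal_mult)
      finally show ?thesis .
    qed
    have mK: "measurable3 ?K" unfolding measurable3_def by measurable
    have "tri ?K z = tri (\<lambda>x y w. if R x y w then ennreal (V x y w) * G (snd z - fst z ^ 3 + resonance x y w) else 0) (fst z)"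
      unfolding tri_iterated[OF mK]
    proof (rule tri_cong)
      fix x y w assume xyw: "x + y + w = fst z"
      have mL: "measurable3 (\<lambda>s t q. J (s - x ^ 3) * J (t - y ^ 3) * J (q - w ^ 3))"
        unfolding measurable3_def by measurable
      have "tri (\<lambda>s t q. J (s - x ^ 3) * J (t - y ^ 3) * J (q - w ^ 3)) (snd z) = G (snd z - x ^ 3 - y ^ 3 - w ^ 3)"
        unfolding G_def using tri_translate[OF mJ, of "x ^ 3" "y ^ 3" "w ^ 3" "snd z"] .
      also have "snd z - x ^ 3 - y ^ 3 - w ^ 3 = snd z - fst z ^ 3 + resonance x y w"
        unfolding resonance_def xyw by simp
      finally have "tri (\<lambda>s t q. ennreal (V x y w) * (J (s - x ^ 3) * J (t - y ^ 3) * J (q - w ^ 3))) (snd z)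
          = ennreal (V x y w) * G (snd z - fst z ^ 3 + resonance x y w)"
        using tri_cmult[OF mL] by simp
      then show "tri (\<lambda>s t q. ?K (x, s) (y, t) (w, q)) (snd z) = (if R x y w then ennreal (V x y w) * G (snd z - fst z ^ 3 + resonance x y w) else 0)"
        by (cases "R x y w") (simp_all add: tri_def)
    qed
    also have "\<dots> \<le> ennreal C3 * (\<integral>\<^sup>+u. G (snd z - fst z ^ 3 + u) \<partial>lborel)"
      by (rule H3) measurable
    also have "(\<integral>\<^sup>+u. G (snd z - fst z ^ 3 + u) \<partial>lborel) = (\<integral>\<^sup>+u. G u \<partial>lborel)"
      using nn_integral_lborel_translate[of G "- (snd z - fst z ^ 3)"] by (simp add: algebra_simps)
    also have "ennreal C3 * \<dots> \<le> ennreal C3 * ennreal (B ^ 3)"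
      by (rule mult_left_mono[OF IG]) simp
    also have "\<dots> = ennreal c" using C B by (simp add: c_def ennreal_mult)
    finally show ?thesis .
  qed

  \<comment> \<open>With \<open>w\<close> frozen, the other two variables form the integral of
    \<open>nn_integral_two_waves\<close>; its bound does not depend on \<open>w\<close>, which
    leaves the mass of \<open>U\<close>.\<close>
  have second: "tri (\<lambda>u v w. ennreal (U w) * (ennreal (jac (fst u) (fst v)) * (J (snd u - fst u ^ 3) * J (snd v - fst v ^ 3)))) z
      \<le> ennreal (n * B\<^sup>2)" (is "tri ?K z \<le> _") if m: "mass_le U n" for U n z
  proof -
    have [measurable]: "U \<in> borel_measurable borel" using m by (simp add: mass_le_def)
    have mK: "measurable3 ?K" unfolding measurable3_def by measurable
    have "tri ?K z = tri (\<lambda>w u v. ?K u v w) z"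
      using tri_swap12[OF measurable3_permute(2)[OF mK]] tri_swap23[OF mK] by (metis (no_types))
    also have "\<dots> = (\<integral>\<^sup>+w. ennreal (U w) * (\<integral>\<^sup>+u. ennreal (jac (fst u) (fst (z - w) - fst u)) * (J (snd u - fst u ^ 3) * J (snd (z - w) - snd u - (fst (z - w) - fst u) ^ 3)) \<partial>lborel) \<partial>lborel)"
      unfolding tri_def
      by (intro nn_integral_cong, subst nn_integral_cmult[symmetric]) simp_all
    also have "\<dots> \<le> (\<integral>\<^sup>+w. ennreal (U w) * (ennreal B)\<^sup>2 \<partial>lborel)"
      by (intro nn_integral_mono mult_left_mono order_trans[OF nn_integral_two_waves] power_mono JB) auto
    also have "\<dots> = (\<integral>\<^sup>+w. ennreal (U w) \<partial>lborel) * (ennreal B)\<^sup>2"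
      by (rule nn_integral_multc) measurable
    also have "\<dots> \<le> ennreal n * (ennreal B)\<^sup>2"
      using m by (intro mult_right_mono) (auto simp: mass_le_def)
    also have "\<dots> = ennreal (n * B\<^sup>2)"
      using m B by (simp add: mass_le_def ennreal_mult ennreal_power)
    finally show ?thesis .
  qed

  \<comment> \<open>Chosen so that n3 * K0 times the integral of \<open>f\<close> can be the
    majorant: in the bound from Hoelder's inequality the factors \<open>n3\<close>, \<open>B\<close>
    and \<open>c\<close> then cancel and exactly t powr (1/p) remains.\<close>
  define K0 where "K0 = B\<^sup>2 * c powr (p - 2)"
  have K0: "K0 > 0" using B c by (simp add: K0_def)
  show ?thesis
    unfolding controlled_def
  proof (intro exI[of _ "K0 * (C1 * B)"] conjI allI impI)
    show "0 < K0 * (C1 * B)" using K0 C B by simp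
    fix U1 U2 U3 n1 n2 n3
    assume m: "mass_le U1 n1" "mass_le U2 n2" "mass_le U3 n3"
    then have [measurable]: "U1 \<in> borel_measurable borel" "U2 \<in> borel_measurable borel" "U3 \<in> borel_measurable borel"
      and U: "\<And>u. 0 \<le> U1 u" "\<And>u. 0 \<le> U2 u" "\<And>u. 0 \<le> U3 u" and n: "0 < n1" "0 < n2" "0 < n3"
      and mass: "(\<integral>\<^sup>+u. ennreal (U1 u) \<partial>lborel) \<le> ennreal n1" "(\<integral>\<^sup>+u. ennreal (U2 u) \<partial>lborel) \<le> ennreal n2"
      by (auto simp: mass_le_def)
    \<comment> \<open>What is left of the multiplier for the first factor, once \<open>jac\<close>
      has been given to \<open>g\<close> and the power p - 2 of \<open>V\<close> to
      \<open>h\<close>.\<close>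
    define X where "X x y w = (if R x y w then \<bar>x + y + w\<bar> powr p * freq_mult x y w / (V x y w powr (p - 2) * jac x y) else 0)" for x y w
    have X0: "0 \<le> X x y w" for x y w by (simp add: X_def)
    have mX: "measurable3 X" unfolding measurable3_def X_def by measurable
    note measurable3_compose[OF mX, measurable (raw)]
    define f where "f u v w = U1 u * U2 v * X (fst u) (fst v) (fst w) * modulation w powr - \<beta>" for u v w
    define g where "g u v w = U3 w * (jac (fst u) (fst v) * (modulation u powr - \<beta> * modulation v powr - \<beta>))" for u v w
    define h where "h u v w = (if R (fst u) (fst v) (fst w) then V (fst u) (fst v) (fst w) * (modulation u powr - \<beta> * modulation v powr - \<beta> * modulation w powr - \<beta>) else 0)" for u v w
    have mf: "measurable3 f" "measurable3 g" "measurable3 h"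
      unfolding measurable3_def f_def g_def h_def by measurable
    have nn: "0 \<le> f u v w" "0 \<le> g u v w" "0 \<le> h u v w" for u v w
      using U X0 pos[of "fst u" "fst v" "fst w"] by (auto simp: f_def g_def h_def)
    have mfe: "measurable3 (\<lambda>u v w. ennreal (f u v w))"
      unfolding measurable3_def f_def by measurable
    have If: "(\<integral>\<^sup>+z. tri (\<lambda>u v w. ennreal (f u v w)) z \<partial>lborel) \<le> ennreal (n1 * n2 * (C1 * B))"
    proof -
      have w: "(\<integral>\<^sup>+w. ennreal (f u v w) \<partial>lborel) \<le> ennreal (U1 u) * ennreal (U2 v) * ennreal (C1 * B)" for u v
      proof -
        have "(\<integral>\<^sup>+w. ennreal (f u v w) \<partial>lborel) = (\<integral>\<^sup>+w. ennreal (U1 u * U2 v) * (ennreal (X (fst u) (fst v) (fst w)) * J (snd w - fst w ^ 3)) \<partial>lborel)"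
          using U X0 by (intro nn_integral_cong) (simp add: f_def J_def modulation_def ennreal_mult mult.assoc)
        also have "\<dots> = ennreal (U1 u * U2 v) * (\<integral>\<^sup>+w. ennreal (X (fst u) (fst v) (fst w)) * J (snd w - fst w ^ 3) \<partial>lborel)"
          by (rule nn_integral_cmult) measurable
        also have "(\<integral>\<^sup>+w. ennreal (X (fst u) (fst v) (fst w)) * J (snd w - fst w ^ 3) \<partial>lborel)
            = (\<integral>\<^sup>+x. \<integral>\<^sup>+s. ennreal (X (fst u) (fst v) x) * J (s - x ^ 3) \<partial>lborel \<partial>lborel)"
          by (subst nn_integral_lborel_pair) simp_all
        also have "\<dots> = (\<integral>\<^sup>+x. ennreal (X (fst u) (fst v) x) * (\<integral>\<^sup>+s. J s \<partial>lborel) \<partial>lborel)"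
          by (simp add: nn_integral_cmult nn_integral_lborel_translate)
        also have "\<dots> = (\<integral>\<^sup>+x. ennreal (X (fst u) (fst v) x) \<partial>lborel) * (\<integral>\<^sup>+s. J s \<partial>lborel)"
          by (rule nn_integral_multc) measurable
        also have "\<dots> \<le> ennreal C1 * ennreal B"
        proof (intro mult_mono JB)
          have "(\<integral>\<^sup>+x. ennreal (X (fst u) (fst v) x) \<partial>lborel)
             = (\<integral>\<^sup>+w. (if R (fst u) (fst v) w then ennreal (\<bar>fst u + fst v + w\<bar> powr p * freq_mult (fst u) (fst v) w / (V (fst u) (fst v) w powr (p - 2) * jac (fst u) (fst v))) else 0) \<partial>lborel)"
            by (rule nn_integral_cong) (simp add: X_def)
          then show "(\<integral>\<^sup>+x. ennreal (X (fst u) (fst v) x) \<partial>lborel) \<le> ennreal C1"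
            using H1 by simp
        qed auto
        also have "\<dots> = ennreal (C1 * B)" using C B by (simp add: ennreal_mult)
        finally show ?thesis using U by (simp add: ennreal_mult mult_left_mono)
      qed
      have "(\<integral>\<^sup>+z. tri (\<lambda>u v w. ennreal (f u v w)) z \<partial>lborel) = (\<integral>\<^sup>+u. \<integral>\<^sup>+v. \<integral>\<^sup>+w. ennreal (f u v w) \<partial>lborel \<partial>lborel \<partial>lborel)"
        by (rule nn_integral_tri[OF mfe])
      also have "\<dots> \<le> (\<integral>\<^sup>+u. \<integral>\<^sup>+v. ennreal (U1 u) * ennreal (U2 v) * ennreal (C1 * B) \<partial>lborel \<partial>lborel)"
        by (intro nn_integral_mono w)
      also have "\<dots> = (\<integral>\<^sup>+u. ennreal (U1 u) \<partial>lborel) * (\<integral>\<^sup>+u. ennreal (U2 u) \<partial>lborel) * ennreal (C1 * B)"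
        by (simp add: nn_integral_cmult nn_integral_multc)
      also have "\<dots> \<le> ennreal n1 * ennreal n2 * ennreal (C1 * B)"
        by (intro mult_mono mass) auto
      also have "\<dots> = ennreal (n1 * n2 * (C1 * B))"
        using n C B by (simp add: ennreal_mult)
      finally show ?thesis .
    qed
    have ker: "trilinear_ker p \<beta> R U1 U2 U3 u v w = ennreal ((f u v w * g u v w) powr (1/p) * h u v w powr (1 - 2/p))" for u v w
    proof (cases "R (fst u) (fst v) (fst w)")
      case True
      define P where "P = \<bar>fst u + fst v + fst w\<bar> powr p * freq_mult (fst u) (fst v) (fst w) * (U1 u * U2 v * U3 w)"
      define V0 where "V0 = V (fst u) (fst v) (fst w)"
      define mm where "mm = modulation u * modulation v * modulation w"
      have P: "P \<ge> 0" using U by (simp add: P_def)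
      have V0: "V0 > 0" and j: "jac (fst u) (fst v) > 0" using pos[OF True] by (auto simp: V0_def)
      have mm: "mm > 0" "mm powr - \<beta> = modulation u powr - \<beta> * modulation v powr - \<beta> * modulation w powr - \<beta>"
        by (simp_all add: mm_def powr_mult less_imp_le)
      have "f u v w * g u v w = P / V0 powr (p - 2) * mm powr - \<beta>"
        unfolding f_def g_def P_def mm(2) using True j V0 by (simp add: X_def V0_def field_simps)
      moreover have "h u v w = V0 * mm powr - \<beta>"
        unfolding h_def mm(2) using True by (simp add: V0_def)
      ultimately show ?thesis
        using Hoelder_exponents[OF p P V0 mm(1), of \<beta>] True
        by (simp add: trilinear_ker_def P_def mm_def)
    qed (simp add: trilinear_ker_def h_def)
    show "Lp_le p (tri (trilinear_ker p \<beta> R U1 U2 U3)) (K0 * (C1 * B) * (n1 * n2 * n3))"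
      unfolding Lp_le_def
    proof (intro bexI[of _ "\<lambda>z. ennreal (n3 * K0) * tri (\<lambda>u v w. ennreal (f u v w)) z"] conjI allI impI)
      have "(\<integral>\<^sup>+z. ennreal (n3 * K0) * tri (\<lambda>u v w. ennreal (f u v w)) z \<partial>lborel)
         = ennreal (n3 * K0) * (\<integral>\<^sup>+z. tri (\<lambda>u v w. ennreal (f u v w)) z \<partial>lborel)"
        using tri_measurable[OF mfe] by (intro nn_integral_cmult) simp
      also have "\<dots> \<le> ennreal (n3 * K0) * ennreal (n1 * n2 * (C1 * B))"
        by (intro mult_left_mono If) simp
      also have "\<dots> = ennreal (K0 * (C1 * B) * (n1 * n2 * n3))"
        using n K0 C B by (simp add: ennreal_mult[symmetric] ac_simps)
      finally show "(\<integral>\<^sup>+z. ennreal (n3 * K0) * tri (\<lambda>u v w. ennreal (f u v w)) z \<partial>lborel) \<le> ennreal (K0 * (C1 * B) * (n1 * n2 * n3))" .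
    next
      fix z and t :: real
      assume t: "0 < t" and le: "ennreal (n3 * K0) * tri (\<lambda>u v w. ennreal (f u v w)) z \<le> ennreal t"
      define L where "L = n3 * K0"
      have L: "L > 0" using n K0 by (simp add: L_def)
      have f: "tri (\<lambda>u v w. ennreal (f u v w)) z \<le> ennreal (t / L)"
      proof -
        have "ennreal (1/L) * (ennreal L * tri (\<lambda>u v w. ennreal (f u v w)) z) \<le> ennreal (1/L) * ennreal t"
          using le unfolding L_def by (rule mult_left_mono) simp
        then show ?thesis
          using L t by (simp add: mult.assoc[symmetric] ennreal_mult[symmetric])
      qed
      have g: "tri (\<lambda>u v w. ennreal (g u v w)) z \<le> ennreal (n3 * B\<^sup>2)"
      proof -
        have "tri (\<lambda>u v w. ennreal (g u v w)) z = tri (\<lambda>u v w. ennreal (U3 w) * (ennreal (jac (fst u) (fst v)) * (J (snd u - fst u ^ 3) * J (snd v - fst v ^ 3)))) z"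
          using U by (intro tri_cong) (simp add: g_def J_def modulation_def ennreal_mult)
        then show ?thesis using second[OF m(3)] by simp
      qed
      have h: "tri (\<lambda>u v w. ennreal (h u v w)) z \<le> ennreal c"
      proof -
        have "tri (\<lambda>u v w. ennreal (h u v w)) z = tri (\<lambda>u v w. if R (fst u) (fst v) (fst w) then ennreal (V (fst u) (fst v) (fst w)) * (J (snd u - fst u ^ 3) * J (snd v - fst v ^ 3) * J (snd w - fst w ^ 3)) else 0) z"
          using pos by (intro tri_cong) (simp add: h_def J_def modulation_def ennreal_mult less_imp_le)
        then show ?thesis using third by simp
      qed
      have "tri (trilinear_ker p \<beta> R U1 U2 U3) z = tri (\<lambda>u v w. ennreal ((f u v w * g u v w) powr (1/p) * h u v w powr (1 - 2/p))) z"
        by (rule tri_cong) (rule ker)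
      also have "\<dots> \<le> ennreal ((t / L * (n3 * B\<^sup>2)) powr (1/p) * c powr (1 - 2/p))"
        using t L n B c by (intro tri_Holder mf nn p f g h) auto
      \<comment> \<open>The factors 1 powr -\<beta> are inserted to match
        \<open>Hoelder_exponents\<close> with \<open>V = c\<close> and \<open>m = 1\<close>.\<close>
      also have "t / L * (n3 * B\<^sup>2) = t / c powr (p - 2) * 1 powr - \<beta>"
        using n B c by (simp add: L_def K0_def field_simps)
      also have "c powr (1 - 2/p) = (c * 1 powr - \<beta>) powr (1 - 2/p)" by simp
      finally show "tri (trilinear_ker p \<beta> R U1 U2 U3) z \<le> ennreal (t powr (1/p))"
        using Hoelder_exponents[OF p _ c, of t 1 \<beta>] t by simp
    qed (use tri_measurable[OF mfe] in simp)
  qed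
qed

section \<open>Integrals along the resonance function\<close>

text \<open>For fixed x the value u of the resonance function replaces y, at the price of the
  Jacobian of the pair (y, w). After interchanging the integrals, x is integrated for fixed u; this
  is why the weight \<open>h\<close> may depend on u.\<close>

lemma tri_resonance_le1:
  fixes h :: "real \<Rightarrow> real \<Rightarrow> ennreal"
  assumes [measurable]: "(\<lambda>(x, u). h x u) \<in> borel_measurable (borel \<Otimes>\<^sub>M borel)" "g \<in> borel_measurable borel"
    and h: "\<And>u. (\<integral>\<^sup>+x. h x u \<partial>lborel) \<le> C"
  shows "tri (\<lambda>x y w. ennreal (jac y w) * (h x (resonance x y w) * g (resonance x y w))) \<xi> \<le> C * (\<integral>\<^sup>+u. g u \<partial>lborel)"
proof -
  have "tri (\<lambda>x y w. ennreal (jac y w) * (h x (resonance x y w) * g (resonance x y w))) \<xi>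
    \<le> (\<integral>\<^sup>+x. \<integral>\<^sup>+u. h x u * g u \<partial>lborel \<partial>lborel)"
    unfolding tri_def
  proof (rule nn_integral_mono)
    fix x
    define c where "c = \<xi> - x"
    have "(\<integral>\<^sup>+y. ennreal (jac y (c - y)) * (\<lambda>u. h x u * g u) ((\<xi> ^ 3 - x ^ 3) - y ^ 3 - (c - y) ^ 3) \<partial>lborel) \<le> (\<integral>\<^sup>+u. h x u * g u \<partial>lborel)"
      by (rule nn_integral_jac) measurable
    moreover have "resonance x y (c - y) = (\<xi> ^ 3 - x ^ 3) - y ^ 3 - (c - y) ^ 3" for y
      by (simp add: resonance_def c_def)
    ultimately show "(\<integral>\<^sup>+y. ennreal (jac y (\<xi> - x - y)) * (h x (resonance x y (\<xi> - x - y)) * g (resonance x y (\<xi> - x - y))) \<partial>lborel)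
        \<le> (\<integral>\<^sup>+u. h x u * g u \<partial>lborel)"
      by (simp add: c_def)
  qed
  also have "\<dots> = (\<integral>\<^sup>+u. \<integral>\<^sup>+x. h x u * g u \<partial>lborel \<partial>lborel)"
    by (rule nn_integral_lborel_swap) measurable
  also have "\<dots> = (\<integral>\<^sup>+u. (\<integral>\<^sup>+x. h x u \<partial>lborel) * g u \<partial>lborel)"
    by (intro nn_integral_cong nn_integral_multc) measurable
  also have "\<dots> \<le> (\<integral>\<^sup>+u. C * g u \<partial>lborel)"
    by (intro nn_integral_mono mult_right_mono h) simp
  also have "\<dots> = C * (\<integral>\<^sup>+u. g u \<partial>lborel)" by (rule nn_integral_cmult) measurable
  finally show ?thesis .
qed

lemma resonance_permute: "resonance y x w = resonance x y w" "resonance x w y = resonance x y w"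
  by (simp_all add: resonance_def algebra_simps)

lemma tri_resonance_le3:
  fixes h :: "real \<Rightarrow> real \<Rightarrow> ennreal"
  assumes [measurable]: "(\<lambda>(x, u). h x u) \<in> borel_measurable (borel \<Otimes>\<^sub>M borel)" "g \<in> borel_measurable borel"
    and h: "\<And>u. (\<integral>\<^sup>+x. h x u \<partial>lborel) \<le> C"
  shows "tri (\<lambda>x y w. ennreal (jac x y) * (h w (resonance x y w) * g (resonance x y w))) \<xi> \<le> C * (\<integral>\<^sup>+u. g u \<partial>lborel)"
proof -
  define K where "K x y w = ennreal (jac y w) * (h x (resonance x y w) * g (resonance x y w))" for x y w
  have K: "measurable3 K" unfolding measurable3_def K_def by measurable
  have "(\<lambda>x y w. ennreal (jac x y) * (h w (resonance x y w) * g (resonance x y w))) = (\<lambda>x y w. K w x y)"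
    unfolding K_def by (intro ext) (metis resonance_permute)
  moreover have "tri (\<lambda>x y w. K w x y) \<xi> = tri K \<xi>"
    using tri_swap23[OF measurable3_permute(1)[OF K], of \<xi>] tri_swap12[OF K, of \<xi>] by simp
  ultimately show ?thesis
    using tri_resonance_le1[OF assms] unfolding K_def by simp
qed

section \<open>One-dimensional bounds and criteria for regions\<close>

lemma nn_integral_ennreal_cmult_le:
  fixes f :: "'a::euclidean_space \<Rightarrow> real"
  assumes "f \<in> borel_measurable borel" "(\<integral>\<^sup>+x. ennreal (f x) \<partial>lborel) \<le> ennreal a" "0 \<le> c" "0 \<le> a"
  shows "(\<integral>\<^sup>+x. ennreal (c * f x) \<partial>lborel) \<le> ennreal (c * a)"
proof -
  have "(\<integral>\<^sup>+x. ennreal (c * f x) \<partial>lborel) = ennreal c * (\<integral>\<^sup>+x. ennreal (f x) \<partial>lborel)"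
    using assms by (simp add: ennreal_mult' nn_integral_cmult)
  also have "\<dots> \<le> ennreal c * ennreal a" using assms by (intro mult_left_mono) auto
  finally show ?thesis using assms by (simp add: ennreal_mult)
qed

lemma nn_integral_short:
  fixes m L :: real
  assumes "0 \<le> L"
  shows "(\<integral>\<^sup>+x. ennreal (if \<bar>x - m\<bar> \<le> L then 1 else 0) \<partial>lborel) \<le> ennreal (2 * L)"
proof -
  have "(\<integral>\<^sup>+x. ennreal (if \<bar>x - m\<bar> \<le> L then 1 else 0) \<partial>lborel) = (\<integral>\<^sup>+x. indicator {m - L..m + L} x \<partial>lborel)"
    by (intro nn_integral_cong) (auto split: split_indicator simp: abs_le_iff)
  then show ?thesis using assms by simp
qed

lemma nn_integral_japan_sqrt:
  assumes "0 \<le> L"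
  shows "(\<integral>\<^sup>+x. ennreal (if \<bar>x\<bar> \<le> L then 1 / sqrt (japan x) else 0) \<partial>lborel) \<le> ennreal (4 * sqrt L)"
proof -
  have "AE x::real in lborel. x \<noteq> 0" by (rule AE_lborel_singleton)
  then have "AE x in lborel. ennreal (if \<bar>x\<bar> \<le> L then 1 / sqrt (japan x) else 0) \<le> ennreal (if \<bar>x\<bar> \<le> L then \<bar>x\<bar> powr - (1/2) else 0)"
  proof eventually_elim
    case (elim x)
    then have "1 / sqrt (japan x) \<le> 1 / sqrt \<bar>x\<bar>"
      using abs_le_japan[of x] by (intro divide_left_mono) auto
    also have "1 / sqrt \<bar>x\<bar> = \<bar>x\<bar> powr - (1/2)"
      using elim by (simp add: powr_minus_divide powr_half_sqrt)
    finally show ?case by (cases "\<bar>x\<bar> \<le> L") (simp_all add: ennreal_leI)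
  qed
  then show ?thesis
    by (rule order_trans[OF nn_integral_mono_AE nn_integral_inverse_sqrt[OF assms]])
qed

text \<open>The integral is scale invariant: the part |\<eta>| \<le> |\<xi>| and the tail contribute
  2 each.\<close>

lemma nn_integral_generic_weight:
  "(\<integral>\<^sup>+\<eta>. ennreal (\<bar>\<xi>\<bar> / max (\<xi>\<^sup>2) (\<eta>\<^sup>2)) \<partial>lborel) \<le> ennreal 4"
proof (cases "\<xi> = 0")
  case False
  have "(\<integral>\<^sup>+\<eta>. ennreal (\<bar>\<xi>\<bar> / max (\<xi>\<^sup>2) (\<eta>\<^sup>2)) \<partial>lborel)
      \<le> (\<integral>\<^sup>+\<eta>. ennreal (1 / \<bar>\<xi>\<bar> * (if \<bar>\<eta> - 0\<bar> \<le> \<bar>\<xi>\<bar> then 1 else 0)) + ennreal (\<bar>\<xi>\<bar> * (if \<bar>\<xi>\<bar> \<le> \<bar>\<eta>\<bar> then \<bar>\<eta>\<bar> powr - 2 else 0)) \<partial>lborel)"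
  proof (rule nn_integral_mono)
    fix \<eta>
    show "ennreal (\<bar>\<xi>\<bar> / max (\<xi>\<^sup>2) (\<eta>\<^sup>2)) \<le> ennreal (1 / \<bar>\<xi>\<bar> * (if \<bar>\<eta> - 0\<bar> \<le> \<bar>\<xi>\<bar> then 1 else 0)) + ennreal (\<bar>\<xi>\<bar> * (if \<bar>\<xi>\<bar> \<le> \<bar>\<eta>\<bar> then \<bar>\<eta>\<bar> powr - 2 else 0))"
    proof (cases "\<bar>\<eta>\<bar> \<le> \<bar>\<xi>\<bar>")
      case True
      then have "max (\<xi>\<^sup>2) (\<eta>\<^sup>2) = \<bar>\<xi>\<bar> * \<bar>\<xi>\<bar>"
        by (simp add: max_absorb1 abs_le_square_iff power2_eq_square)
      then have "\<bar>\<xi>\<bar> / max (\<xi>\<^sup>2) (\<eta>\<^sup>2) = \<bar>\<xi>\<bar> / (\<bar>\<xi>\<bar> * \<bar>\<xi>\<bar>)" by (rule arg_cong)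
      also have "\<dots> = 1 / \<bar>\<xi>\<bar> * (if \<bar>\<eta> - 0\<bar> \<le> \<bar>\<xi>\<bar> then 1 else 0)"
        using False True by (simp add: divide_simps)
      finally show ?thesis by (metis add_increasing2 order_refl zero_le)
    next
      case F: False
      then have "max (\<xi>\<^sup>2) (\<eta>\<^sup>2) = \<bar>\<eta>\<bar>\<^sup>2"
        by (metis abs_le_square_iff linear max_absorb2 power2_abs)
      moreover have "\<bar>\<eta>\<bar> powr - 2 = 1 / \<bar>\<eta>\<bar>\<^sup>2" using F by (simp add: powr_minus_divide)
      ultimately have "\<bar>\<xi>\<bar> / max (\<xi>\<^sup>2) (\<eta>\<^sup>2) = \<bar>\<xi>\<bar> * (if \<bar>\<xi>\<bar> \<le> \<bar>\<eta>\<bar> then \<bar>\<eta>\<bar> powr - 2 else 0)"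
        using F by simp
      then show ?thesis by (metis add_increasing order_refl zero_le)
    qed
  qed
  also have "\<dots> = (\<integral>\<^sup>+\<eta>. ennreal (1 / \<bar>\<xi>\<bar> * (if \<bar>\<eta> - 0\<bar> \<le> \<bar>\<xi>\<bar> then 1 else 0)) \<partial>lborel) + (\<integral>\<^sup>+\<eta>. ennreal (\<bar>\<xi>\<bar> * (if \<bar>\<xi>\<bar> \<le> \<bar>\<eta>\<bar> then \<bar>\<eta>\<bar> powr - 2 else 0)) \<partial>lborel)"
    by (rule nn_integral_add) measurable
  also have "\<dots> \<le> ennreal (1 / \<bar>\<xi>\<bar> * (2 * \<bar>\<xi>\<bar>)) + ennreal (\<bar>\<xi>\<bar> * (2 * \<bar>\<xi>\<bar> powr (1 - 2) / (2 - 1)))"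
  proof (intro add_mono nn_integral_ennreal_cmult_le)
    show "(\<integral>\<^sup>+\<eta>. ennreal (if \<bar>\<eta> - 0\<bar> \<le> \<bar>\<xi>\<bar> then 1 else 0) \<partial>lborel) \<le> ennreal (2 * \<bar>\<xi>\<bar>)"
      by (rule nn_integral_short) simp
    show "(\<integral>\<^sup>+\<eta>. ennreal (if \<bar>\<xi>\<bar> \<le> \<bar>\<eta>\<bar> then \<bar>\<eta>\<bar> powr - 2 else 0) \<partial>lborel) \<le> ennreal (2 * \<bar>\<xi>\<bar> powr (1 - 2) / (2 - 1))"
      by (rule nn_integral_powr_tail_even) (use False in auto)
  qed simp_all
  also have "\<dots> = ennreal 4"
  proof -
    have 1: "1 / \<bar>\<xi>\<bar> * (2 * \<bar>\<xi>\<bar>) = 2" "\<bar>\<xi>\<bar> * (2 * \<bar>\<xi>\<bar> powr (1 - 2) / (2 - 1)) = 2"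
      using False by (simp_all add: powr_minus_divide)
    show ?thesis unfolding 1 by (subst ennreal_plus[symmetric]) simp_all
  qed
  finally show ?thesis .
qed simp

text \<open>\<open>lam\<close> is a loss factor which makes up for a logarithmic divergence in \<open>H3\<close>;
  it is \<open>1\<close> except in the nearly resonant region.\<close>

lemma controlled_region:
  assumes p: "p \<ge> 2" and \<beta>: "\<beta> > 1" and R: "pred3 R" and lam: "measurable3 lam"
    and pos: "\<And>x y w. R x y w \<Longrightarrow> x + y + w \<noteq> 0 \<and> 0 < lam x y w \<and> lam x y w \<le> 1 \<and> 0 < jac x y"
    and C: "C1 > 0" "C3 > 0"
    and H1: "\<And>x y. (\<integral>\<^sup>+w. ennreal (if R x y w then (x + y + w)\<^sup>2 * freq_mult x y w / (sqrt (lam x y w) * jac x y) else 0) \<partial>lborel) \<le> ennreal C1"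
    and H3: "\<And>\<xi> g. g \<in> borel_measurable borel \<Longrightarrow>
        tri (\<lambda>x y w. if R x y w then ennreal (\<bar>\<xi>\<bar> * lam x y w powr (1 / (2 * p))) * g (resonance x y w) else 0) \<xi> \<le> ennreal C3 * (\<integral>\<^sup>+u. g u \<partial>lborel)"
  shows "controlled p \<beta> R"
proof (rule controlled_Schur[where V = "\<lambda>x y w. \<bar>x + y + w\<bar> * lam x y w powr (1 / (2 * p))", OF p \<beta> R _ _ C])
  note measurable3_compose[OF lam, measurable (raw)]
  show "measurable3 (\<lambda>x y w. \<bar>x + y + w\<bar> * lam x y w powr (1 / (2 * p)))"
    unfolding measurable3_def by measurable
  show "0 < \<bar>x + y + w\<bar> * lam x y w powr (1 / (2 * p)) \<and> 0 < jac x y" if "R x y w" for x y w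
    using pos[OF that] by simp
  show "(\<integral>\<^sup>+w. (if R x y w then ennreal (\<bar>x + y + w\<bar> powr p * freq_mult x y w / ((\<bar>x + y + w\<bar> * lam x y w powr (1 / (2 * p))) powr (p - 2) * jac x y)) else 0) \<partial>lborel) \<le> ennreal C1" for x y
  proof (rule order_trans[OF nn_integral_mono H1])
    fix w
    show "(if R x y w then ennreal (\<bar>x + y + w\<bar> powr p * freq_mult x y w / ((\<bar>x + y + w\<bar> * lam x y w powr (1 / (2 * p))) powr (p - 2) * jac x y)) else 0)
      \<le> ennreal (if R x y w then (x + y + w)\<^sup>2 * freq_mult x y w / (sqrt (lam x y w) * jac x y) else 0)"
    proof (cases "R x y w")
      case True
      define X l where "X = \<bar>x + y + w\<bar>" and "l = lam x y w"
      have X: "X > 0" and l: "0 < l" "l \<le> 1" and j: "0 < jac x y" using pos[OF True] by (auto simp: X_def l_def)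
      \<comment> \<open>The first factor contains the power -(p - 2)/(2p) of \<open>lam\<close>. As
        \<open>lam\<close> is at most 1 and (p - 2)/(2p) is below 1/2, the loss is at most 1 /
        sqrt(lam) for every p.\<close>
      have "sqrt l \<le> l powr (1 / (2 * p) * (p - 2))"
        unfolding powr_half_sqrt[OF less_imp_le[OF l(1)], symmetric]
        using l p by (intro powr_mono') (auto simp: field_simps)
      then have le: "X powr (p - 2) * sqrt l \<le> (X * l powr (1 / (2 * p))) powr (p - 2)"
        using X l by (simp add: powr_mult powr_powr)
      have "X powr p * freq_mult x y w / ((X * l powr (1 / (2 * p))) powr (p - 2) * jac x y)
         \<le> X powr p * freq_mult x y w / (X powr (p - 2) * sqrt l * jac x y)"
        using X l j le by (intro divide_left_mono mult_right_mono mult_pos_pos) auto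
      also have "\<dots> = X\<^sup>2 * freq_mult x y w / (sqrt l * jac x y)"
      proof -
        have "X powr p = X powr (p - 2) * X\<^sup>2" using X by (simp add: powr_diff)
        then show ?thesis using X by simp
      qed
      finally show ?thesis
        using True by (simp add: X_def l_def ennreal_leI)
    qed simp
  qed
  show "tri (\<lambda>x y w. if R x y w then ennreal (\<bar>x + y + w\<bar> * lam x y w powr (1 / (2 * p))) * g (resonance x y w) else 0) \<xi>
      \<le> ennreal C3 * (\<integral>\<^sup>+u. g u \<partial>lborel)" if "g \<in> borel_measurable borel" for \<xi> g
    by (rule order_trans[OF eq_refl[OF tri_cong] H3[OF that]]) auto
qed

text \<open>If the Jacobian dominates the squares of \<xi> and of the frequency \<eta> outside its
  pair, then |\<xi>| / jac is integrable in \<eta> uniformly in \<xi>, which is \<open>H3\<close>.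
  The alternative in \<open>J\<close> lets the third factor substitute in the pair (y, w) although
  the second factor always uses (x, y).\<close>

lemma controlled_generic:
  assumes p: "p \<ge> 2" and \<beta>: "\<beta> > 1" and R: "pred3 R"
    and k: "k > 0" and J: "J = (\<lambda>x y w. k * max ((x + y + w)\<^sup>2) (w\<^sup>2) \<le> jac x y) \<or> J = (\<lambda>x y w. k * max ((x + y + w)\<^sup>2) (x\<^sup>2) \<le> jac y w)"
    and pos: "\<And>x y w. R x y w \<Longrightarrow> x + y + w \<noteq> 0 \<and> 0 < jac x y \<and> J x y w"
    and C: "C1 > 0"
    and H1: "\<And>x y. (\<integral>\<^sup>+w. ennreal (if R x y w then (x + y + w)\<^sup>2 * freq_mult x y w / jac x y else 0) \<partial>lborel) \<le> ennreal C1"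
  shows "controlled p \<beta> R"
proof (rule controlled_region[where lam = "\<lambda>_ _ _. 1", OF p \<beta> R])
  show "measurable3 (\<lambda>(_::real) (_::real) (_::real). 1 :: real)" unfolding measurable3_def by measurable
  show "x + y + w \<noteq> 0 \<and> (0::real) < 1 \<and> (1::real) \<le> 1 \<and> 0 < jac x y" if "R x y w" for x y w
    using pos[OF that] by simp
  show "C1 > 0" by fact
  show "4 / k > 0" using k by simp
  show "(\<integral>\<^sup>+w. ennreal (if R x y w then (x + y + w)\<^sup>2 * freq_mult x y w / (sqrt 1 * jac x y) else 0) \<partial>lborel) \<le> ennreal C1" for x y
    by (simp only: real_sqrt_one mult_1_left H1)
  fix \<xi> :: real and g :: "real \<Rightarrow> ennreal" assume g [measurable]: "g \<in> borel_measurable borel"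
  define h where "h \<eta> u = ennreal (1 / k * (\<bar>\<xi>\<bar> / max (\<xi>\<^sup>2) (\<eta>\<^sup>2)))" for \<eta> u :: real
  have hm: "(\<lambda>(x, u). h x u) \<in> borel_measurable (borel \<Otimes>\<^sub>M borel)" unfolding h_def by measurable
  have hi: "(\<integral>\<^sup>+x. h x u \<partial>lborel) \<le> ennreal (4 / k)" for u
  proof -
    have "(\<integral>\<^sup>+x. h x u \<partial>lborel) \<le> ennreal (1 / k * 4)"
      unfolding h_def by (rule nn_integral_ennreal_cmult_le[OF _ nn_integral_generic_weight]) (use k in auto)
    then show ?thesis by (simp only: times_divide_eq_left mult_1_left)
  qed
  have key: "ennreal \<bar>\<xi>\<bar> \<le> ennreal j * h \<eta> u" if "k * max (\<xi>\<^sup>2) (\<eta>\<^sup>2) \<le> j" "\<xi> \<noteq> 0" for j \<eta> u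
  proof -
    have m: "0 < max (\<xi>\<^sup>2) (\<eta>\<^sup>2)" using that by (simp add: less_max_iff_disj)
    have "\<bar>\<xi>\<bar> = (k * max (\<xi>\<^sup>2) (\<eta>\<^sup>2)) * (1 / k * (\<bar>\<xi>\<bar> / max (\<xi>\<^sup>2) (\<eta>\<^sup>2)))" using k m by simp
    also have "\<dots> \<le> j * (1 / k * (\<bar>\<xi>\<bar> / max (\<xi>\<^sup>2) (\<eta>\<^sup>2)))" using that k m by (intro mult_right_mono) auto
    finally have le: "\<bar>\<xi>\<bar> \<le> j * (1 / k * (\<bar>\<xi>\<bar> / max (\<xi>\<^sup>2) (\<eta>\<^sup>2)))" .
    have "0 \<le> j" using that(1) k m by (meson less_imp_le mult_pos_pos order_trans)
    then have "ennreal j * h \<eta> u = ennreal (j * (1 / k * (\<bar>\<xi>\<bar> / max (\<xi>\<^sup>2) (\<eta>\<^sup>2))))"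
      unfolding h_def by (rule ennreal_mult'[symmetric])
    then show ?thesis using le by (simp only: ennreal_leI)
  qed
  show "tri (\<lambda>x y w. if R x y w then ennreal (\<bar>\<xi>\<bar> * 1 powr (1 / (2 * p))) * g (resonance x y w) else 0) \<xi> \<le> ennreal (4 / k) * (\<integral>\<^sup>+u. g u \<partial>lborel)"
    using J
  proof
    assume J: "J = (\<lambda>x y w. k * max ((x + y + w)\<^sup>2) (w\<^sup>2) \<le> jac x y)"
    have "tri (\<lambda>x y w. if R x y w then ennreal (\<bar>\<xi>\<bar> * 1 powr (1 / (2 * p))) * g (resonance x y w) else 0) \<xi>
       \<le> tri (\<lambda>x y w. ennreal (jac x y) * (h w (resonance x y w) * g (resonance x y w))) \<xi>"
    proof (rule tri_mono)
      fix x y w assume s: "x + y + w = \<xi>"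
      show "(if R x y w then ennreal (\<bar>\<xi>\<bar> * 1 powr (1 / (2 * p))) * g (resonance x y w) else 0) \<le> ennreal (jac x y) * (h w (resonance x y w) * g (resonance x y w))"
      proof (cases "R x y w")
        case True
        then have "ennreal \<bar>\<xi>\<bar> \<le> ennreal (jac x y) * h w (resonance x y w)"
          using pos[OF True] s by (intro key) (auto simp: J)
        then have "ennreal \<bar>\<xi>\<bar> * g (resonance x y w) \<le> ennreal (jac x y) * h w (resonance x y w) * g (resonance x y w)"
          by (rule mult_right_mono) simp
        then show ?thesis using True by (simp only: if_True powr_one_eq_one mult_1_right mult.assoc)
      qed (simp only: if_False zero_le)
    qed
    also have "\<dots> \<le> ennreal (4 / k) * (\<integral>\<^sup>+u. g u \<partial>lborel)" by (rule tri_resonance_le3[OF hm g hi])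
    finally show ?thesis .
  next
    assume J: "J = (\<lambda>x y w. k * max ((x + y + w)\<^sup>2) (x\<^sup>2) \<le> jac y w)"
    have "tri (\<lambda>x y w. if R x y w then ennreal (\<bar>\<xi>\<bar> * 1 powr (1 / (2 * p))) * g (resonance x y w) else 0) \<xi>
       \<le> tri (\<lambda>x y w. ennreal (jac y w) * (h x (resonance x y w) * g (resonance x y w))) \<xi>"
    proof (rule tri_mono)
      fix x y w assume s: "x + y + w = \<xi>"
      show "(if R x y w then ennreal (\<bar>\<xi>\<bar> * 1 powr (1 / (2 * p))) * g (resonance x y w) else 0) \<le> ennreal (jac y w) * (h x (resonance x y w) * g (resonance x y w))"
      proof (cases "R x y w")
        case True
        then have "ennreal \<bar>\<xi>\<bar> \<le> ennreal (jac y w) * h x (resonance x y w)"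
          using pos[OF True] s by (intro key) (auto simp: J)
        then have "ennreal \<bar>\<xi>\<bar> * g (resonance x y w) \<le> ennreal (jac y w) * h x (resonance x y w) * g (resonance x y w)"
          by (rule mult_right_mono) simp
        then show ?thesis using True by (simp only: if_True powr_one_eq_one mult_1_right mult.assoc)
      qed (simp only: if_False zero_le)
    qed
    also have "\<dots> \<le> ennreal (4 / k) * (\<integral>\<^sup>+u. g u \<partial>lborel)" by (rule tri_resonance_le1[OF hm g hi])
    finally show ?thesis .
  qed
qed

section \<open>Frequency regions\<close>

lemma freq_mult_commute: "freq_mult y x w = freq_mult x y w" "freq_mult x w y = freq_mult x y w"
  by (simp_all add: freq_mult_def ac_simps)

lemma freq_mult_le:
  assumes k: "1 \<le> k" and le: "\<bar>x + y + w\<bar> \<le> k * \<bar>x\<bar>"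
  shows "freq_mult x y w \<le> sqrt (k / (japan y * japan w))"
proof -
  have "japan (x + y + w) / (japan x * japan y * japan w) \<le> k * japan x / (japan x * japan y * japan w)"
    using japan_scale[OF k le] by (intro divide_right_mono) auto
  also have "\<dots> = k / (japan y * japan w)" by simp
  finally show ?thesis unfolding freq_mult_def by (rule real_sqrt_le_mono)
qed

text \<open>In every region \<open>w\<close> is the frequency whose function is isolated in \<open>controlled_Schur\<close>.\<close>

definition low_region :: "real \<Rightarrow> real \<Rightarrow> real \<Rightarrow> bool" where
  "low_region x y w \<longleftrightarrow> x + y + w \<noteq> 0 \<and> \<bar>w\<bar> \<le> \<bar>y\<bar> \<and> \<bar>y\<bar> \<le> \<bar>x\<bar> \<and>
     1/900 * max ((x + y + w)\<^sup>2) (w\<^sup>2) \<le> jac x y"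

text \<open>Two frequencies of comparable size with the output controlled by the third one.
  Isolating one of the large ones leaves a pair of clearly different size, whose Jacobian is of
  order x^2.\<close>

definition high_region :: "real \<Rightarrow> real \<Rightarrow> real \<Rightarrow> bool" where
  "high_region x y w \<longleftrightarrow> x + y + w \<noteq> 0 \<and> \<bar>y\<bar> \<le> 9/10 * \<bar>x\<bar> \<and> \<bar>x\<bar> / 2 \<le> \<bar>w\<bar> \<and> \<bar>w\<bar> \<le> \<bar>x\<bar> \<and> \<bar>x + y + w\<bar> \<le> 2 * \<bar>y\<bar>"

text \<open>Meant for two close large frequencies x and w. The threshold |x| <y> is the squared
  length of the w-interval which the multiplier can absorb; beyond it,
  \<open>parallel_long_region\<close> takes over with y and w exchanged.\<close>

definition parallel_short_region :: "real \<Rightarrow> real \<Rightarrow> real \<Rightarrow> bool" where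
  "parallel_short_region x y w \<longleftrightarrow> x + y + w \<noteq> 0 \<and> \<bar>y\<bar> \<le> 9/10 * \<bar>x\<bar> \<and> \<bar>x\<bar> / 2 \<le> \<bar>w\<bar> \<and> \<bar>w\<bar> \<le> \<bar>x\<bar> \<and> (w - x)\<^sup>2 \<le> \<bar>x\<bar> * japan y"

definition parallel_long_region :: "real \<Rightarrow> real \<Rightarrow> real \<Rightarrow> bool" where
  "parallel_long_region x y w \<longleftrightarrow> x + y + w \<noteq> 0 \<and> 0 < x * y \<and> \<bar>y\<bar> \<le> \<bar>x\<bar> \<and> 95/100 * \<bar>x\<bar> \<le> \<bar>y\<bar> \<and> \<bar>w\<bar> \<le> 9/10 * \<bar>x\<bar> \<and> \<bar>x\<bar> * japan w \<le> (x - y)\<^sup>2"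

text \<open>Two small pairwise sums force x and w to be near \<xi> and y near -\<xi>. The sum y + w
  containing the isolated frequency is the smaller one.\<close>

definition resonant_region :: "real \<Rightarrow> real \<Rightarrow> real \<Rightarrow> bool" where
  "resonant_region x y w \<longleftrightarrow> x + y + w \<noteq> 0 \<and> y + w \<noteq> 0 \<and> \<bar>y + w\<bar> \<le> \<bar>x + y\<bar> \<and> \<bar>x + y\<bar> \<le> \<bar>x + y + w\<bar> / 4"

text \<open>The first inequality says that w lies between x and y; the second puts all three close
  to \<xi>/3. The isolated frequency is the middle one because the outer two have the largest
  Jacobian up to constants.\<close>

definition diagonal_region :: "real \<Rightarrow> real \<Rightarrow> real \<Rightarrow> bool" where
  "diagonal_region x y w \<longleftrightarrow> x \<noteq> y \<and> \<bar>2 * w - x - y\<bar> \<le> \<bar>x - y\<bar> \<and> \<bar>x - y\<bar> \<le> \<bar>x + y + w\<bar> / 5"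

lemma pred3_regions:
  "pred3 low_region" "pred3 high_region" "pred3 parallel_short_region" "pred3 parallel_long_region"
  "pred3 resonant_region" "pred3 diagonal_region"
  unfolding pred3_def low_region_def high_region_def parallel_short_region_def parallel_long_region_def
    resonant_region_def diagonal_region_def
  by measurable

lemma nn_integral_bound_indicator:
  assumes "(\<lambda>w. g w) \<in> borel_measurable borel" "(\<integral>\<^sup>+w. ennreal (g w) \<partial>lborel) \<le> ennreal a" "0 \<le> a" "0 \<le> c" "c * a \<le> C"
    and "\<And>w. R w \<Longrightarrow> f w \<le> c * g w" "\<And>w. 0 \<le> g w"
  shows "(\<integral>\<^sup>+w. ennreal (if R w then f w else 0) \<partial>lborel) \<le> ennreal C"
proof -
  have "(\<integral>\<^sup>+w. ennreal (if R w then f w else 0) \<partial>lborel) \<le> (\<integral>\<^sup>+w. ennreal (c * g w) \<partial>lborel)"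
    using assms by (intro nn_integral_mono ennreal_leI) auto
  also have "\<dots> \<le> ennreal (c * a)" by (rule nn_integral_ennreal_cmult_le[OF assms(1,2,4,3)])
  also have "\<dots> \<le> ennreal C" by (rule ennreal_leI) fact
  finally show ?thesis .
qed

lemma abs_sum_le3: "\<bar>y\<bar> \<le> \<bar>x\<bar> \<Longrightarrow> \<bar>w\<bar> \<le> \<bar>x\<bar> \<Longrightarrow> \<bar>x + y + w\<bar> \<le> 3 * \<bar>x :: real\<bar>"
  by linarith

section \<open>Regions in which some Jacobian is large\<close>

text \<open>The quotient of \<xi>^2 and the Jacobian is at most 900, and the multiplier is at most 2
  / sqrt(<y><w>). The integral of 1 / sqrt(<w>) over |w| \<le> |y| is at most 4 sqrt|y|, which the
  bracket of y absorbs: 900 * 2 * 4 = 7200.\<close>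

lemma controlled_low:
  assumes p: "p \<ge> 2" and \<beta>: "\<beta> > 1"
  shows "controlled p \<beta> low_region"
proof (rule controlled_generic[OF p \<beta> pred3_regions(1), of "1/900"])
  show "x + y + w \<noteq> 0 \<and> 0 < jac x y \<and> 1/900 * max ((x + y + w)\<^sup>2) (w\<^sup>2) \<le> jac x y" if "low_region x y w" for x y w
  proof -
    from that have R: "x + y + w \<noteq> 0" "1/900 * max ((x + y + w)\<^sup>2) (w\<^sup>2) \<le> jac x y" by (auto simp: low_region_def)
    then have "0 < 1/900 * max ((x + y + w)\<^sup>2) (w\<^sup>2)" by (simp add: less_max_iff_disj)
    with R show ?thesis by linarith
  qed
  show "(\<integral>\<^sup>+w. ennreal (if low_region x y w then (x + y + w)\<^sup>2 * freq_mult x y w / jac x y else 0) \<partial>lborel) \<le> ennreal 7200" for x y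
  proof (rule nn_integral_bound_indicator[where g = "\<lambda>w. if \<bar>w\<bar> \<le> \<bar>y\<bar> then 1 / sqrt (japan w) else 0" and c = "1800 / sqrt (japan y)"])
    show "(\<integral>\<^sup>+w. ennreal (if \<bar>w\<bar> \<le> \<bar>y\<bar> then 1 / sqrt (japan w) else 0) \<partial>lborel) \<le> ennreal (4 * sqrt \<bar>y\<bar>)"
      by (rule nn_integral_japan_sqrt) simp
    have "sqrt \<bar>y\<bar> \<le> sqrt (japan y)" using abs_le_japan by simp
    then show "1800 / sqrt (japan y) * (4 * sqrt \<bar>y\<bar>) \<le> 7200" by (simp add: divide_simps)
    fix w assume R: "low_region x y w"
    then have w: "\<bar>w\<bar> \<le> \<bar>y\<bar>" "\<bar>y\<bar> \<le> \<bar>x\<bar>" "x + y + w \<noteq> 0" and J: "1/900 * max ((x + y + w)\<^sup>2) (w\<^sup>2) \<le> jac x y"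
      by (auto simp: low_region_def)
    have "(x + y + w)\<^sup>2 / 900 \<le> jac x y" using J by (simp add: max_def split: if_splits)
    moreover have "(x + y + w)\<^sup>2 > 0" using w by simp
    ultimately have q: "(x + y + w)\<^sup>2 / jac x y \<le> 900" by (subst pos_divide_le_eq) linarith+
    have "freq_mult x y w \<le> sqrt (3 / (japan y * japan w))"
      using w by (intro freq_mult_le abs_sum_le3) auto
    also have "\<dots> \<le> sqrt (4 / (japan y * japan w))" by (intro real_sqrt_le_mono divide_right_mono) auto
    also have "\<dots> = 2 / (sqrt (japan y) * sqrt (japan w))"
      by (simp add: real_sqrt_divide real_sqrt_mult)
    finally have "((x + y + w)\<^sup>2 / jac x y) * freq_mult x y w \<le> 900 * (2 / (sqrt (japan y) * sqrt (japan w)))"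
      using q by (intro mult_mono) auto
    then show "(x + y + w)\<^sup>2 * freq_mult x y w / jac x y \<le> 1800 / sqrt (japan y) * (if \<bar>w\<bar> \<le> \<bar>y\<bar> then 1 / sqrt (japan w) else 0)"
      using w by simp
  qed (auto simp: less_imp_le)
qed auto

lemma jac_ge:
  assumes "\<bar>y\<bar> \<le> 9/10 * \<bar>x\<bar>"
  shows "19/100 * x\<^sup>2 \<le> jac x y"
proof -
  have "\<bar>y\<bar>\<^sup>2 \<le> (9/10 * \<bar>x\<bar>)\<^sup>2" using assms by (intro power_mono) auto
  then have "y\<^sup>2 \<le> 81/100 * x\<^sup>2" by (simp add: power_mult_distrib power_divide)
  then show ?thesis unfolding jac_def by linarith
qed

text \<open>When |y| stays clearly below |x|, the Jacobian is comparable to x^2 and dominates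
  everything else. \<open>H1\<close> then asks only that the multiplier be bounded by the inverse
  length of the interval around \<open>m x y\<close> to which w is confined.\<close>

lemma controlled_short:
  fixes m L :: "real \<Rightarrow> real \<Rightarrow> real"
  assumes p: "p \<ge> 2" and \<beta>: "\<beta> > 1" and R: "pred3 R" and \<kappa>: "\<kappa> > 0"
    and reg: "\<And>x y w. R x y w \<Longrightarrow> x + y + w \<noteq> 0 \<and> \<bar>y\<bar> \<le> 9/10 * \<bar>x\<bar> \<and> \<bar>w\<bar> \<le> \<bar>x\<bar>"
    and sh: "\<And>x y w. R x y w \<Longrightarrow> \<bar>w - m x y\<bar> \<le> L x y \<and> 0 < L x y \<and> freq_mult x y w * L x y \<le> \<kappa>"
  shows "controlled p \<beta> R"
proof (rule controlled_generic[OF p \<beta> R, of "1/90"])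
  have sq: "max ((x + y + w)\<^sup>2) (w\<^sup>2) \<le> 9 * x\<^sup>2 \<and> x \<noteq> 0" if "R x y w" for x y w
  proof
    have "\<bar>x + y + w\<bar> \<le> \<bar>3 * x\<bar>" "\<bar>w\<bar> \<le> \<bar>3 * x\<bar>" using reg[OF that] by linarith+
    then have "(x + y + w)\<^sup>2 \<le> (3 * x)\<^sup>2" "w\<^sup>2 \<le> (3 * x)\<^sup>2" by (simp_all only: abs_le_square_iff)
    then show "max ((x + y + w)\<^sup>2) (w\<^sup>2) \<le> 9 * x\<^sup>2" by (simp add: power_mult_distrib)
    show "x \<noteq> 0" using reg[OF that] by auto
  qed
  show "x + y + w \<noteq> 0 \<and> 0 < jac x y \<and> 1/90 * max ((x + y + w)\<^sup>2) (w\<^sup>2) \<le> jac x y" if "R x y w" for x y w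
  proof -
    have "0 < x\<^sup>2" using sq[OF that] by simp
    moreover have "max ((x + y + w)\<^sup>2) (w\<^sup>2) \<le> 9 * x\<^sup>2" using sq[OF that] ..
    moreover have "19/100 * x\<^sup>2 \<le> jac x y" using reg[OF that] by (intro jac_ge) auto
    ultimately show ?thesis using reg[OF that] by (intro conjI) (blast, linarith+)
  qed
  show "0 < 100 * \<kappa>" using \<kappa> by simp
  show "(\<integral>\<^sup>+w. ennreal (if R x y w then (x + y + w)\<^sup>2 * freq_mult x y w / jac x y else 0) \<partial>lborel) \<le> ennreal (100 * \<kappa>)" for x y
  proof (cases "0 < L x y")
    case True
    show ?thesis
    proof (rule nn_integral_bound_indicator[where g = "\<lambda>w. if \<bar>w - m x y\<bar> \<le> L x y then 1 else 0" and c = "50 * \<kappa> / L x y"])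
      show "(\<integral>\<^sup>+w. ennreal (if \<bar>w - m x y\<bar> \<le> L x y then 1 else 0) \<partial>lborel) \<le> ennreal (2 * L x y)"
        by (rule nn_integral_short) (use True in simp)
      fix w assume w: "R x y w"
      have "(x + y + w)\<^sup>2 \<le> 9 * x\<^sup>2" "x\<^sup>2 > 0" using sq[OF w] by auto
      moreover have "19/100 * x\<^sup>2 \<le> jac x y" using reg[OF w] by (intro jac_ge) auto
      ultimately have q: "(x + y + w)\<^sup>2 / jac x y \<le> 50" by (subst pos_divide_le_eq) linarith+
      have "freq_mult x y w \<le> \<kappa> / L x y" using sh[OF w] True by (simp add: pos_le_divide_eq)
      then have "((x + y + w)\<^sup>2 / jac x y) * freq_mult x y w \<le> 50 * (\<kappa> / L x y)"
        using q by (intro mult_mono) auto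
      then show "(x + y + w)\<^sup>2 * freq_mult x y w / jac x y \<le> 50 * \<kappa> / L x y * (if \<bar>w - m x y\<bar> \<le> L x y then 1 else 0)"
        using sh[OF w] by simp
    qed (use True \<kappa> in auto)
  next
    case False
    then have "\<not> R x y w" for w using sh by blast
    then show ?thesis by simp
  qed
qed auto

text \<open>The bracket of \<xi> cancels against that of y, so the multiplier is at most 2 / |x|,
  while w ranges over an interval of half length |x|.\<close>

lemma controlled_high:
  assumes p: "p \<ge> 2" and \<beta>: "\<beta> > 1"
  shows "controlled p \<beta> high_region"
proof (rule controlled_short[OF p \<beta> pred3_regions(2), where m = "\<lambda>_ _. 0" and L = "\<lambda>x _. \<bar>x\<bar>" and \<kappa> = 2])
  fix x y w assume R: "high_region x y w"
  then show "x + y + w \<noteq> 0 \<and> \<bar>y\<bar> \<le> 9/10 * \<bar>x\<bar> \<and> \<bar>w\<bar> \<le> \<bar>x\<bar>" by (auto simp: high_region_def)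
  have x: "0 < \<bar>x\<bar>" using R by (auto simp: high_region_def)
  have "freq_mult x y w = freq_mult y x w" by (rule freq_mult_commute)
  also have "\<dots> \<le> sqrt (2 / (japan x * japan w))"
    using R by (intro freq_mult_le) (auto simp: high_region_def add.commute)
  also have "\<dots> \<le> sqrt ((2 / \<bar>x\<bar>)\<^sup>2)"
  proof (rule real_sqrt_le_mono)
    have "\<bar>x\<bar> * (\<bar>x\<bar> / 2) \<le> japan x * japan w"
      using R abs_le_japan[of x] abs_le_japan[of w] by (intro mult_mono) (auto simp: high_region_def)
    moreover have "0 < \<bar>x\<bar> * (\<bar>x\<bar> / 2)" by (intro mult_pos_pos) (use x in linarith)+
    ultimately have "2 / (japan x * japan w) \<le> 2 / (\<bar>x\<bar> * (\<bar>x\<bar> / 2))"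
      by (intro divide_left_mono) auto
    then show "2 / (japan x * japan w) \<le> (2 / \<bar>x\<bar>)\<^sup>2" using x by (simp add: power2_eq_square divide_simps)
  qed
  also have "\<dots> = 2 / \<bar>x\<bar>" using x by simp
  finally have "freq_mult x y w * \<bar>x\<bar> \<le> 2" using x by (simp add: pos_le_divide_eq)
  then show "\<bar>w - 0\<bar> \<le> \<bar>x\<bar> \<and> 0 < \<bar>x\<bar> \<and> freq_mult x y w * \<bar>x\<bar> \<le> 2" using R x by (auto simp: high_region_def)
qed simp

lemma controlled_parallel_short:
  assumes p: "p \<ge> 2" and \<beta>: "\<beta> > 1"
  shows "controlled p \<beta> parallel_short_region"
proof (rule controlled_short[OF p \<beta> pred3_regions(3), where m = "\<lambda>x _. x" and L = "\<lambda>x y. sqrt (\<bar>x\<bar> * japan y)" and \<kappa> = 3])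
  fix x y w assume R: "parallel_short_region x y w"
  then show "x + y + w \<noteq> 0 \<and> \<bar>y\<bar> \<le> 9/10 * \<bar>x\<bar> \<and> \<bar>w\<bar> \<le> \<bar>x\<bar>" by (auto simp: parallel_short_region_def)
  have x: "0 < \<bar>x\<bar>" using R by (auto simp: parallel_short_region_def)
  have "freq_mult x y w = freq_mult w x y" using freq_mult_commute by metis
  also have "\<dots> \<le> sqrt (6 / (japan x * japan y))"
    using R by (intro freq_mult_le) (auto simp: parallel_short_region_def)
  also have "\<dots> \<le> sqrt (9 / (\<bar>x\<bar> * japan y))"
    using x abs_le_japan[of x] by (intro real_sqrt_le_mono frac_le mult_right_mono mult_pos_pos) auto
  also have "\<dots> = 3 / sqrt (\<bar>x\<bar> * japan y)" by (simp add: real_sqrt_divide)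
  finally have "freq_mult x y w * sqrt (\<bar>x\<bar> * japan y) \<le> 3" using x by (simp add: pos_le_divide_eq)
  moreover have "\<bar>w - x\<bar> \<le> sqrt (\<bar>x\<bar> * japan y)"
    using R by (intro real_le_rsqrt) (auto simp: parallel_short_region_def)
  ultimately show "\<bar>w - x\<bar> \<le> sqrt (\<bar>x\<bar> * japan y) \<and> 0 < sqrt (\<bar>x\<bar> * japan y) \<and> freq_mult x y w * sqrt (\<bar>x\<bar> * japan y) \<le> 3"
    using x by simp
qed simp

text \<open>With d = |x - y| the Jacobian of (x, y) is only known to be at least |x| d. The factor
  |x| / d so lost in \<open>H1\<close> is regained from the constraint |w| \<le> d^2 / |x|, over
  which 1 / sqrt(<w>) has integral at most 4 d / sqrt|x|. For \<open>H3\<close> the well separated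
  pair (y, w) is used, with Jacobian of order x^2.\<close>

lemma controlled_parallel_long:
  assumes p: "p \<ge> 2" and \<beta>: "\<beta> > 1"
  shows "controlled p \<beta> parallel_long_region"
proof (rule controlled_generic[OF p \<beta> pred3_regions(4), of "1/100"])
  have sq: "0 < x\<^sup>2 \<and> (x + y + w)\<^sup>2 \<le> 9 * x\<^sup>2 \<and> 9/100 * x\<^sup>2 \<le> jac y w \<and> \<bar>x\<bar> * \<bar>x - y\<bar> \<le> jac x y \<and> 0 < \<bar>x - y\<bar>"
    if R: "parallel_long_region x y w" for x y w
  proof (intro conjI)
    from R have x: "x \<noteq> 0" by (auto simp: parallel_long_region_def)
    then show "0 < x\<^sup>2" by simp
    have "\<bar>x + y + w\<bar> \<le> \<bar>3 * x\<bar>" using R unfolding parallel_long_region_def by linarith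
    then have "(x + y + w)\<^sup>2 \<le> (3 * x)\<^sup>2" by (simp only: abs_le_square_iff)
    then show "(x + y + w)\<^sup>2 \<le> 9 * x\<^sup>2" by (simp add: power_mult_distrib)
    \<comment> \<open>The squares of 95/100 and 9/10 are 0.9025 and 0.81, which leaves the gap
      9/100.\<close>
    have "(95/100 * \<bar>x\<bar>)\<^sup>2 \<le> \<bar>y\<bar>\<^sup>2" "\<bar>w\<bar>\<^sup>2 \<le> (9/10 * \<bar>x\<bar>)\<^sup>2"
      using R by (intro power_mono; simp add: parallel_long_region_def)+
    then have "9025/10000 * x\<^sup>2 \<le> y\<^sup>2" "w\<^sup>2 \<le> 81/100 * x\<^sup>2"
      by (simp_all add: power_mult_distrib power_divide)
    then show "9/100 * x\<^sup>2 \<le> jac y w" unfolding jac_def using zero_le_power2[of x] by linarith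
    have "0 < \<bar>x\<bar> * japan w" using x by simp
    moreover have "\<bar>x\<bar> * japan w \<le> (x - y)\<^sup>2" using R by (simp add: parallel_long_region_def)
    ultimately have "0 < (x - y)\<^sup>2" by linarith
    then show "0 < \<bar>x - y\<bar>" by simp
    have "\<bar>x\<bar> \<le> \<bar>x + y\<bar>"
      using R unfolding parallel_long_region_def zero_less_mult_iff by linarith
    then have "\<bar>x\<bar> * \<bar>x - y\<bar> \<le> \<bar>x + y\<bar> * \<bar>x - y\<bar>" by (rule mult_right_mono) simp
    also have "\<dots> = jac x y" by (simp add: jac_def abs_mult[symmetric] power2_eq_square algebra_simps)
    finally show "\<bar>x\<bar> * \<bar>x - y\<bar> \<le> jac x y" .
  qed
  show "(\<lambda>x y w. 1/100 * max ((x + y + w)\<^sup>2) (x\<^sup>2) \<le> jac y w) = (\<lambda>x y w. 1/100 * max ((x + y + w)\<^sup>2) (w\<^sup>2) \<le> jac x y)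
      \<or> (\<lambda>x y w. 1/100 * max ((x + y + w)\<^sup>2) (x\<^sup>2) \<le> jac y w) = (\<lambda>x y w. 1/100 * max ((x + y + w)\<^sup>2) (x\<^sup>2) \<le> jac y w)"
    by simp
  show "x + y + w \<noteq> 0 \<and> 0 < jac x y \<and> 1/100 * max ((x + y + w)\<^sup>2) (x\<^sup>2) \<le> jac y w" if R: "parallel_long_region x y w" for x y w
  proof (intro conjI)
    show "x + y + w \<noteq> 0" using R by (simp add: parallel_long_region_def)
    have "0 < \<bar>x\<bar> * \<bar>x - y\<bar>" using sq[OF R] by (intro mult_pos_pos) auto
    then show "0 < jac x y" using sq[OF R] by linarith
    have "max ((x + y + w)\<^sup>2) (x\<^sup>2) \<le> 9 * x\<^sup>2" using sq[OF R] by simp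
    then show "1/100 * max ((x + y + w)\<^sup>2) (x\<^sup>2) \<le> jac y w" using sq[OF R] by linarith
  qed
  show "(\<integral>\<^sup>+w. ennreal (if parallel_long_region x y w then (x + y + w)\<^sup>2 * freq_mult x y w / jac x y else 0) \<partial>lborel) \<le> ennreal 72" for x y
  proof (cases "x \<noteq> 0 \<and> x \<noteq> y")
    case True
    define d where "d = \<bar>x - y\<bar>"
    have d: "d > 0" and x: "\<bar>x\<bar> > 0" using True by (auto simp: d_def)
    show ?thesis
    proof (rule nn_integral_bound_indicator[where g = "\<lambda>w. if \<bar>w\<bar> \<le> d\<^sup>2 / \<bar>x\<bar> then 1 / sqrt (japan w) else 0" and c = "18 * sqrt \<bar>x\<bar> / d"])
      show "(\<integral>\<^sup>+w. ennreal (if \<bar>w\<bar> \<le> d\<^sup>2 / \<bar>x\<bar> then 1 / sqrt (japan w) else 0) \<partial>lborel) \<le> ennreal (4 * sqrt (d\<^sup>2 / \<bar>x\<bar>))"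
        by (rule nn_integral_japan_sqrt) simp
      show "18 * sqrt \<bar>x\<bar> / d * (4 * sqrt (d\<^sup>2 / \<bar>x\<bar>)) \<le> 72" using d x by (simp add: real_sqrt_divide)
      fix w assume R: "parallel_long_region x y w"
      have "freq_mult x y w \<le> sqrt (3 / (japan y * japan w))"
        using R by (intro freq_mult_le abs_sum_le3) (auto simp: parallel_long_region_def)
      also have "\<dots> \<le> sqrt (3 / ((95/100 * \<bar>x\<bar>) * japan w))"
        using R x abs_le_japan[of y]
        by (intro real_sqrt_le_mono frac_le mult_right_mono mult_pos_pos) (auto simp: parallel_long_region_def)
      also have "\<dots> \<le> sqrt (4 / (\<bar>x\<bar> * japan w))"
        using x by (intro real_sqrt_le_mono) (simp add: divide_simps)
      also have "\<dots> = 2 / (sqrt \<bar>x\<bar> * sqrt (japan w))" by (simp add: real_sqrt_divide real_sqrt_mult)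
      finally have fm: "freq_mult x y w \<le> 2 / (sqrt \<bar>x\<bar> * sqrt (japan w))" .
      have "(x + y + w)\<^sup>2 / jac x y \<le> (9 * \<bar>x\<bar> * \<bar>x\<bar>) / (\<bar>x\<bar> * d)"
        using sq[OF R] d x by (intro frac_le) (auto simp: d_def power2_eq_square)
      also have "\<dots> = 9 * \<bar>x\<bar> / d" using x by simp
      finally have "((x + y + w)\<^sup>2 / jac x y) * freq_mult x y w \<le> (9 * \<bar>x\<bar> / d) * (2 / (sqrt \<bar>x\<bar> * sqrt (japan w)))"
        using fm d by (intro mult_mono) auto
      also have "\<dots> = 18 * (\<bar>x\<bar> / sqrt \<bar>x\<bar>) / d * (1 / sqrt (japan w))" by simp
      also have "\<bar>x\<bar> / sqrt \<bar>x\<bar> = sqrt \<bar>x\<bar>" by (rule real_div_sqrt) simp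
      finally have main: "(x + y + w)\<^sup>2 * freq_mult x y w / jac x y \<le> 18 * sqrt \<bar>x\<bar> / d * (1 / sqrt (japan w))"
        by simp
      have "\<bar>x\<bar> * \<bar>w\<bar> \<le> \<bar>x\<bar> * japan w" using abs_le_japan by (intro mult_left_mono) auto
      also have "\<dots> \<le> d\<^sup>2" using R by (simp add: parallel_long_region_def d_def)
      finally have "\<bar>w\<bar> \<le> d\<^sup>2 / \<bar>x\<bar>" using x by (simp add: pos_le_divide_eq mult.commute)
      then show "(x + y + w)\<^sup>2 * freq_mult x y w / jac x y \<le> 18 * sqrt \<bar>x\<bar> / d * (if \<bar>w\<bar> \<le> d\<^sup>2 / \<bar>x\<bar> then 1 / sqrt (japan w) else 0)"
        using main by simp
    qed (use d in auto)
  next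
    case False
    then have "\<not> parallel_long_region x y w" for w using sq[of x y w] by auto
    then show ?thesis by simp
  qed
qed auto

section \<open>Regions around the common zeros of all Jacobians\<close>

text \<open>For fixed \<xi>, x = y = w = \<xi>/3 is a critical point of the resonance function, and
  the deviation from its critical value is comparable to |\<xi>| (x - y)^2. So |x - y| is known from
  the value u up to constants, and |\<xi>| / jac is of size 1 / |x - y| on a w-interval of the same
  length. In \<open>H1\<close>, likewise, w ranges over an interval of length |x - y|.\<close>

lemma controlled_diagonal:
  assumes p: "p \<ge> 2" and \<beta>: "\<beta> > 1"
  shows "controlled p \<beta> diagonal_region"
proof (rule controlled_region[where lam = "\<lambda>_ _ _. 1", OF p \<beta> pred3_regions(6)])
  show "measurable3 (\<lambda>(_::real) (_::real) (_::real). 1 :: real)" unfolding measurable3_def by measurable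
  have geo: "0 < \<bar>x - y\<bar> \<and> 0 < \<bar>x + y + w\<bar> \<and> 6/10 * \<bar>x + y + w\<bar> \<le> \<bar>x + y\<bar> \<and> 2/10 * \<bar>x + y + w\<bar> \<le> \<bar>x\<bar> \<and> 2/10 * \<bar>x + y + w\<bar> \<le> \<bar>y\<bar>
      \<and> 2/10 * \<bar>x + y + w\<bar> \<le> \<bar>w\<bar>" if "diagonal_region x y w" for x y w
    using that unfolding diagonal_region_def by (auto simp: abs_if split: if_splits)
  have jac: "6/10 * \<bar>x + y + w\<bar> * \<bar>x - y\<bar> \<le> jac x y" if R: "diagonal_region x y w" for x y w
  proof -
    have "6/10 * \<bar>x + y + w\<bar> * \<bar>x - y\<bar> \<le> \<bar>x + y\<bar> * \<bar>x - y\<bar>"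
      using geo[OF R] by (intro mult_right_mono) auto
    also have "\<dots> = jac x y" by (simp add: jac_def abs_mult[symmetric] power2_eq_square algebra_simps)
    finally show ?thesis .
  qed
  show "x + y + w \<noteq> 0 \<and> (0::real) < 1 \<and> (1::real) \<le> 1 \<and> 0 < jac x y" if R: "diagonal_region x y w" for x y w
  proof -
    have "0 < 6/10 * \<bar>x + y + w\<bar> * \<bar>x - y\<bar>" using geo[OF R] by (intro mult_pos_pos) auto
    then have "0 < jac x y" using jac[OF R] by linarith
    then show ?thesis using geo[OF R] by auto
  qed
  show "(\<integral>\<^sup>+w. ennreal (if diagonal_region x y w then (x + y + w)\<^sup>2 * freq_mult x y w / (sqrt 1 * jac x y) else 0) \<partial>lborel) \<le> ennreal 40" for x y
  proof (cases "x = y")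
    case False
    define d where "d = \<bar>x - y\<bar>"
    have d: "d > 0" using False by (simp add: d_def)
    show ?thesis
    proof (rule nn_integral_bound_indicator[where g = "\<lambda>w. if \<bar>w - (x + y) / 2\<bar> \<le> d / 2 then 1 else 0" and c = "40 / d"])
      show "(\<integral>\<^sup>+w. ennreal (if \<bar>w - (x + y) / 2\<bar> \<le> d / 2 then 1 else 0) \<partial>lborel) \<le> ennreal (2 * (d / 2))"
        by (rule nn_integral_short) (use d in simp)
      fix w assume R: "diagonal_region x y w"
      define X where "X = \<bar>x + y + w\<bar>"
      have X: "X > 0" using geo[OF R] by (simp add: X_def)
      have "freq_mult x y w \<le> sqrt (5 / (japan y * japan w))"
        using geo[OF R] by (intro freq_mult_le) auto
      also have "\<dots> \<le> sqrt (5 / ((2/10 * X) * (2/10 * X)))"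
        using geo[OF R] X abs_le_japan[of y] abs_le_japan[of w]
        by (intro real_sqrt_le_mono divide_left_mono mult_mono mult_pos_pos) (auto simp: X_def)
      \<comment> \<open>The radicand before is 125 / X^2, and 125 < 144.\<close>
      also have "\<dots> \<le> sqrt ((12 / X)\<^sup>2)"
        using X by (intro real_sqrt_le_mono) (simp add: divide_simps power2_eq_square)
      also have "\<dots> = 12 / X" using X by simp
      finally have fm: "freq_mult x y w \<le> 12 / X" .
      have "0 < 6/10 * X * d" using X d by simp
      then have "(x + y + w)\<^sup>2 / jac x y \<le> X\<^sup>2 / (6/10 * X * d)"
        using jac[OF R] by (intro frac_le) (auto simp: X_def d_def)
      then have "((x + y + w)\<^sup>2 / jac x y) * freq_mult x y w \<le> (X\<^sup>2 / (6/10 * X * d)) * (12 / X)"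
        using fm X d by (intro mult_mono) auto
      also have "\<dots> = 20 / d" using X d by (simp add: power2_eq_square)
      also have "\<dots> \<le> 40 / d" using d by (simp add: divide_right_mono)
      finally have "(x + y + w)\<^sup>2 * freq_mult x y w / (sqrt 1 * jac x y) \<le> 40 / d" by simp
      moreover have "\<bar>w - (x + y) / 2\<bar> \<le> d / 2"
      proof -
        have "\<bar>2 * w - x - y\<bar> \<le> d" using R by (simp add: diagonal_region_def d_def)
        then show ?thesis by (auto simp: abs_le_iff field_simps)
      qed
      ultimately show "(x + y + w)\<^sup>2 * freq_mult x y w / (sqrt 1 * jac x y) \<le> 40 / d * (if \<bar>w - (x + y) / 2\<bar> \<le> d / 2 then 1 else 0)"
        by simp
    qed (use d in auto)
  next
    case True
    then have "\<not> diagonal_region x y w" for w by (simp add: diagonal_region_def)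
    then show ?thesis by simp
  qed
  fix \<xi> :: real and g :: "real \<Rightarrow> ennreal" assume g [measurable]: "g \<in> borel_measurable borel"
  \<comment> \<open>8/9 \<xi>^3 = \<xi>^3 - 3 (\<xi>/3)^3 is the critical value; \<open>D u\<close>
    will lie between |x - y| / 3 and |x - y|.\<close>
  define D where "D u = sqrt (\<bar>8/9 * \<xi> ^ 3 - u\<bar> / \<bar>\<xi>\<bar>)" for u
  define h where "h \<eta> u = ennreal (2 / D u * (if \<bar>\<eta> - \<xi> / 3\<bar> \<le> D u then 1 else 0))" for \<eta> u
  have hm: "(\<lambda>(x, u). h x u) \<in> borel_measurable (borel \<Otimes>\<^sub>M borel)" unfolding h_def D_def by measurable
  have hi: "(\<integral>\<^sup>+x. h x u \<partial>lborel) \<le> ennreal 4" for u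
  proof -
    have D0: "D u \<ge> 0" unfolding D_def by simp
    have "(\<integral>\<^sup>+x. h x u \<partial>lborel) \<le> ennreal (2 / D u * (2 * D u))"
      unfolding h_def using D0 by (intro nn_integral_ennreal_cmult_le nn_integral_short) auto
    also have "\<dots> \<le> ennreal 4" by (rule ennreal_leI) simp
    finally show ?thesis .
  qed
  have "tri (\<lambda>x y w. if diagonal_region x y w then ennreal (\<bar>\<xi>\<bar> * 1 powr (1 / (2 * p))) * g (resonance x y w) else 0) \<xi>
     \<le> tri (\<lambda>x y w. ennreal (jac x y) * (h w (resonance x y w) * g (resonance x y w))) \<xi>"
  proof (rule tri_mono)
    fix x y w assume s: "x + y + w = \<xi>"
    show "(if diagonal_region x y w then ennreal (\<bar>\<xi>\<bar> * 1 powr (1 / (2 * p))) * g (resonance x y w) else 0) \<le> ennreal (jac x y) * (h w (resonance x y w) * g (resonance x y w))"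
    proof (cases "diagonal_region x y w")
      case R: True
      define u d e where "u = resonance x y w" and "d = x - y" and "e = w - \<xi> / 3"
      have d: "\<bar>d\<bar> > 0" "\<bar>3 * e\<bar> \<le> \<bar>d\<bar>" "\<bar>d\<bar> \<le> \<bar>\<xi>\<bar> / 5" and X: "\<bar>\<xi>\<bar> > 0"
      proof -
        have "3 * e = 2 * w - x - y" unfolding e_def s[symmetric] by (simp add: field_simps)
        then show "\<bar>3 * e\<bar> \<le> \<bar>d\<bar>" using R by (simp add: diagonal_region_def d_def)
      qed (use R geo[OF R] s in \<open>simp_all add: diagonal_region_def d_def\<close>)
      have e2: "e\<^sup>2 \<le> d\<^sup>2 / 9"
      proof -
        have "(3 * e)\<^sup>2 \<le> d\<^sup>2" using d(2) by (simp only: abs_le_square_iff)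
        then show ?thesis by (simp add: power_mult_distrib)
      qed
      \<comment> \<open>Expansion around the critical point: a sum of squares whose coefficients are
        close to 3/2 \<xi> and 1/2 \<xi>, since |e| \<le> |\<xi>| / 15.\<close>
      have dev: "8/9 * \<xi> ^ 3 - u = (3/2 * \<xi> + 3/4 * e) * e\<^sup>2 + (1/2 * \<xi> - 3/4 * e) * d\<^sup>2"
      proof -
        have xyw: "w = e + \<xi> / 3" "x = (\<xi> - w + d) / 2" "y = (\<xi> - w - d) / 2" using s by (auto simp: e_def d_def field_simps)
        show ?thesis unfolding u_def resonance_def s xyw(2,3) xyw(1) by (simp add: field_simps power2_eq_square power3_eq_cube)
      qed
      have up: "\<bar>8/9 * \<xi> ^ 3 - u\<bar> \<le> \<bar>\<xi>\<bar> * d\<^sup>2"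
      proof -
        have "\<bar>8/9 * \<xi> ^ 3 - u\<bar> \<le> \<bar>(3/2 * \<xi> + 3/4 * e) * e\<^sup>2\<bar> + \<bar>(1/2 * \<xi> - 3/4 * e) * d\<^sup>2\<bar>"
          unfolding dev by (rule abs_triangle_ineq)
        also have "\<dots> = \<bar>3/2 * \<xi> + 3/4 * e\<bar> * e\<^sup>2 + \<bar>1/2 * \<xi> - 3/4 * e\<bar> * d\<^sup>2" by (simp add: abs_mult)
        also have "\<dots> \<le> (16/10 * \<bar>\<xi>\<bar>) * (d\<^sup>2 / 9) + (55/100 * \<bar>\<xi>\<bar>) * d\<^sup>2"
          using d e2 by (intro add_mono mult_mono) (auto simp: abs_if split: if_splits)
        also have "\<dots> \<le> \<bar>\<xi>\<bar> * d\<^sup>2"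
        proof -
          have "0 \<le> \<bar>\<xi>\<bar> * d\<^sup>2" by simp
          moreover have "(16/10 * \<bar>\<xi>\<bar>) * (d\<^sup>2 / 9) + (55/100 * \<bar>\<xi>\<bar>) * d\<^sup>2 = (16/90 + 55/100) * (\<bar>\<xi>\<bar> * d\<^sup>2)" by (simp add: algebra_simps)
          ultimately show ?thesis by simp
        qed
        finally show ?thesis .
      qed
      have lo: "\<bar>\<xi>\<bar> * d\<^sup>2 / 9 \<le> \<bar>8/9 * \<xi> ^ 3 - u\<bar>"
      proof -
        have a: "\<bar>\<xi>\<bar> / 9 * d\<^sup>2 \<le> \<bar>1/2 * \<xi> - 3/4 * e\<bar> * d\<^sup>2"
          using d by (intro mult_right_mono) (auto simp: abs_if split: if_splits)
        \<comment> \<open>Both coefficients have the sign of \<xi>, so the two terms cannot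
          cancel.\<close>
        have "\<bar>(3/2 * \<xi> + 3/4 * e) * e\<^sup>2 + (1/2 * \<xi> - 3/4 * e) * d\<^sup>2\<bar> = \<bar>3/2 * \<xi> + 3/4 * e\<bar> * e\<^sup>2 + \<bar>1/2 * \<xi> - 3/4 * e\<bar> * d\<^sup>2"
        proof (cases "\<xi> > 0")
          case True
          then have "3/2 * \<xi> + 3/4 * e \<ge> 0" "1/2 * \<xi> - 3/4 * e \<ge> 0" using d by linarith+
          then show ?thesis by simp
        next
          case False
          then have *: "3/2 * \<xi> + 3/4 * e \<le> 0" "1/2 * \<xi> - 3/4 * e \<le> 0" using d by linarith+
          then have "(3/2 * \<xi> + 3/4 * e) * e\<^sup>2 \<le> 0" "(1/2 * \<xi> - 3/4 * e) * d\<^sup>2 \<le> 0" by (simp_all add: mult_nonpos_nonneg)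
          then show ?thesis using * by (simp only: abs_of_nonpos add_nonpos_nonpos)
        qed
        note eq = this
        have "\<bar>\<xi>\<bar> * d\<^sup>2 / 9 = \<bar>\<xi>\<bar> / 9 * d\<^sup>2" by simp
        also note a
        also have "\<bar>1/2 * \<xi> - 3/4 * e\<bar> * d\<^sup>2 \<le> \<bar>3/2 * \<xi> + 3/4 * e\<bar> * e\<^sup>2 + \<bar>1/2 * \<xi> - 3/4 * e\<bar> * d\<^sup>2" by simp
        also note eq[symmetric]
        finally show ?thesis unfolding dev .
      qed
      have D: "\<bar>d\<bar> / 3 \<le> D u" "D u \<le> \<bar>d\<bar>"
      proof -
        have "(\<bar>d\<bar> / 3)\<^sup>2 \<le> \<bar>8/9 * \<xi> ^ 3 - u\<bar> / \<bar>\<xi>\<bar>"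
          using lo X by (simp add: pos_le_divide_eq power_divide mult.commute)
        then show "\<bar>d\<bar> / 3 \<le> D u" unfolding D_def by (rule real_le_rsqrt)
        have "\<bar>8/9 * \<xi> ^ 3 - u\<bar> / \<bar>\<xi>\<bar> \<le> \<bar>d\<bar>\<^sup>2"
          using up X by (simp add: pos_divide_le_eq mult.commute)
        then show "D u \<le> \<bar>d\<bar>" unfolding D_def by (intro real_le_lsqrt) auto
      qed
      have "\<bar>\<xi>\<bar> \<le> (6/10 * \<bar>\<xi>\<bar> * \<bar>d\<bar>) * (2 / \<bar>d\<bar>)" using d by simp
      also have "\<dots> \<le> jac x y * (2 / D u)"
        using jac[OF R] s d D by (intro mult_mono divide_left_mono mult_pos_pos) (auto simp: d_def)
      also have "\<dots> = jac x y * (2 / D u * (if \<bar>w - \<xi> / 3\<bar> \<le> D u then 1 else 0))"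
        using d D by (auto simp: e_def)
      finally have "ennreal \<bar>\<xi>\<bar> \<le> ennreal (jac x y) * h w u"
        unfolding h_def by (subst ennreal_mult'[symmetric]) (auto intro: ennreal_leI)
      then have "ennreal \<bar>\<xi>\<bar> * g u \<le> ennreal (jac x y) * h w u * g u"
        by (rule mult_right_mono) simp
      then show ?thesis using R by (simp only: if_True powr_one_eq_one mult_1_right mult.assoc u_def)
    qed (simp only: if_False zero_le)
  qed
  also have "\<dots> \<le> ennreal 4 * (\<integral>\<^sup>+u. g u \<partial>lborel)" by (rule tri_resonance_le3[OF hm g hi])
  finally show "tri (\<lambda>x y w. if diagonal_region x y w then ennreal (\<bar>\<xi>\<bar> * 1 powr (1 / (2 * p))) * g (resonance x y w) else 0) \<xi> \<le> ennreal 4 * (\<integral>\<^sup>+u. g u \<partial>lborel)" .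
qed auto

lemma resonance_factor: "resonance x y w = 3 * (x + y) * (y + w) * (x + w)"
  by (simp add: resonance_def power3_eq_cube algebra_simps)

lemma jac_factor: "jac x y = \<bar>x + y\<bar> * \<bar>x - y\<bar>"
  by (simp add: jac_def abs_mult[symmetric] power2_eq_square algebra_simps)

text \<open>Put c = |x + y| and a = |y + w|. Here jac is at least c |\<xi>|, and \<open>H3\<close>
  without loss would need the integral of 1/c, which diverges logarithmically. The resonance
  function is comparable to |\<xi>| a c, so for fixed u the ratio a/c behaves like 1/c^2, and any
  positive power of it gives convergence. In \<open>H1\<close> the loss sqrt(c/a) is an integrable
  singularity.\<close>

lemma controlled_resonant:
  assumes p: "p \<ge> 2" and \<beta>: "\<beta> > 1"
  shows "controlled p \<beta> resonant_region"
proof (rule controlled_region[where lam = "\<lambda>x y w. \<bar>y + w\<bar> / \<bar>x + y\<bar>", OF p \<beta> pred3_regions(5)])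
  show "measurable3 (\<lambda>x y w. \<bar>y + w\<bar> / \<bar>x + y\<bar> :: real)" unfolding measurable3_def by measurable
  have geo: "0 < \<bar>x + y + w\<bar> \<and> 0 < \<bar>x + y\<bar> \<and> 0 < \<bar>y + w\<bar> \<and> \<bar>y + w\<bar> \<le> \<bar>x + y\<bar> \<and> \<bar>x + y + w\<bar> \<le> \<bar>x - y\<bar>
      \<and> \<bar>x + y + w\<bar> / 2 \<le> \<bar>x\<bar> \<and> \<bar>x + y + w\<bar> / 2 \<le> \<bar>y\<bar> \<and> \<bar>x + y + w\<bar> / 2 \<le> \<bar>w\<bar>
      \<and> 3/2 * \<bar>x + y + w\<bar> \<le> \<bar>x + w\<bar> \<and> \<bar>x + w\<bar> \<le> 5/2 * \<bar>x + y + w\<bar>"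
    if "resonant_region x y w" for x y w
    using that unfolding resonant_region_def by (auto simp: abs_if split: if_splits)
  have jac: "\<bar>x + y\<bar> * \<bar>x + y + w\<bar> \<le> jac x y \<and> 0 < \<bar>x + y\<bar> * \<bar>x + y + w\<bar>" if R: "resonant_region x y w" for x y w
    unfolding jac_factor using geo[OF R] by (intro conjI mult_left_mono mult_pos_pos) auto
  show "x + y + w \<noteq> 0 \<and> 0 < \<bar>y + w\<bar> / \<bar>x + y\<bar> \<and> \<bar>y + w\<bar> / \<bar>x + y\<bar> \<le> 1 \<and> 0 < jac x y" if R: "resonant_region x y w" for x y w
  proof -
    have "0 < jac x y" using jac[OF R] by linarith
    then show ?thesis using geo[OF R] by auto
  qed
  show "(\<integral>\<^sup>+w. ennreal (if resonant_region x y w then (x + y + w)\<^sup>2 * freq_mult x y w / (sqrt (\<bar>y + w\<bar> / \<bar>x + y\<bar>) * jac x y) else 0) \<partial>lborel) \<le> ennreal 16" for x y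
  proof (cases "x + y = 0")
    case False
    define c where "c = \<bar>x + y\<bar>"
    have c: "c > 0" using False by (simp add: c_def)
    \<comment> \<open>The singularity 1 / sqrt(a) is integrated over a \<le> c and gives 4 sqrt(c);
      with the factor 4 / sqrt(c) the total is 16.\<close>
    define k where "k v = (if \<bar>v\<bar> \<le> c then \<bar>v\<bar> powr - (1/2) else 0)" for v
    have [measurable]: "k \<in> borel_measurable borel" unfolding k_def[abs_def] by measurable
    show ?thesis
    proof (rule nn_integral_bound_indicator[where g = "\<lambda>w. k (w - (- y))" and c = "4 / sqrt c"])
      have "(\<integral>\<^sup>+w. ennreal (k (w - (- y))) \<partial>lborel) = (\<integral>\<^sup>+w. ennreal (k w) \<partial>lborel)"
        by (rule nn_integral_lborel_translate[where f = "\<lambda>w. ennreal (k w)"]) measurable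
      also have "\<dots> \<le> ennreal (4 * sqrt c)"
        unfolding k_def by (rule nn_integral_inverse_sqrt) (use c in simp)
      finally show "(\<integral>\<^sup>+w. ennreal (k (w - (- y))) \<partial>lborel) \<le> ennreal (4 * sqrt c)" .
      fix w assume R: "resonant_region x y w"
      define X where "X = \<bar>x + y + w\<bar>"
      define a where "a = \<bar>y + w\<bar>"
      have X: "X > 0" and a: "a > 0" "a \<le> c" using geo[OF R] by (auto simp: X_def a_def c_def)
      have "freq_mult x y w \<le> sqrt (2 / (japan y * japan w))"
        using geo[OF R] by (intro freq_mult_le) auto
      also have "\<dots> \<le> sqrt (2 / ((X / 2) * (X / 2)))"
        using geo[OF R] X abs_le_japan[of y] abs_le_japan[of w]
        by (intro real_sqrt_le_mono divide_left_mono mult_mono mult_pos_pos) (auto simp: X_def)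
      also have "\<dots> \<le> sqrt ((4 / X)\<^sup>2)"
        using X by (intro real_sqrt_le_mono) (simp add: divide_simps power2_eq_square)
      also have "\<dots> = 4 / X" using X by simp
      finally have fm: "freq_mult x y w \<le> 4 / X" .
      have "(x + y + w)\<^sup>2 / jac x y \<le> X\<^sup>2 / (c * X)"
        using jac[OF R] by (intro frac_le) (auto simp: X_def c_def)
      then have "((x + y + w)\<^sup>2 / jac x y) * freq_mult x y w \<le> (X\<^sup>2 / (c * X)) * (4 / X)"
        using fm X c by (intro mult_mono) auto
      also have "\<dots> = 4 / c" using X c by (simp add: power2_eq_square)
      finally have "((x + y + w)\<^sup>2 / jac x y * freq_mult x y w) * (1 / sqrt (a / c)) \<le> 4 / c * (1 / sqrt (a / c))"
        using a c by (intro mult_right_mono) auto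
      also have "\<dots> = 4 * (sqrt c / c) / sqrt a" by (simp add: real_sqrt_divide)
      also have "sqrt c / c = 1 / sqrt c" using c by (simp add: sqrt_divide_self_eq inverse_eq_divide)
      also have "4 * (1 / sqrt c) / sqrt a = 4 / sqrt c * (1 / sqrt a)" by simp
      also have "1 / sqrt a = k (w - (- y))"
        using a by (simp add: k_def a_def add.commute powr_minus_divide powr_half_sqrt)
      finally show "(x + y + w)\<^sup>2 * freq_mult x y w / (sqrt (\<bar>y + w\<bar> / \<bar>x + y\<bar>) * jac x y) \<le> 4 / sqrt c * k (w - (- y))"
        by (simp add: a_def c_def mult.commute)
    qed (use c in \<open>auto simp: k_def\<close>)
  next
    case True
    then have "\<not> resonant_region x y w" for w by (auto simp: resonant_region_def)
    then show ?thesis by simp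
  qed
  show "8 * p > 0" using p by simp
  fix \<xi> :: real and g :: "real \<Rightarrow> ennreal" assume g [measurable]: "g \<in> borel_measurable borel"
  define \<theta> where "\<theta> = 1 / (2 * p)"
  have \<theta>: "0 < \<theta>" "\<theta> \<le> 1" using p by (auto simp: \<theta>_def divide_simps)
  \<comment> \<open>The resonance function is 3 c a |x + w| in modulus, where a \<le> c and |x + w|
    \<le> 5/2 |\<xi>|. The constant 15/2 = 3 * 5/2 makes \<open>A u\<close> a lower bound for c, the
    cutoff of the tail integral.\<close>
  define A where "A u = sqrt (\<bar>u\<bar> / (15/2 * \<bar>\<xi>\<bar>))" for u
  \<comment> \<open>The variable v = \<xi> - w equals x + y. The power of \<open>A u\<close> in
    front is the one which the tail integral from \<open>A u\<close> on cancels, so the result is 2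
    / \<theta> = 4 p, uniformly in u.\<close>
  define k where "k u v = (2 * A u powr (2 * \<theta>)) * (if A u \<le> \<bar>v\<bar> then \<bar>v\<bar> powr - (1 + 2 * \<theta>) else 0)" for u v
  define h where "h \<eta> u = ennreal (k u (\<xi> - \<eta>))" for \<eta> u
  have hm: "(\<lambda>(x, u). h x u) \<in> borel_measurable (borel \<Otimes>\<^sub>M borel)" unfolding h_def k_def A_def by measurable
  have hi: "(\<integral>\<^sup>+x. h x u \<partial>lborel) \<le> ennreal (8 * p)" for u
  proof -
    have [measurable]: "k u \<in> borel_measurable borel" unfolding k_def[abs_def] by measurable
    have "(\<integral>\<^sup>+x. h x u \<partial>lborel) = (\<integral>\<^sup>+v. ennreal (k u v) \<partial>lborel)"
      unfolding h_def by (rule nn_integral_lborel_reflect[where f = "\<lambda>v. ennreal (k u v)"]) measurable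
    also have "\<dots> \<le> ennreal (8 * p)"
    proof (cases "A u = 0")
      case False
      then have A: "A u > 0" unfolding A_def by simp
      have "(\<integral>\<^sup>+v. ennreal (k u v) \<partial>lborel) \<le> ennreal ((2 * A u powr (2 * \<theta>)) * (2 * A u powr (1 - (1 + 2 * \<theta>)) / ((1 + 2 * \<theta>) - 1)))"
        unfolding k_def using A \<theta> by (intro nn_integral_ennreal_cmult_le nn_integral_powr_tail_even) auto
      also have "(2 * A u powr (2 * \<theta>)) * (2 * A u powr (1 - (1 + 2 * \<theta>)) / ((1 + 2 * \<theta>) - 1)) = 2 / \<theta>"
        using A \<theta> by (simp add: powr_minus divide_simps)
      also have "\<dots> \<le> 8 * p" using p by (simp add: \<theta>_def)
      finally show ?thesis using p by (simp add: ennreal_leI)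
    qed (simp add: k_def)
    finally show ?thesis .
  qed
  have "tri (\<lambda>x y w. if resonant_region x y w then ennreal (\<bar>\<xi>\<bar> * (\<bar>y + w\<bar> / \<bar>x + y\<bar>) powr (1 / (2 * p))) * g (resonance x y w) else 0) \<xi>
     \<le> tri (\<lambda>x y w. ennreal (jac x y) * (h w (resonance x y w) * g (resonance x y w))) \<xi>"
  proof (rule tri_mono)
    fix x y w assume s: "x + y + w = \<xi>"
    show "(if resonant_region x y w then ennreal (\<bar>\<xi>\<bar> * (\<bar>y + w\<bar> / \<bar>x + y\<bar>) powr (1 / (2 * p))) * g (resonance x y w) else 0) \<le> ennreal (jac x y) * (h w (resonance x y w) * g (resonance x y w))"
    proof (cases "resonant_region x y w")
      case R: True
      define u a c b where "u = resonance x y w" and "a = \<bar>y + w\<bar>" and "c = \<bar>x + y\<bar>" and "b = \<bar>x + w\<bar>"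
      have X: "\<bar>\<xi>\<bar> > 0" and ac: "0 < a" "a \<le> c" "0 < c" and b: "3/2 * \<bar>\<xi>\<bar> \<le> b" "b \<le> 5/2 * \<bar>\<xi>\<bar>"
        using geo[OF R] s by (auto simp: a_def b_def c_def)
      have u: "\<bar>u\<bar> = 3 * (c * a) * b" unfolding u_def resonance_factor a_def b_def c_def by (simp only: abs_mult abs_numeral mult_ac)
      have u1: "\<bar>u\<bar> \<le> 3 * (c * c) * (5/2 * \<bar>\<xi>\<bar>)"
        unfolding u using ac b X by (intro mult_mono) auto
      have u2: "3 * (c * a) * (3/2 * \<bar>\<xi>\<bar>) \<le> \<bar>u\<bar>"
        unfolding u using ac b X by (intro mult_left_mono) auto
      have Ac: "A u \<le> c"
      proof -
        have "\<bar>u\<bar> / (15/2 * \<bar>\<xi>\<bar>) \<le> c\<^sup>2" using u1 X by (simp add: pos_divide_le_eq power2_eq_square algebra_simps)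
        then show ?thesis unfolding A_def using ac by (intro real_le_lsqrt) auto
      qed
      have lam: "(a / c) powr \<theta> \<le> 2 * A u powr (2 * \<theta>) * c powr - (2 * \<theta>)"
      proof -
        have sq: "(t\<^sup>2) powr \<theta> = t powr (2 * \<theta>)" if "t \<ge> 0" for t :: real
        proof (cases "t = 0")
          case False
          then have "t\<^sup>2 = t powr 2" using that by simp
          then show ?thesis by (simp only: powr_powr)
        qed simp
        have A2: "(A u)\<^sup>2 = \<bar>u\<bar> / (15/2 * \<bar>\<xi>\<bar>)" unfolding A_def by simp
        \<comment> \<open>From |x + w| \<ge> 3/2 |\<xi>| the ratio of constants is (9/2) / (15/2) =
          3/5, which exceeds 1/2.\<close>
        have "c * a / 2 \<le> (A u)\<^sup>2"
          unfolding A2 using u2 X ac by (simp add: pos_le_divide_eq algebra_simps)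
        then have "c * a / c\<^sup>2 \<le> 2 * (A u)\<^sup>2 / c\<^sup>2" by (intro divide_right_mono) auto
        then have "a / c \<le> 2 * (A u)\<^sup>2 / c\<^sup>2" using ac by (simp add: power2_eq_square)
        then have "(a / c) powr \<theta> \<le> (2 * (A u)\<^sup>2 / c\<^sup>2) powr \<theta>" using ac \<theta> by (intro powr_mono2) auto
        also have "\<dots> = 2 powr \<theta> * ((A u)\<^sup>2) powr \<theta> / (c\<^sup>2) powr \<theta>" by (simp add: powr_mult powr_divide)
        also have "((A u)\<^sup>2) powr \<theta> = A u powr (2 * \<theta>)"
          by (rule sq) (simp add: A_def)
        also have "(c\<^sup>2) powr \<theta> = c powr (2 * \<theta>)"
          by (rule sq) (use ac in simp)
        also have "2 powr \<theta> * A u powr (2 * \<theta>) / c powr (2 * \<theta>) \<le> 2 * A u powr (2 * \<theta>) / c powr (2 * \<theta>)"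
          using \<theta> powr_mono[of \<theta> 1 2] by (intro divide_right_mono mult_right_mono) auto
        finally show ?thesis by (simp add: powr_minus_divide)
      qed
      have "\<bar>\<xi>\<bar> * (a / c) powr \<theta> \<le> \<bar>\<xi>\<bar> * (2 * A u powr (2 * \<theta>) * c powr - (2 * \<theta>))"
        using lam by (rule mult_left_mono) simp
      also have "\<dots> = (c * \<bar>\<xi>\<bar>) * (2 * A u powr (2 * \<theta>) * c powr - (1 + 2 * \<theta>))"
      proof -
        have "c powr - (2 * \<theta>) = c powr (1 + - (1 + 2 * \<theta>))" by simp
        also have "\<dots> = c * c powr - (1 + 2 * \<theta>)" unfolding powr_add using ac by simp
        finally show ?thesis by (simp only: mult.assoc mult.left_commute)
      qed
      also have "\<dots> \<le> jac x y * (2 * A u powr (2 * \<theta>) * c powr - (1 + 2 * \<theta>))"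
        using jac[OF R] s by (intro mult_right_mono) (auto simp: c_def)
      also have "2 * A u powr (2 * \<theta>) * c powr - (1 + 2 * \<theta>) = k u (\<xi> - w)"
        using Ac s by (auto simp: k_def c_def)
      finally have "ennreal (\<bar>\<xi>\<bar> * (a / c) powr \<theta>) \<le> ennreal (jac x y) * h w u"
        unfolding h_def by (subst ennreal_mult'[symmetric]) (auto intro: ennreal_leI)
      then have "ennreal (\<bar>\<xi>\<bar> * (a / c) powr \<theta>) * g u \<le> ennreal (jac x y) * h w u * g u"
        by (rule mult_right_mono) simp
      then show ?thesis using R by (simp only: if_True mult.assoc u_def a_def c_def \<theta>_def)
    qed (simp only: if_False zero_le)
  qed
  also have "\<dots> \<le> ennreal (8 * p) * (\<integral>\<^sup>+u. g u \<partial>lborel)" by (rule tri_resonance_le3[OF hm g hi])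
  finally show "tri (\<lambda>x y w. if resonant_region x y w then ennreal (\<bar>\<xi>\<bar> * (\<bar>y + w\<bar> / \<bar>x + y\<bar>) powr (1 / (2 * p))) * g (resonance x y w) else 0) \<xi>
      \<le> ennreal (8 * p) * (\<integral>\<^sup>+u. g u \<partial>lborel)" .
qed auto

section \<open>Covering all frequencies\<close>

definition sym3 :: "(real \<Rightarrow> real \<Rightarrow> real \<Rightarrow> bool) \<Rightarrow> real \<Rightarrow> real \<Rightarrow> real \<Rightarrow> bool" where
  "sym3 R x y w \<longleftrightarrow> R x y w \<or> R x w y \<or> R y x w \<or> R y w x \<or> R w x y \<or> R w y x"

lemma pred3_swap:
  assumes "pred3 R"
  shows "pred3 (\<lambda>x y w. R y x w)" "pred3 (\<lambda>x y w. R x w y)"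
proof -
  note pred3_compose[OF assms, measurable (raw)]
  show "pred3 (\<lambda>x y w. R y x w)" "pred3 (\<lambda>x y w. R x w y)"
    unfolding pred3_def by measurable
qed

lemma pred3_disj:
  assumes "pred3 R" "pred3 S"
  shows "pred3 (\<lambda>x y w. R x y w \<or> S x y w)"
proof -
  note pred3_compose[OF assms(1), measurable (raw)] pred3_compose[OF assms(2), measurable (raw)]
  show ?thesis unfolding pred3_def by measurable
qed

lemma controlled_sym3:
  assumes p: "p > 0" and R: "controlled p \<beta> R" "pred3 R"
  shows "controlled p \<beta> (sym3 R)"
proof -
  note c = controlled_swap12 controlled_swap23
  note m = pred3_swap(1) pred3_swap(2)
  have 1: "controlled p \<beta> (\<lambda>x y w. R y x w)" "pred3 (\<lambda>x y w. R y x w)" using R by (auto intro: c(1) m(1))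
  have 2: "controlled p \<beta> (\<lambda>x y w. R x w y)" "pred3 (\<lambda>x y w. R x w y)" using R by (auto intro: c(2) m(2))
  have 3: "controlled p \<beta> (\<lambda>x y w. R w x y)" "pred3 (\<lambda>x y w. R w x y)"
    using c(2)[OF 1] m(2)[OF 1(2)] by auto
  have 4: "controlled p \<beta> (\<lambda>x y w. R y w x)" "pred3 (\<lambda>x y w. R y w x)"
    using c(1)[OF 2] m(1)[OF 2(2)] by auto
  have 5: "controlled p \<beta> (\<lambda>x y w. R w y x)" "pred3 (\<lambda>x y w. R w y x)"
    using c(1)[OF 3] m(1)[OF 3(2)] by auto
  show ?thesis
    unfolding sym3_def[abs_def]
    by (intro controlled_disj p pred3_disj R 1 2 3 4 5)
qed

text \<open>Collects the null sets left out by the strict conditions of the other regions; one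
  choice of variables suffices, as \<open>sym3\<close> supplies the permutations.\<close>

definition degenerate_region :: "real \<Rightarrow> real \<Rightarrow> real \<Rightarrow> bool" where
  "degenerate_region x y w \<longleftrightarrow> x + y + w = 0 \<or> x = y \<or> x + y = 0"

lemma pred3_degenerate: "pred3 degenerate_region"
  unfolding pred3_def degenerate_region_def by measurable

lemma controlled_degenerate: "controlled p \<beta> degenerate_region"
proof (rule controlled_negligible[OF pred3_degenerate])
  fix x z :: real
  have "AE y in lborel. y \<noteq> x" "AE y in lborel. y \<noteq> - x" by (rule AE_lborel_singleton)+
  then show "AE y in lborel. degenerate_region x y (z - x - y) \<longrightarrow> z = 0"
    by eventually_elim (auto simp: degenerate_region_def)
qed

definition covered :: "real \<Rightarrow> real \<Rightarrow> real \<Rightarrow> bool" where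
  "covered x y w \<longleftrightarrow> low_region x y w \<or> high_region x y w \<or> parallel_short_region x y w \<or> parallel_long_region x y w
     \<or> resonant_region x y w \<or> diagonal_region x y w \<or> degenerate_region x y w"

lemma controlled_covered:
  assumes "p \<ge> 2" "\<beta> > 1"
  shows "controlled p \<beta> covered" "pred3 covered"
proof -
  have p: "p > 0" using assms by simp
  note m = pred3_regions pred3_degenerate
  show "pred3 covered" unfolding covered_def[abs_def] by (intro pred3_disj m)
  show "controlled p \<beta> covered" unfolding covered_def[abs_def]
    by (intro controlled_disj pred3_disj p m controlled_low[OF assms] controlled_high[OF assms] controlled_parallel_short[OF assms]
        controlled_parallel_long[OF assms] controlled_resonant[OF assms] controlled_diagonal[OF assms] controlled_degenerate)
qed

text \<open>Every region is even, so the frequency of largest modulus may be taken positive.\<close>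

lemma covered_uminus: "covered (- x) (- y) (- w) = covered x y w"
proof -
  have 1: "- x + - y = - (x + y)" "- (x + y) + - w = - (x + y + w)" "- y + - w = - (y + w)" "- x - - y = - (x - y)"
    "2 * - w - - x - - y = - (2 * w - x - y)" "- w - - x = - (w - x)" by simp_all
  show ?thesis
    unfolding covered_def low_region_def high_region_def parallel_short_region_def parallel_long_region_def
      resonant_region_def diagonal_region_def degenerate_region_def 1
    by (simp only: abs_minus_cancel power2_minus neg_equal_0_iff_equal neg_equal_iff_equal jac_def japan_def mult_minus_left mult_minus_right minus_minus)
qed

text \<open>Outside \<open>low_region\<close> the Jacobian of the two largest frequencies is small.
  If they have the same sign, they agree within one per cent; if not, their sum is tiny compared
  with |w|. In both cases the size and the sign of w decide which region applies and which frequency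
  is isolated.\<close>

lemma sym3_covered_pos:
  assumes x: "0 < x" and le: "\<bar>w\<bar> \<le> \<bar>y\<bar>" "\<bar>y\<bar> \<le> x"
  shows "sym3 covered x y w"
proof (rule ccontr)
  assume n: "\<not> sym3 covered x y w"
  have nd: "x + y + w \<noteq> 0" "x \<noteq> y" "x + y \<noteq> 0" "x \<noteq> w" "x + w \<noteq> 0" "y \<noteq> w" "y + w \<noteq> 0"
    using n unfolding sym3_def covered_def degenerate_region_def by auto
  then have nd2: "x + w + y \<noteq> 0" "w + y + x \<noteq> 0" "y + x + w \<noteq> 0" "w + x + y \<noteq> 0" "y + x \<noteq> 0" "w + y \<noteq> 0" "w + x \<noteq> 0"
    by (simp_all add: ac_simps)
  have nr: "\<not> low_region x y w" "\<not> high_region x w y" "\<not> parallel_short_region x w y" "\<not> parallel_long_region x y w"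
     "\<not> resonant_region x w y" "\<not> resonant_region w y x" "\<not> resonant_region x y w" "\<not> resonant_region w x y" "\<not> resonant_region y x w"
     "\<not> diagonal_region x w y"
    using n unfolding sym3_def covered_def by auto
  have J: "jac x y < 1/900 * max ((x + y + w)\<^sup>2) (w\<^sup>2)"
  proof (rule ccontr)
    assume "\<not> ?thesis"
    then have "1/900 * max ((x + y + w)\<^sup>2) (w\<^sup>2) \<le> jac x y" by (rule leI)
    then have "low_region x y w" unfolding low_region_def using nd(1) le x by (intro conjI) auto
    with nr(1) show False ..
  qed
  have jac: "jac x y = x\<^sup>2 - y\<^sup>2"
    using le x unfolding jac_def by (simp add: abs_le_square_iff[symmetric])
  show False
  proof (cases "y > 0")
    case y: True
    have "\<bar>x + y + w\<bar> \<le> \<bar>3 * x\<bar>" "\<bar>w\<bar> \<le> \<bar>3 * x\<bar>" using le x by - linarith+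
    then have "(x + y + w)\<^sup>2 \<le> (3 * x)\<^sup>2" "w\<^sup>2 \<le> (3 * x)\<^sup>2" by (simp_all only: abs_le_square_iff)
    then have "max ((x + y + w)\<^sup>2) (w\<^sup>2) \<le> 9 * x\<^sup>2" by (simp add: power_mult_distrib)
    then have "x\<^sup>2 - y\<^sup>2 < x\<^sup>2 / 100" using J jac by linarith
    \<comment> \<open>The square of 99/100 is 0.9801, below the bound 0.99 which holds for
      (y/x)^2.\<close>
    have yx: "99/100 * x < y"
    proof (rule ccontr)
      assume "\<not> 99/100 * x < y"
      then have "y\<^sup>2 \<le> (99/100 * x)\<^sup>2" using y by (intro power_mono) auto
      then have "y\<^sup>2 \<le> 9801/10000 * x\<^sup>2" by (simp add: power_mult_distrib power_divide)
      then show False using \<open>x\<^sup>2 - y\<^sup>2 < x\<^sup>2 / 100\<close> zero_le_power2[of x] by linarith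
    qed
    have lw: "w \<le> y" "- y \<le> w" "y \<le> x" using le y by - linarith+
    consider "\<bar>w\<bar> \<le> 9/10 * x" | "9/10 * x < w" | "w < - (9/10 * x)" by linarith
    then show False
    proof cases
      case 1
      show False
      proof (cases "(y - x)\<^sup>2 \<le> \<bar>x\<bar> * japan w")
        case True
        then show False using nr(3) nd(1) 1 x y yx le by (simp add: parallel_short_region_def add.commute add.left_commute)
      next
        case False
        then have "\<bar>x\<bar> * japan w \<le> (x - y)\<^sup>2" by (simp add: power2_commute)
        then show False using nr(4) nd(1) 1 x y yx le by (simp add: parallel_long_region_def)
      qed
    next
      case 2
      \<comment> \<open>All three are close together and w < y < x up to equality, so the middle
        frequency y is isolated.\<close>
      have "\<bar>x - w\<bar> = x - w" "\<bar>x + w + y\<bar> = x + w + y" "w \<le> y" using 2 x y le by - linarith+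
      moreover have "y \<le> x" using le y by simp
      moreover have "x - w \<le> (x + w + y) / 5" using 2 x yx by simp
      ultimately have "\<bar>2 * y - x - w\<bar> \<le> \<bar>x - w\<bar>" "\<bar>x - w\<bar> \<le> \<bar>x + w + y\<bar> / 5"
        by (simp_all add: abs_le_iff)
      then show False using nr(10) nd by (simp add: diagonal_region_def)
    next
      case 3
      \<comment> \<open>Now w is nearly opposite to x and y. Since y \<le> x, the sum w + y is the
        smaller one, and so y is the isolated frequency.\<close>
      have "\<bar>w + y\<bar> = w + y" "\<bar>x + w\<bar> = x + w" "\<bar>x + w + y\<bar> = x + w + y" using x y lw by - linarith+
      moreover have "w + y \<le> x + w" "x + w \<le> (x + w + y) / 4" using 3 x yx lw by simp_all
      ultimately have "\<bar>w + y\<bar> \<le> \<bar>x + w\<bar>" "\<bar>x + w\<bar> \<le> \<bar>x + w + y\<bar> / 4" by simp_all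
      moreover have "x + w + y \<noteq> 0" "w + y \<noteq> 0" using nd by - linarith+
      ultimately show False using nr(5) by (simp add: resonant_region_def)
    qed
  next
    case False
    then have y: "y < 0" using le nd by linarith
    have p: "w + x = x + w" "y + x = x + y" "y + w = w + y" "x + y + w = x + w + y" "w + y + x = x + w + y" by simp_all
    define c where "c = x + y"
    have c: "0 < c" "c \<le> x" using le nd y by (auto simp: c_def)
    \<comment> \<open>The chain ends in c x < (c x + |w| x) / 450, that is, 449 c < |w|: near
      cancellation of x and y is only possible well below the size of w.\<close>
    have "c * x \<le> c * (x - y)" using c y by (intro mult_left_mono) auto
    also have "\<dots> = jac x y" unfolding jac c_def by (simp add: power2_eq_square algebra_simps)
    also have "\<dots> < 1/900 * (2 * c\<^sup>2 + 2 * w\<^sup>2)"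
    proof -
      have "(x + y + w)\<^sup>2 + (c - w)\<^sup>2 = 2 * c\<^sup>2 + 2 * w\<^sup>2" by (simp add: c_def power2_eq_square algebra_simps)
      then have "(x + y + w)\<^sup>2 \<le> 2 * c\<^sup>2 + 2 * w\<^sup>2" using zero_le_power2[of "c - w"] by linarith
      moreover have "w\<^sup>2 \<le> 2 * c\<^sup>2 + 2 * w\<^sup>2" by simp
      ultimately have "max ((x + y + w)\<^sup>2) (w\<^sup>2) \<le> 2 * c\<^sup>2 + 2 * w\<^sup>2" by simp
      then have "1/900 * max ((x + y + w)\<^sup>2) (w\<^sup>2) \<le> 1/900 * (2 * c\<^sup>2 + 2 * w\<^sup>2)" by (rule mult_left_mono) simp
      with J show ?thesis by (rule less_le_trans)
    qed
    also have "\<dots> \<le> 1/450 * (c * x + \<bar>w\<bar> * x)"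
    proof -
      have "c\<^sup>2 \<le> c * x" using c by (simp add: power2_eq_square)
      moreover have "w\<^sup>2 \<le> \<bar>w\<bar> * x"
        using le mult_left_mono[of "\<bar>w\<bar>" x "\<bar>w\<bar>"] by (simp add: power2_eq_square)
      ultimately have "1/450 * (c\<^sup>2 + w\<^sup>2) \<le> 1/450 * (c * x + \<bar>w\<bar> * x)" by (intro mult_left_mono add_mono) auto
      then show ?thesis by simp
    qed
    finally have "x * (449 * c) < x * \<bar>w\<bar>" by (simp add: algebra_simps)
    then have cw: "449 * c < \<bar>w\<bar>" using x by simp
    have lw: "w \<le> - y" "y \<le> w" "- y \<le> x" using le y by - linarith+
    consider "\<bar>w\<bar> \<le> 9/10 * x" | "9/10 * x < w" | "w < - (9/10 * x)" by linarith
    then show False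
    proof cases
      case 1
      have "\<bar>x\<bar> = x" "\<bar>y\<bar> = - y" using x y by simp_all
      moreover have "x / 2 \<le> - y"
      proof -
        have "449 * c < 9/10 * x" using cw 1 by (rule less_le_trans)
        then show ?thesis using x by (simp add: c_def)
      qed
      moreover have "\<bar>x + w + y\<bar> \<le> 2 * \<bar>w\<bar>"
      proof -
        have "\<bar>x + w + y\<bar> = \<bar>w + c\<bar>" by (simp add: c_def ac_simps)
        also have "\<dots> \<le> \<bar>w\<bar> + c" using abs_triangle_ineq[of w c] c by simp
        also have "\<dots> \<le> \<bar>w\<bar> + \<bar>w\<bar>" using cw c by simp
        finally show ?thesis by simp
      qed
      moreover have "- y \<le> x" by (rule lw)
      ultimately show False using nr(2) nd2 1 by (simp add: high_region_def)
    next
      case 2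
      then have cw: "449 * c < w" and w: "9 * x < 10 * w" using cw x by simp_all
      have abs: "\<bar>x + y\<bar> = x + y" "\<bar>w + y\<bar> = - w - y" "\<bar>x + w + y\<bar> = x + w + y"
        using w x c lw c_def by - linarith+
      have "4 * x + 4 * y \<le> x + w + y" "- (4 * w) - 4 * y \<le> x + w + y"
        using w x cw c lw c_def by - linarith+
      then have le: "x + y \<le> (x + w + y) / 4" "- w - y \<le> (x + w + y) / 4" by simp_all
      show False
      \<comment> \<open>Here y is the frequency of opposite sign, and both sums with y are small.
        Their comparison decides whether x or w is isolated.\<close>
      proof (cases "x + y \<le> - w - y")
        case True
        have "resonant_region w y x" unfolding resonant_region_def p abs
          by (intro conjI; fact)
        then show False using nr(6) by blast
      next
        case False
        then have F: "- w - y \<le> x + y" by linarith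
        have "resonant_region x y w" unfolding resonant_region_def p abs
          by (intro conjI; fact)
        then show False using nr(7) by blast
      qed
    next
      case 3
      then have cw: "449 * c < - w" and w: "9 * x < 10 * (- w)" using cw x by simp_all
      have abs: "\<bar>x + y\<bar> = x + y" "\<bar>x + w\<bar> = x + w" "\<bar>x + w + y\<bar> = - (x + w + y)"
        using w x cw c lw c_def by - linarith+
      have "4 * x + 4 * y \<le> - (x + w + y)" "4 * x + 4 * w \<le> - (x + w + y)"
        using w x cw c lw c_def by - linarith+
      then have le: "x + y \<le> - (x + w + y) / 4" "x + w \<le> - (x + w + y) / 4" by simp_all
      show False
      \<comment> \<open>Now x is the frequency of opposite sign; the smaller of its sums with y and
        w decides which of these is isolated.\<close>
      proof (cases "x + y \<le> x + w")
        case True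
        have "resonant_region w x y" unfolding resonant_region_def p abs
          by (intro conjI; fact)
        then show False using nr(8) by blast
      next
        case False
        then have F: "x + w \<le> x + y" by linarith
        have "resonant_region y x w" unfolding resonant_region_def p abs
          by (intro conjI; fact)
        then show False using nr(9) by blast
      qed
    qed
  qed
qed

lemma sym3_covered: "sym3 covered x y w"
proof -
  have sorted: "sym3 covered x y w" if le: "\<bar>w\<bar> \<le> \<bar>y\<bar>" "\<bar>y\<bar> \<le> \<bar>x\<bar>" for x y w
  proof -
    consider "x > 0" | "x < 0" | "x = 0" by linarith
    then show ?thesis
    proof cases
      case 1
      then show ?thesis using le by (intro sym3_covered_pos) auto
    next
      case 2
      then have "sym3 covered (- x) (- y) (- w)" using le by (intro sym3_covered_pos) auto
      then show ?thesis unfolding sym3_def covered_uminus .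
    next
      case 3
      then have "y = 0" using le by simp
      then show ?thesis using 3 by (simp add: sym3_def covered_def degenerate_region_def)
    qed
  qed
  consider "\<bar>w\<bar> \<le> \<bar>y\<bar>" "\<bar>y\<bar> \<le> \<bar>x\<bar>" | "\<bar>y\<bar> \<le> \<bar>w\<bar>" "\<bar>w\<bar> \<le> \<bar>x\<bar>" | "\<bar>w\<bar> \<le> \<bar>x\<bar>" "\<bar>x\<bar> \<le> \<bar>y\<bar>"
    | "\<bar>x\<bar> \<le> \<bar>w\<bar>" "\<bar>w\<bar> \<le> \<bar>y\<bar>" | "\<bar>x\<bar> \<le> \<bar>y\<bar>" "\<bar>y\<bar> \<le> \<bar>w\<bar>" | "\<bar>y\<bar> \<le> \<bar>x\<bar>" "\<bar>x\<bar> \<le> \<bar>w\<bar>"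
    by linarith
  then show ?thesis
    by cases (use sorted[of w y x] sorted[of y w x] sorted[of w x y] sorted[of x w y] sorted[of x y w] sorted[of y x w] in \<open>auto simp: sym3_def\<close>)
qed

lemma controlled_everything:
  assumes "p \<ge> 2" "\<beta> > 1"
  shows "controlled p \<beta> (\<lambda>_ _ _. True)"
  by (rule controlled_mono[OF controlled_sym3[OF _ controlled_covered[OF assms]]]) (use assms sym3_covered in auto)

section \<open>The trilinear estimate\<close>

text \<open>A function that is not integrable has integral 0 by convention, so integrability need
  not be assumed. This is how the estimate covers points where the convolution might
  diverge.\<close>

lemma ennreal_norm_integral_le:
  fixes f :: "'a \<Rightarrow> 'b::{banach, second_countable_topology}"
  shows "ennreal (norm (integral\<^sup>L M f)) \<le> (\<integral>\<^sup>+x. ennreal (norm (f x)) \<partial>M)"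
  by (cases "integrable M f") (simp_all add: integral_norm_bound_ennreal not_integrable_integral_eq)

lemma dx_triple_measurable:
  assumes "F1 \<in> borel_measurable lborel" "F2 \<in> borel_measurable lborel" "F3 \<in> borel_measurable lborel"
  shows "dx_triple F1 F2 F3 \<in> borel_measurable lborel"
proof -
  have [measurable]: "F1 \<in> borel_measurable borel" "F2 \<in> borel_measurable borel" "F3 \<in> borel_measurable borel"
    using assms by simp_all
  show ?thesis unfolding dx_triple_def[abs_def] by measurable
qed

lemma dx_triple_le:
  assumes "F1 \<in> borel_measurable lborel" "F2 \<in> borel_measurable lborel" "F3 \<in> borel_measurable lborel"
  shows "ennreal (cmod (dx_triple F1 F2 F3 z)) \<le> tri (\<lambda>u v w. ennreal (\<bar>fst z\<bar> * (cmod (F1 u) * cmod (F2 v) * cmod (F3 w)))) z"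
proof -
  have [measurable]: "F1 \<in> borel_measurable borel" "F2 \<in> borel_measurable borel" "F3 \<in> borel_measurable borel"
    using assms by simp_all
  define K where "K q = F1 (fst q) * F2 (snd q) * F3 (fst z - fst (fst q) - fst (snd q), snd z - snd (fst q) - snd (snd q))" for q
  have le1: "1 / (2 * pi) ^ 4 \<le> 1"
  proof -
    have "1 \<le> (2 * pi) ^ 4" using pi_ge_two by (intro one_le_power) linarith
    moreover have "1 / A \<le> 1" if "1 \<le> A" for A :: real using that by simp
    ultimately show ?thesis by blast
  qed
  have "cmod (dx_triple F1 F2 F3 z) = (\<bar>fst z\<bar> * (1 / (2 * pi) ^ 4)) * cmod (integral\<^sup>L lborel K)"
    unfolding dx_triple_def K_def[abs_def] by (simp add: norm_mult norm_divide norm_power)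
  also have "\<dots> \<le> (\<bar>fst z\<bar> * 1) * cmod (integral\<^sup>L lborel K)"
    using le1 by (intro mult_right_mono mult_left_mono) auto
  finally have "ennreal (cmod (dx_triple F1 F2 F3 z)) \<le> ennreal (\<bar>fst z\<bar> * cmod (integral\<^sup>L lborel K))"
    by (intro ennreal_leI) simp
  also have "\<dots> = ennreal \<bar>fst z\<bar> * ennreal (cmod (integral\<^sup>L lborel K))"
    by (simp add: ennreal_mult)
  also have "\<dots> \<le> ennreal \<bar>fst z\<bar> * (\<integral>\<^sup>+q. ennreal (cmod (K q)) \<partial>lborel)"
    by (intro mult_left_mono ennreal_norm_integral_le) simp
  also have "(\<integral>\<^sup>+q. ennreal (cmod (K q)) \<partial>lborel) = (\<integral>\<^sup>+u. \<integral>\<^sup>+v. ennreal (cmod (K (u, v))) \<partial>lborel \<partial>lborel)"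
    unfolding K_def[abs_def] by (rule nn_integral_lborel_pair) measurable
  also have "\<dots> = tri (\<lambda>u v w. ennreal (cmod (F1 u) * cmod (F2 v) * cmod (F3 w))) z"
  proof -
    have "(fst z - fst u - fst v, snd z - snd u - snd v) = z - u - v" for u v by (simp add: prod_eq_iff)
    then show ?thesis unfolding tri_def K_def by (simp add: norm_mult)
  qed
  also have "ennreal \<bar>fst z\<bar> * \<dots> = tri (\<lambda>u v w. ennreal \<bar>fst z\<bar> * ennreal (cmod (F1 u) * cmod (F2 v) * cmod (F3 w))) z"
    by (rule tri_cmult[symmetric]) (unfold measurable3_def, measurable)
  also have "\<dots> = tri (\<lambda>u v w. ennreal (\<bar>fst z\<bar> * (cmod (F1 u) * cmod (F2 v) * cmod (F3 w)))) z"
    by (rule tri_cong) (simp add: ennreal_mult)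
  finally show ?thesis .
qed

lemma japan_sum_le: "japan (x + y + w) \<le> 4 * (japan x * japan y * japan w)"
proof -
  have 1: "1 \<le> japan x" "1 \<le> japan y" "1 \<le> japan w" by (rule japan_ge_1)+
  then have 2: "1 \<le> japan x * japan y" by (metis mult_mono mult_1 zero_le_one order_trans)
  have P: "japan x \<le> japan x * japan y * japan w" "japan y \<le> japan x * japan y * japan w" "japan w \<le> japan x * japan y * japan w" "1 \<le> japan x * japan y * japan w"
  proof -
    have xy: "japan x \<le> japan x * japan y" "japan y \<le> japan x * japan y" using 1 by simp_all
    have "japan x * japan y \<le> japan x * japan y * japan w" using 1 by simp
    then show "japan x \<le> japan x * japan y * japan w" "japan y \<le> japan x * japan y * japan w" "1 \<le> japan x * japan y * japan w" using xy 2 by linarith+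
    show "japan w \<le> japan x * japan y * japan w" using 2 by simp
  qed
  have "japan (x + y + w) \<le> 1 + \<bar>x + y + w\<bar>" by (rule japan_le)
  also have "\<dots> \<le> 1 + japan x + japan y + japan w"
    using abs_le_japan[of x] abs_le_japan[of y] abs_le_japan[of w] by linarith
  also have "\<dots> \<le> 4 * (japan x * japan y * japan w)" using P by linarith
  finally show ?thesis .
qed

lemma weight_root:
  assumes "p > 0" "U = japan x powr (s * p) * m powr (b * p) * a powr p" "m > 0" "a \<ge> 0"
  shows "a = U powr (1/p) * japan x powr - s * m powr - b"
proof -
  have "U powr (1/p) = japan x powr s * m powr b * a"
    unfolding assms(2) using assms by (simp add: powr_mult powr_powr)
  moreover have "japan x powr s * japan x powr - s = 1" "m powr b * m powr - b = 1"
    using assms by (simp_all add: powr_add[symmetric])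
  ultimately show ?thesis by (metis (no_types, opaque_lifting) mult.assoc mult.commute mult_1)
qed

lemma trilinear_pointwise:
  fixes p s b :: real
  assumes p: "p \<ge> 2" and s: "s \<ge> 1 / (2 * p)" and a: "a1 \<ge> 0" "a2 \<ge> 0" "a3 \<ge> 0" and m: "m1 > 0" "m2 > 0" "m3 > 0"
    and U: "U1 = japan x powr (s * p) * m1 powr (b * p) * a1 powr p"
      "U2 = japan y powr (s * p) * m2 powr (b * p) * a2 powr p"
      "U3 = japan w powr (s * p) * m3 powr (b * p) * a3 powr p"
  shows "japan (x + y + w) powr s * (\<bar>x + y + w\<bar> * (a1 * a2 * a3))
     \<le> 4 powr s * ((\<bar>x + y + w\<bar> powr p * freq_mult x y w * (U1 * U2 * U3)) powr (1/p) * (m1 * m2 * m3) powr - b)"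
proof -
  define X P where "X = japan (x + y + w)" and "P = japan x * japan y * japan w"
  have X: "X > 0" and P: "P > 0" by (simp_all add: X_def P_def)
  have s0: "s \<ge> 0" using s p by (meson divide_nonneg_nonneg order_trans zero_le_one mult_nonneg_nonneg zero_le_numeral)
  have pp: "p > 0" using p by simp
  define t where "t = X / P"
  have t: "0 < t" "t \<le> 4" using X P japan_sum_le[of x y w] by (auto simp: t_def X_def P_def pos_divide_le_eq)
  have fm: "freq_mult x y w powr (1/p) = t powr (1 / (2 * p))"
    unfolding freq_mult_def t_def X_def P_def using pp by (simp add: powr_half_sqrt[symmetric] powr_powr)
  \<comment> \<open>Since t \<le> 4, the power of t/4 may be lowered from s to 1/(2p); normalising
    by 4 costs the factor 4 powr s.\<close>
  have "t powr s = 4 powr s * (t / 4) powr s" using t by (simp add: powr_divide)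
  also have "\<dots> \<le> 4 powr s * (t / 4) powr (1 / (2 * p))"
    using t s by (intro mult_left_mono powr_mono') auto
  also have "\<dots> \<le> 4 powr s * t powr (1 / (2 * p))"
    using t pp by (intro mult_left_mono powr_mono2) auto
  finally have ts: "t powr s \<le> 4 powr s * freq_mult x y w powr (1/p)" unfolding fm .
  define V where "V = U1 powr (1/p) * U2 powr (1/p) * U3 powr (1/p)"
  define M where "M = m1 powr - b * m2 powr - b * m3 powr - b"
  have VM: "V \<ge> 0" "M \<ge> 0" by (auto simp: V_def M_def)
  have "a1 * a2 * a3 = (V * M) * (japan x powr - s * japan y powr - s * japan w powr - s)"
    unfolding weight_root[OF pp U(1) m(1) a(1)] weight_root[OF pp U(2) m(2) a(2)] weight_root[OF pp U(3) m(3) a(3)] V_def M_def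
    by (simp only: mult_ac)
  also have "japan x powr - s * japan y powr - s * japan w powr - s = P powr - s"
    unfolding P_def by (simp add: powr_mult)
  finally have aa: "a1 * a2 * a3 = (V * M) * P powr - s" .
  have "X powr s * P powr - s = t powr s"
    using X P by (simp add: t_def powr_divide powr_minus_divide less_imp_le)
  then have "X powr s * (\<bar>x + y + w\<bar> * (a1 * a2 * a3)) = t powr s * (\<bar>x + y + w\<bar> * V * M)"
    unfolding aa by (metis mult.assoc mult.commute)
  also have "\<dots> \<le> (4 powr s * freq_mult x y w powr (1/p)) * (\<bar>x + y + w\<bar> * V * M)"
    using ts VM by (intro mult_right_mono) auto
  also have "\<dots> = 4 powr s * ((\<bar>x + y + w\<bar> powr p * freq_mult x y w * (U1 * U2 * U3)) powr (1/p) * (m1 * m2 * m3) powr - b)"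
  proof -
    have U0: "U1 \<ge> 0" "U2 \<ge> 0" "U3 \<ge> 0" unfolding U by auto
    have "(\<bar>x + y + w\<bar> powr p) powr (1/p) = \<bar>x + y + w\<bar>" using pp by (simp add: powr_powr)
    then have "(\<bar>x + y + w\<bar> powr p * freq_mult x y w * (U1 * U2 * U3)) powr (1/p) = \<bar>x + y + w\<bar> * freq_mult x y w powr (1/p) * V"
      unfolding V_def using U0 by (simp add: powr_mult)
    moreover have "(m1 * m2 * m3) powr - b = M" unfolding M_def using m by (simp add: powr_mult)
    ultimately show ?thesis by (simp only: mult_ac)
  qed
  finally show ?thesis unfolding X_def .
qed

text \<open>Translates the threshold form of \<open>Lp_le\<close> back into a bound for p-th powers.
  The thresholds are positive while \<open>a\<close> may be 0, so finite \<open>a\<close> is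
  approached from above.\<close>

lemma root_le_imp_le:
  fixes y :: real
  assumes "y \<ge> 0" "\<kappa> > 0" "p > 0" and le: "\<And>t. 0 < t \<Longrightarrow> a \<le> ennreal t \<Longrightarrow> y \<le> \<kappa> * t powr (1/p)"
  shows "ennreal (y powr p) \<le> ennreal (\<kappa> powr p) * a"
proof (cases a)
  case (real \<alpha>)
  have "y powr p \<le> \<kappa> powr p * \<alpha> + e" if e: "e > 0" for e
  proof -
    define t where "t = \<alpha> + e / \<kappa> powr p"
    have k: "\<kappa> powr p > 0" using assms by simp
    have t: "t > 0" using real e k by (simp add: t_def add_nonneg_pos)
    have "a \<le> ennreal t" unfolding real(2) t_def using e k by (intro ennreal_leI) simp
    then have "y powr p \<le> (\<kappa> * t powr (1/p)) powr p"
      using le[OF t] assms by (intro powr_mono2) auto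
    also have "\<dots> = \<kappa> powr p * t" using t assms by (simp add: powr_mult powr_powr)
    also have "\<dots> = \<kappa> powr p * \<alpha> + e" using k by (simp add: t_def algebra_simps)
    finally show ?thesis .
  qed
  then have "y powr p \<le> \<kappa> powr p * \<alpha>" by (rule field_le_epsilon)
  then show ?thesis using real by (simp add: ennreal_mult[symmetric] ennreal_leI)
next
  case top
  then show ?thesis using assms by (simp add: ennreal_mult_top)
qed

lemma Xpow_dx_triple:
  fixes r s b b' :: real
  assumes r: "1 < r" "r \<le> 2" and s: "s \<ge> 1/2 - 1/(2*r)" and b': "b' < 0" and b: "b > 1/r"
  obtains K where "K > 0" and "\<And>F1 F2 F3 n1 n2 n3. \<lbrakk>F1 \<in> borel_measurable lborel; F2 \<in> borel_measurable lborel; F3 \<in> borel_measurable lborel;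
     0 < n1; 0 < n2; 0 < n3; Xpow r s b F1 \<le> ennreal n1; Xpow r s b F2 \<le> ennreal n2; Xpow r s b F3 \<le> ennreal n3\<rbrakk>
     \<Longrightarrow> Xpow r s b' (dx_triple F1 F2 F3) \<le> ennreal (K * (n1 * n2 * n3))"
proof -
  define p where "p = conj_exp r"
  have p: "p \<ge> 2" "1/p = 1 - 1/r" using r by (auto simp: p_def conj_exp_def divide_simps)
  have sp: "s \<ge> 1 / (2 * p)"
  proof -
    have "1 / (2 * p) = (1/p) / 2" by simp
    also have "\<dots> = 1/2 - 1/(2*r)" unfolding p(2) by (simp add: diff_divide_distrib)
    finally show ?thesis using s by simp
  qed
  have s0: "s \<ge> 0" using sp p(1) by (meson divide_nonneg_nonneg order_trans zero_le_one mult_nonneg_nonneg zero_le_numeral)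
  \<comment> \<open>As 1 - 1/p = 1/r, this \<beta> satisfies \<beta> (1 - 1/p) = b, and b > 1/r is
    exactly the condition \<beta> > 1 for integrable modulation weights.\<close>
  define \<beta> where "\<beta> = b * r"
  have \<beta>: "\<beta> > 1" "\<beta> * (1 - 1/p) = b" using b r unfolding p(2) by (auto simp: \<beta>_def field_simps)
  obtain C where C: "C > 0" "\<And>U1 U2 U3 n1 n2 n3. mass_le U1 n1 \<Longrightarrow> mass_le U2 n2 \<Longrightarrow> mass_le U3 n3 \<Longrightarrow>
     Lp_le p (tri (trilinear_ker p \<beta> (\<lambda>_ _ _. True) U1 U2 U3)) (C * (n1 * n2 * n3))"
    using controlled_everything[OF p(1) \<beta>(1)] unfolding controlled_def by blast
  define \<kappa> :: real where "\<kappa> = 4 powr s"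
  have \<kappa>: "\<kappa> > 0" by (simp add: \<kappa>_def)
  show thesis
  proof (rule that[of "\<kappa> powr p * C"])
    show "\<kappa> powr p * C > 0" using \<kappa> C by simp
    fix F1 F2 F3 :: "real \<times> real \<Rightarrow> complex" and n1 n2 n3 :: real
    assume F: "F1 \<in> borel_measurable lborel" "F2 \<in> borel_measurable lborel" "F3 \<in> borel_measurable lborel"
      and n: "0 < n1" "0 < n2" "0 < n3"
      and N: "Xpow r s b F1 \<le> ennreal n1" "Xpow r s b F2 \<le> ennreal n2" "Xpow r s b F3 \<le> ennreal n3"
    define U where "U F z = Xweight r s b z * cmod (F z) powr p" for F :: "real \<times> real \<Rightarrow> complex" and z
    have mass: "mass_le (U F) n" if "F \<in> borel_measurable lborel" "0 < n" "Xpow r s b F \<le> ennreal n" for F n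
    proof -
      have [measurable]: "F \<in> borel_measurable borel" using that by simp
      have "U F \<in> borel_measurable borel" unfolding U_def[abs_def] Xweight_def by measurable
      then show ?thesis using that by (simp add: mass_le_def U_def Xweight_def Xpow_def p_def)
    qed
    define T where "T = tri (trilinear_ker p \<beta> (\<lambda>_ _ _. True) (U F1) (U F2) (U F3))"
    obtain a where a [measurable]: "a \<in> borel_measurable borel" and Ia: "(\<integral>\<^sup>+z. a z \<partial>lborel) \<le> ennreal (C * (n1 * n2 * n3))"
      and Ta: "\<And>z t. 0 < t \<Longrightarrow> a z \<le> ennreal t \<Longrightarrow> T z \<le> ennreal (t powr (1/p))"
      using C(2)[OF mass[OF F(1) n(1) N(1)] mass[OF F(2) n(2) N(2)] mass[OF F(3) n(3) N(3)]] unfolding Lp_le_def T_def by blast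
    have UF: "U F u = japan (fst u) powr (s * p) * modulation u powr (b * p) * cmod (F u) powr p" for F u
      by (simp add: U_def Xweight_def modulation_def p_def)
    have main: "ennreal (japan (fst z) powr s * cmod (dx_triple F1 F2 F3 z)) \<le> ennreal \<kappa> * T z" for z
    proof -
      have mF: "F1 \<in> borel_measurable borel" "F2 \<in> borel_measurable borel" "F3 \<in> borel_measurable borel" using F by simp_all
      note [measurable] = mF
      have "ennreal (japan (fst z) powr s * cmod (dx_triple F1 F2 F3 z))
         \<le> ennreal (japan (fst z) powr s) * tri (\<lambda>u v w. ennreal (\<bar>fst z\<bar> * (cmod (F1 u) * cmod (F2 v) * cmod (F3 w)))) z"
        by (subst ennreal_mult) (auto intro!: mult_left_mono dx_triple_le F)
      also have "\<dots> = tri (\<lambda>u v w. ennreal (japan (fst z) powr s) * ennreal (\<bar>fst z\<bar> * (cmod (F1 u) * cmod (F2 v) * cmod (F3 w)))) z"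
        by (rule tri_cmult[symmetric]) (unfold measurable3_def, measurable)
      also have "\<dots> \<le> tri (\<lambda>u v w. ennreal \<kappa> * trilinear_ker p \<beta> (\<lambda>_ _ _. True) (U F1) (U F2) (U F3) u v w) z"
      proof (rule tri_mono)
        fix u v w :: "real \<times> real" assume "u + v + w = z"
        then have z: "fst z = fst u + fst v + fst w" by auto
        have nb: "- \<beta> * (1 - 1/p) = - b" using \<beta>(2) by simp
        have "japan (fst z) powr s * (\<bar>fst z\<bar> * (cmod (F1 u) * cmod (F2 v) * cmod (F3 w)))
          \<le> \<kappa> * ((\<bar>fst u + fst v + fst w\<bar> powr p * freq_mult (fst u) (fst v) (fst w) * (U F1 u * U F2 v * U F3 w)) powr (1/p) * (modulation u * modulation v * modulation w) powr - b)"
          unfolding z \<kappa>_def by (rule trilinear_pointwise[OF p(1) sp _ _ _ _ _ _ UF UF UF]) auto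
        then show "ennreal (japan (fst z) powr s) * ennreal (\<bar>fst z\<bar> * (cmod (F1 u) * cmod (F2 v) * cmod (F3 w)))
          \<le> ennreal \<kappa> * trilinear_ker p \<beta> (\<lambda>_ _ _. True) (U F1) (U F2) (U F3) u v w"
          unfolding trilinear_ker_def nb if_True
          using \<kappa> by (subst (1 2) ennreal_mult[symmetric]) (auto intro: ennreal_leI)
      qed
      also have "\<dots> = ennreal \<kappa> * T z"
        unfolding T_def
        by (rule tri_cmult, rule trilinear_ker_measurable3[OF _ mass[OF F(1) n(1) N(1)] mass[OF F(2) n(2) N(2)] mass[OF F(3) n(3) N(3)]])
           (simp add: pred3_def)
      finally show ?thesis .
    qed
    have pt: "ennreal (Xweight r s b' z * cmod (dx_triple F1 F2 F3 z) powr conj_exp r) \<le> ennreal (\<kappa> powr p) * a z" for z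
    proof -
      define y where "y = japan (fst z) powr s * cmod (dx_triple F1 F2 F3 z)"
      have y0: "y \<ge> 0" by (simp add: y_def)
      have "y \<le> \<kappa> * t powr (1/p)" if t: "0 < t" "a z \<le> ennreal t" for t
      proof -
        have "ennreal y \<le> ennreal \<kappa> * ennreal (t powr (1/p))"
          unfolding y_def by (rule order_trans[OF main mult_left_mono[OF Ta[OF t]]]) simp
        also have "\<dots> = ennreal (\<kappa> * t powr (1/p))" using \<kappa> by (simp add: ennreal_mult)
        finally show ?thesis using \<kappa> by (subst (asm) ennreal_le_iff) auto
      qed
      then have le: "ennreal (y powr p) \<le> ennreal (\<kappa> powr p) * a z"
        using y0 \<kappa> p(1) by (intro root_le_imp_le) auto
      have "japan (snd z - (fst z) ^ 3) powr (b' * p) \<le> 1"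
        using b' p(1) japan_ge_1[of "snd z - (fst z) ^ 3"] powr_mono2'[of "b' * p" 1 "japan (snd z - (fst z) ^ 3)"]
        by (simp add: mult_nonpos_nonneg)
      then have "Xweight r s b' z * cmod (dx_triple F1 F2 F3 z) powr conj_exp r \<le> (japan (fst z) powr (s * p) * 1) * cmod (dx_triple F1 F2 F3 z) powr p"
        unfolding Xweight_def p_def[symmetric] by (intro mult_right_mono mult_left_mono) auto
      also have "\<dots> = y powr p" by (simp add: y_def powr_mult powr_powr)
      finally show ?thesis using le by (meson ennreal_leI order_trans)
    qed
    have "Xpow r s b' (dx_triple F1 F2 F3) \<le> (\<integral>\<^sup>+z. ennreal (\<kappa> powr p) * a z \<partial>lborel)"
      unfolding Xpow_def by (intro nn_integral_mono pt)
    also have "\<dots> = ennreal (\<kappa> powr p) * (\<integral>\<^sup>+z. a z \<partial>lborel)" by (rule nn_integral_cmult) measurable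
    also have "\<dots> \<le> ennreal (\<kappa> powr p) * ennreal (C * (n1 * n2 * n3))" by (intro mult_left_mono Ia) simp
    also have "\<dots> = ennreal (\<kappa> powr p * C * (n1 * n2 * n3))"
      using C n by (simp add: ennreal_mult[symmetric] mult.assoc)
    finally show "Xpow r s b' (dx_triple F1 F2 F3) \<le> ennreal (\<kappa> powr p * C * (n1 * n2 * n3))" .
  qed
qed

theorem theorem2:
  fixes r s b b' :: real
  assumes "1 < r" and "r \<le> 2"
    and "s \<ge> 1/2 - 1/(2*r)"
    and "b' < 0" and "b > 1/r"
  shows "\<exists>c. \<forall>F1 \<in> Xspace r s b. \<forall>F2 \<in> Xspace r s b. \<forall>F3 \<in> Xspace r s b.
           dx_triple F1 F2 F3 \<in> Xspace r s b' \<and>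
           Xnorm r s b' (dx_triple F1 F2 F3)
             \<le> c * Xnorm r s b F1 * Xnorm r s b F2 * Xnorm r s b F3"
proof -
  obtain K where K: "K > 0" "\<And>F1 F2 F3 n1 n2 n3. \<lbrakk>F1 \<in> borel_measurable lborel; F2 \<in> borel_measurable lborel; F3 \<in> borel_measurable lborel;
     0 < n1; 0 < n2; 0 < n3; Xpow r s b F1 \<le> ennreal n1; Xpow r s b F2 \<le> ennreal n2; Xpow r s b F3 \<le> ennreal n3\<rbrakk>
     \<Longrightarrow> Xpow r s b' (dx_triple F1 F2 F3) \<le> ennreal (K * (n1 * n2 * n3))"
    using Xpow_dx_triple[OF assms] by metis
  define q where "q = 1 / conj_exp r"
  have q: "q \<ge> 0" using assms by (simp add: q_def conj_exp_def)
  show ?thesis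
  proof (intro exI[of _ "K powr q"] ballI)
    fix F1 F2 F3 assume F: "F1 \<in> Xspace r s b" "F2 \<in> Xspace r s b" "F3 \<in> Xspace r s b"
    then have m: "F1 \<in> borel_measurable lborel" "F2 \<in> borel_measurable lborel" "F3 \<in> borel_measurable lborel"
      by (auto simp: Xspace_def)
    define N where "N F = enn2real (Xpow r s b F)" for F
    have N0: "N F \<ge> 0" for F by (simp add: N_def)
    \<comment> \<open>The masses have to be positive, but a norm may vanish; hence N + e with e > 0,
      and the limit e -> 0 at the end.\<close>
    have N: "Xpow r s b F \<le> ennreal (N F + e)" if "F \<in> Xspace r s b" "e > 0" for F e
      using that by (auto simp: Xspace_def N_def ennreal_enn2real_if intro: order_trans[OF _ ennreal_leI])
    have le: "Xpow r s b' (dx_triple F1 F2 F3) \<le> ennreal (K * ((N F1 + e) * (N F2 + e) * (N F3 + e)))" if "e > 0" for e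
      using that N0 F by (intro K m N) (auto intro: add_nonneg_pos)
    have fin: "Xpow r s b' (dx_triple F1 F2 F3) < \<infinity>"
      using le[of 1] by (auto simp: less_top[symmetric] top_unique)
    define Y where "Y = enn2real (Xpow r s b' (dx_triple F1 F2 F3))"
    have Y0: "Y \<ge> 0" by (simp add: Y_def)
    have Ye: "Y \<le> K * ((N F1 + e) * (N F2 + e) * (N F3 + e))" if "e > 0" for e
      unfolding Y_def using le[OF that] that N0 K(1) by (intro enn2real_leI) (auto intro!: mult_nonneg_nonneg add_nonneg_nonneg)
    have ev: "\<forall>\<^sub>F e in at_right 0. Y \<le> K * ((N F1 + e) * (N F2 + e) * (N F3 + e))"
      by (rule eventually_mono[OF eventually_at_right_less]) (rule Ye)
    have "((\<lambda>e. K * ((N F1 + e) * (N F2 + e) * (N F3 + e))) \<longlongrightarrow> K * ((N F1 + 0) * (N F2 + 0) * (N F3 + 0))) (at_right 0)"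
      by (intro tendsto_intros)
    from tendsto_lowerbound[OF this ev] have "Y \<le> K * (N F1 * N F2 * N F3)" by simp
    then have "Y powr q \<le> (K * (N F1 * N F2 * N F3)) powr q"
      using Y0 q by (intro powr_mono2)
    also have "\<dots> = K powr q * N F1 powr q * N F2 powr q * N F3 powr q"
      using K(1) N0 by (simp add: powr_mult)
    finally have "Xnorm r s b' (dx_triple F1 F2 F3) \<le> K powr q * Xnorm r s b F1 * Xnorm r s b F2 * Xnorm r s b F3"
      by (simp add: Xnorm_def Y_def N_def q_def)
    moreover have "dx_triple F1 F2 F3 \<in> Xspace r s b'"
      using fin dx_triple_measurable[OF m] by (simp add: Xspace_def)
    ultimately show "dx_triple F1 F2 F3 \<in> Xspace r s b' \<and> Xnorm r s b' (dx_triple F1 F2 F3) \<le> K powr q * Xnorm r s b F1 * Xnorm r s b F2 * Xnorm r s b F3"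
      by simp
  qed
qed

end
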